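(* If $d\ge1$ and $q\in(2,2^* )$, or $d\ge3$ and $q=2^*$, then $$K_{q,\mathbb V^d_1}\ge K_{q,\mathbb R^d}.$$ Furthermore, for every $d\ge1$ and $q\in(2,2^* )$, if there exists $u\in H^1(\mathbb V^d_1)\setminus\{0\}$ such that $Q_{q,\mathbb V^d_1}(u)\ge K_{q,\mathbb R^d}$, then $K_{q,\mathbb V^d_1}$ is attained.
   Context: $2^*=\infty$ if $d=1,2$ and $2^*=\frac{2d}{d-2}$ if $d\ge3$. $\mathbb V^d_1=\mathbb Z^d$, with $x\sim y$ iff $\sum_{i=1}^d|x_i-y_i|=1$; $\|\cdot\|_{\ell^q(\mathbb V^d_1)}$ is the usual $\ell^q(\mathbb Z^d)$ norm and $\|\nabla^d_1u\|^2_{\ell^2(\mathbb V^d_1)}=\frac12\sum_{x\in\mathbb Z^d}\sum_{y\sim x}|u(y)-u(x)|^2$. $H^1(\mathbb V^d_1)$ is the completion of the finitely supported real functions under $(\|\nabla^d_1u\|^2_{\ell^2}+\|u\|^2_{\ell^2})^{1/2}$, and (for $d\ge3$) $D^{1,2}(\mathbb V^d_1)$ is the completion of the finitely supported functions under $\|\nabla^d_1u\|_{\ell^2}$. For $d\ge1$, $q\in(2,2^* )$: $$Q_{q,\mathbb V^d_1}(u)=\frac{\|u\|^q_{\ell^q}}{\|u\|_{\ell^2}^{d+(2-d)\frac q2}\|\nabla^d_1u\|_{\ell^2}^{(\frac q2-1)d}}\ (u\in H^1(\mathbb V^d_1)\setminus\{0\}),\qquad Q_{q,\mathbb R^d}(v)=\frac{\|v\|^q_{L^q}}{\|v\|_{L^2}^{d+(2-d)\frac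 q2}\|\nabla v\|_{L^2}^{(\frac q2-1)d}}\ (v\in H^1(\mathbb R^d)\setminus\{0\}),$$ and $K_{q,\mathbb V^d_1}=\sup_{H^1(\mathbb V^d_1)\setminus\{0\}}Q_{q,\mathbb V^d_1}$, $K_{q,\mathbb R^d}=\sup_{H^1(\mathbb R^d)\setminus\{0\}}Q_{q,\mathbb R^d}$. For $d\ge3$, $q=2^*$: $$Q_{2^*,\mathbb V^d_1}(u)=\frac{\|u\|^{2^*}_{\ell^{2^*}}}{\|\nabla^d_1u\|^{2^*}_{\ell^2}}\ (u\in D^{1,2}(\mathbb V^d_1)\setminus\{0\}),\qquad Q_{2^*,\mathbb R^d}(v)=\frac{\|v\|^{2^*}_{L^{2^*}}}{\|\nabla v\|^{2^*}_{L^2}}\ (v\in D^{1,2}(\mathbb R^d)\setminus\{0\}),$$ and $K_{2^*,\mathbb V^d_1}$, $K_{2^*,\mathbb R^d}$ are the corresponding suprema over $D^{1,2}(\mathbb V^d_1)\setminus\{0\}$ and $D^{1,2}(\mathbb R^d)\setminus\{0\}$ (where $D^{1,2}(\mathbb R^d)$ is the usual homogeneous Sobolev space). "$K_{q,\mathbb V^d_1}$ is attained" means that the supremum is a maximum. *)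

theory Defs
  imports "HOL-Analysis.Analysis"
begin

text \<open>
  The dimension is \<open>d = CARD('d)\<close> for a finite index type \<open>'d\<close>: the lattice is
  \<open>int ^ 'd\<close> and Euclidean space is \<open>real ^ 'd\<close>.
\<close>

definition two_star :: "nat \<Rightarrow> ereal" where
  "two_star d = (if d \<le> 2 then \<infinity> else ereal (2 * real d / (real d - 2)))"


section \<open>The lattice\<close>

definition adj :: "int ^ 'd::finite \<Rightarrow> int ^ 'd \<Rightarrow> bool" where
  "adj x y \<longleftrightarrow> (\<Sum>i\<in>UNIV. \<bar>x $ i - y $ i\<bar>) = 1"

definition lq_norm :: "real \<Rightarrow> (int ^ 'd::finite \<Rightarrow> real) \<Rightarrow> real" where
  "lq_norm q u = (\<Sum>\<^sub>\<infinity>x. \<bar>u x\<bar> powr q) powr (1 / q)"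

definition grad_norm :: "(int ^ 'd::finite \<Rightarrow> real) \<Rightarrow> real" where
  "grad_norm u = sqrt (1/2 * (\<Sum>\<^sub>\<infinity>x. \<Sum>y\<in>{y. adj x y}. \<bar>u y - u x\<bar>\<^sup>2))"

text \<open>
  Completion of the finitely supported functions under \<open>N\<close>, realised as a space of functions:
  the pointwise limits of \<open>N\<close>-Cauchy sequences. For the two norms used below (the second one only
  for \<open>d \<ge> 3\<close>, by the discrete Sobolev inequality) \<open>N\<close> controls point values, a Cauchy
  sequence is determined up to null sequences by its pointwise limit \<open>u\<close>, and the norm of its
  class is \<open>N u\<close>.
\<close>

definition completion_fin_supp ::
    "((int ^ 'd::finite \<Rightarrow> real) \<Rightarrow> real) \<Rightarrow> (int ^ 'd \<Rightarrow> real) set" where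
  "completion_fin_supp N = {u. \<exists>\<phi> :: nat \<Rightarrow> int ^ 'd \<Rightarrow> real.
      (\<forall>n. finite {x. \<phi> n x \<noteq> 0}) \<and>
      (\<forall>e>0. \<exists>M. \<forall>m\<ge>M. \<forall>n\<ge>M. N (\<lambda>x. \<phi> m x - \<phi> n x) < e) \<and>
      (\<forall>x. (\<lambda>n. \<phi> n x) \<longlonglongrightarrow> u x)}"

definition H1_lattice :: "(int ^ 'd::finite \<Rightarrow> real) set" where
  "H1_lattice = completion_fin_supp (\<lambda>u. sqrt ((grad_norm u)\<^sup>2 + (lq_norm 2 u)\<^sup>2))"

definition D12_lattice :: "(int ^ 'd::finite \<Rightarrow> real) set" where
  "D12_lattice = completion_fin_supp grad_norm"

definition Q_lattice :: "real \<Rightarrow> (int ^ 'd::finite \<Rightarrow> real) \<Rightarrow> real" where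
  "Q_lattice q u = (let d = real CARD('d) in
     if ereal q < two_star CARD('d)
     then lq_norm q u powr q /
       (lq_norm 2 u powr (d + (2 - d) * (q / 2)) * grad_norm u powr ((q / 2 - 1) * d))
     else lq_norm q u powr q / grad_norm u powr q)"

definition K_lattice :: "'d::finite itself \<Rightarrow> real \<Rightarrow> ereal" where
  "K_lattice _ q =
     (SUP u \<in> (if ereal q < two_star CARD('d) then H1_lattice else D12_lattice) - {\<lambda>_ :: int ^ 'd. 0}.
        ereal (Q_lattice q u))"


section \<open>Euclidean space\<close>

text \<open>
  Lebesgue and Sobolev functions are represented by Borel functions; equality in these spaces is
  equality almost everywhere.
\<close>

definition in_Lp :: "real \<Rightarrow> (real ^ 'd::finite \<Rightarrow> 'b::euclidean_space) \<Rightarrow> bool" where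
  "in_Lp p f \<longleftrightarrow> f \<in> borel_measurable lborel \<and> integrable lborel (\<lambda>x. norm (f x) powr p)"

definition Lp_norm :: "real \<Rightarrow> (real ^ 'd::finite \<Rightarrow> 'b::euclidean_space) \<Rightarrow> real" where
  "Lp_norm p f = (\<integral>x. norm (f x) powr p \<partial>lborel) powr (1 / p)"

definition partial_deriv :: "'d::finite \<Rightarrow> (real ^ 'd \<Rightarrow> real) \<Rightarrow> real ^ 'd \<Rightarrow> real" where
  "partial_deriv i f x = frechet_derivative f (at x) (axis i 1)"

primrec C_k :: "nat \<Rightarrow> (real ^ 'd::finite \<Rightarrow> real) \<Rightarrow> bool" where
  "C_k 0 f \<longleftrightarrow> continuous_on UNIV f"
| "C_k (Suc k) f \<longleftrightarrow> (\<forall>x. f differentiable at x) \<and> (\<forall>i. C_k k (partial_deriv i f))"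

definition test_function :: "(real ^ 'd::finite \<Rightarrow> real) \<Rightarrow> bool" where
  "test_function \<phi> \<longleftrightarrow> (\<forall>k. C_k k \<phi>) \<and> compact (closure {x. \<phi> x \<noteq> 0})"

definition locally_integrable :: "(real ^ 'd::finite \<Rightarrow> 'b::euclidean_space) \<Rightarrow> bool" where
  "locally_integrable f \<longleftrightarrow> (\<forall>S. compact S \<longrightarrow> set_integrable lborel S f)"

definition has_weak_gradient ::
    "(real ^ 'd::finite \<Rightarrow> real) \<Rightarrow> (real ^ 'd \<Rightarrow> real ^ 'd) \<Rightarrow> bool" where
  "has_weak_gradient v g \<longleftrightarrow> locally_integrable v \<and> locally_integrable g \<and>
     (\<forall>\<phi> i. test_function \<phi> \<longrightarrow>
        (\<integral>x. v x * partial_deriv i \<phi> x \<partial>lborel) = - (\<integral>x. g x $ i * \<phi> x \<partial>lborel))"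

text \<open>The choice below is immaterial, since weak gradients are unique almost everywhere.\<close>

definition weak_gradient :: "(real ^ 'd::finite \<Rightarrow> real) \<Rightarrow> real ^ 'd \<Rightarrow> real ^ 'd" where
  "weak_gradient v = (SOME g. has_weak_gradient v g)"

definition H1_euclid :: "(real ^ 'd::finite \<Rightarrow> real) set" where
  "H1_euclid = {v. in_Lp 2 v \<and> (\<exists>g. has_weak_gradient v g) \<and> in_Lp 2 (weak_gradient v)}"

text \<open>
  Only meaningful for \<open>d \<ge> 3\<close>: the homogeneous Sobolev space, as the functions in
  \<open>L\<^sup>2\<^sup>*\<close> whose weak gradient is in \<open>L\<^sup>2\<close>.
\<close>

definition D12_euclid :: "(real ^ 'd::finite \<Rightarrow> real) set" where
  "D12_euclid = {v. in_Lp (real_of_ereal (two_star CARD('d))) v \<and>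
     (\<exists>g. has_weak_gradient v g) \<and> in_Lp 2 (weak_gradient v)}"

definition Q_euclid :: "real \<Rightarrow> (real ^ 'd::finite \<Rightarrow> real) \<Rightarrow> real" where
  "Q_euclid q v = (let d = real CARD('d) in
     if ereal q < two_star CARD('d)
     then Lp_norm q v powr q /
       (Lp_norm 2 v powr (d + (2 - d) * (q / 2)) *
        Lp_norm 2 (weak_gradient v) powr ((q / 2 - 1) * d))
     else Lp_norm q v powr q / Lp_norm 2 (weak_gradient v) powr q)"

definition K_euclid :: "'d::finite itself \<Rightarrow> real \<Rightarrow> ereal" where
  "K_euclid _ q =
     (SUP v \<in> (if ereal q < two_star CARD('d) then H1_euclid else D12_euclid)
               - {v :: real ^ 'd \<Rightarrow> real. AE x in lborel. v x = 0}.
        ereal (Q_euclid q v))"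

end

theory Submission
  imports Defs "HOL-Complex_Analysis.Great_Picard"
begin

text \<open>
  Both directions between the lattice and Euclidean space use the same smooth compactly supported
  partitions of unity, and by Jensen's inequality neither increases the norms in the denominator
  of the quotient.

  For \<open>K_lattice \<ge> K_euclid\<close>, average a Sobolev function \<open>v\<close> over the cells of \<open>h \<int>\<^sup>d\<close>. The \<open>\<ell>\<^sup>2\<close> norm
  and the discrete gradient are bounded by the scaled norms of \<open>v\<close> and its weak gradient, the step
  functions converge to \<open>v\<close> almost everywhere along a sequence of meshes, and Fatou's lemma bounds
  the \<open>\<ell>\<^sup>q\<close> norm from below.

  For attainment, assume \<open>K_lattice > K_euclid\<close>, as otherwise the given function is a maximizer.
  Smooth interpolation shows that the quotient of \<open>u\<close> is at most about \<open>K_euclid\<close> if the gradient of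
  \<open>u\<close> is small compared with \<open>u\<close>; here \<open>q\<close> subcritical is needed. So the gradients of a normalized maximizing
  sequence are bounded below, \<open>K_lattice\<close> is finite, and after translation the sequence has values
  at the origin bounded away from zero. Its pointwise limit along a subsequence is a maximizer, by
  the Brezis--Lieb lemma and the superadditivity of \<open>x\<^sup>a y\<^sup>b\<close> for \<open>a + b \<ge> 1\<close>.
\<close>

section \<open>Smooth kernels on the line\<close>

text \<open>No Sobolev or Gagliardo-Nirenberg inequality is proved from scratch. For attainment, the
  quotient of the given function is a real upper bound for \<open>K_euclid\<close>, and this bound
  is itself a Euclidean inequality that applies to every interpolant. Let N be the squared l2 norm
  and E the squared gradient norm. The denominator of the subcritical quotient is N powr a * E powr
  b with a + b = q / 2. Replacing a lattice function by its interpolant costs an error of order E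
  powr (q / 2), which is E powr a * E powr b. It is negligible against the denominator for small E /
  N because a > 0, and a > 0 is what subcriticality means. For E / N bounded below, the quotient is
  bounded because on the lattice l2 embeds in lq without any gradient. The kernels have to be smooth
  because weak gradients are tested with infinitely differentiable functions. Two of them are needed
  because a difference on the lattice and a derivative in space differ by one averaging over a unit
  interval.\<close>

primrec smooth_upto :: "nat \<Rightarrow> (real \<Rightarrow> real) \<Rightarrow> bool" where
  "smooth_upto 0 f \<longleftrightarrow> True"
| "smooth_upto (Suc k) f \<longleftrightarrow> (\<exists>f'. (\<forall>t. (f has_real_derivative f' t) (at t)) \<and> smooth_upto k f')"

text \<open>Each stage only asks that a derivative exists everywhere; over all \<open>k\<close> this
  amounts to infinite differentiability. The existential form lets a known derivative be supplied as
  a witness, as in \<open>smooth_antideriv\<close>.\<close>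

definition smooth :: "(real \<Rightarrow> real) \<Rightarrow> bool" where
  "smooth f \<longleftrightarrow> (\<forall>k. smooth_upto k f)"

lemma smooth_upto_Suc_D: "smooth_upto (Suc k) f \<Longrightarrow> smooth_upto k f"
  by (induction k arbitrary: f) auto

lemma smooth_has_derivative:
  assumes "smooth f" shows "(f has_real_derivative deriv f t) (at t)"
proof -
  have "smooth_upto (Suc 0) f" using assms unfolding smooth_def by blast
  then obtain f' where "\<forall>t. (f has_real_derivative f' t) (at t)" by auto
  thus ?thesis using DERIV_imp_deriv[of f "f' t" t] by simp
qed

lemma smooth_deriv:
  assumes "smooth f" shows "smooth (deriv f)"
  unfolding smooth_def
proof
  fix k
  have "smooth_upto (Suc k) f" using assms by (auto simp: smooth_def)
  then obtain f' where f': "\<And>t. (f has_real_derivative f' t) (at t)" "smooth_upto k f'" by auto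
  have "f' = deriv f" using DERIV_imp_deriv[OF f'(1)] by (simp add: fun_eq_iff)
  thus "smooth_upto k (deriv f)" using f' by simp
qed

lemma smooth_antideriv:
  assumes "\<And>t. (f has_real_derivative f' t) (at t)" "smooth f'"
  shows "smooth f"
  unfolding smooth_def
proof
  fix k show "smooth_upto k f"
    using assms by (cases k) (auto simp: smooth_def)
qed

lemma smooth_imp_continuous: "smooth f \<Longrightarrow> continuous_on S f"
  by (meson DERIV_isCont continuous_at_imp_continuous_on smooth_has_derivative)

lemma smooth_upto_const: "smooth_upto k (\<lambda>_. c)"
proof (induction k arbitrary: c)
  case (Suc k)
  show ?case using Suc[of 0] by (auto intro!: exI[of _ "\<lambda>_. 0"])
qed auto

lemma smooth_upto_add:
  "smooth_upto k f \<Longrightarrow> smooth_upto k g \<Longrightarrow> smooth_upto k (\<lambda>t. f t + g t)"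
proof (induction k arbitrary: f g)
  case (Suc k)
  then obtain f' g' where "\<And>t. (f has_real_derivative f' t) (at t)" "smooth_upto k f'"
    "\<And>t. (g has_real_derivative g' t) (at t)" "smooth_upto k g'" by auto
  thus ?case using Suc.IH[of f' g'] by (auto intro!: exI[of _ "\<lambda>t. f' t + g' t"] DERIV_add)
qed auto

lemma smooth_upto_mult:
  "smooth_upto k f \<Longrightarrow> smooth_upto k g \<Longrightarrow> smooth_upto k (\<lambda>t. f t * g t)"
proof (induction k arbitrary: f g)
  case (Suc k)
  then obtain f' g' where *: "\<And>t. (f has_real_derivative f' t) (at t)" "smooth_upto k f'"
    "\<And>t. (g has_real_derivative g' t) (at t)" "smooth_upto k g'" by auto
  have "smooth_upto k (\<lambda>t. f' t * g t + g' t * f t)"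
    using Suc.prems * by (intro smooth_upto_add Suc.IH) (auto intro: smooth_upto_Suc_D simp del: smooth_upto.simps)
  thus ?case using * by (auto intro!: exI[of _ "\<lambda>t. f' t * g t + g' t * f t"] DERIV_mult)
qed auto

lemma smooth_upto_affine:
  "smooth_upto k f \<Longrightarrow> smooth_upto k (\<lambda>t. f (a * t + b))"
proof (induction k arbitrary: f)
  case (Suc k)
  then obtain f' where *: "\<And>t. (f has_real_derivative f' t) (at t)" "smooth_upto k f'" by auto
  have "((\<lambda>t. f (a * t + b)) has_real_derivative f' (a * t + b) * a) (at t)" for t
    by (rule DERIV_chain2[where f = f]) (auto intro!: derivative_eq_intros *)
  moreover have "smooth_upto k (\<lambda>t. f' (a * t + b) * a)"
    by (intro smooth_upto_mult smooth_upto_const Suc.IH *)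
  ultimately show ?case unfolding smooth_upto.simps
    by (intro exI[of _ "\<lambda>t. f' (a * t + b) * a"]) blast
qed auto

lemma smooth_const: "smooth (\<lambda>_. c)"
  and smooth_add: "smooth f \<Longrightarrow> smooth g \<Longrightarrow> smooth (\<lambda>t. f t + g t)"
  and smooth_mult: "smooth f \<Longrightarrow> smooth g \<Longrightarrow> smooth (\<lambda>t. f t * g t)"
  and smooth_affine: "smooth f \<Longrightarrow> smooth (\<lambda>t. f (a * t + b))"
  by (auto simp: smooth_def smooth_upto_const smooth_upto_add smooth_upto_mult smooth_upto_affine)

lemma smooth_diff: "smooth f \<Longrightarrow> smooth g \<Longrightarrow> smooth (\<lambda>t. f t - g t)"
  using smooth_add[of f "\<lambda>t. (-1) * g t"] smooth_mult[OF smooth_const, of g "-1"] by simp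

lemma smooth_shift: "smooth f \<Longrightarrow> smooth (\<lambda>t. f (t - b))"
  using smooth_affine[of f 1 "-b"] by simp

text \<open>A family closed under differentiation.\<close>

definition flat :: "real poly \<Rightarrow> real \<Rightarrow> real" where
  "flat p t = (if t > 0 then poly p (1 / t) * exp (- (1 / t)) else 0)"

lemma poly_times_exp_minus_tendsto_0: "((\<lambda>s. poly p s * exp (- s :: real)) \<longlongrightarrow> 0) at_top"
proof (induction p)
  case (pCons a p)
  have *: "((\<lambda>s. poly p s * s * exp (- s :: real)) \<longlongrightarrow> 0) at_top" for p
  proof -
    have "((\<lambda>s. \<Sum>i\<le>degree p. coeff p i * (s ^ Suc i / exp s)) \<longlongrightarrow> (\<Sum>i\<le>degree p. coeff p i * 0)) at_top"
      by (intro tendsto_intros tendsto_power_div_exp_0)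
    moreover have "(\<lambda>s. \<Sum>i\<le>degree p. coeff p i * (s ^ Suc i / exp s)) = (\<lambda>s. poly p s * s * exp (- s :: real))"
      by (auto simp: fun_eq_iff poly_altdef sum_distrib_right sum_distrib_left exp_minus divide_simps algebra_simps)
    ultimately show ?thesis by simp
  qed
  have "((\<lambda>s. a * (s ^ 0 / exp s) + poly p s * s * exp (- s)) \<longlongrightarrow> a * 0 + 0) at_top"
    by (intro tendsto_intros tendsto_power_div_exp_0 *)
  thus ?case by (simp add: algebra_simps exp_minus divide_simps)
qed auto

text \<open>With s = 1 / t, differentiating p(s) exp(-s) in t gives s^2 (p(s) - p'(s)) exp(-s),
  hence the polynomial X^2 (p - p'). At t = 0 the exponential decay beats every power of s.\<close>

lemma flat_has_derivative:
  "(flat p has_real_derivative flat ([:0, 0, 1:] * (p - pderiv p)) t) (at t)"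
proof (cases t "0 :: real" rule: linorder_cases)
  case greater
  have "((\<lambda>t. poly p (1 / t) * exp (- (1 / t))) has_real_derivative
     flat ([:0, 0, 1:] * (p - pderiv p)) t) (at t)"
    using greater
    by (auto intro!: derivative_eq_intros DERIV_chain2[OF poly_DERIV] simp: flat_def field_simps power2_eq_square)
  moreover have "\<forall>\<^sub>F s in nhds t. poly p (1 / s) * exp (- (1 / s)) = flat p s"
    using eventually_nhds_in_open[of "{0<..}" t] greater by (auto elim!: eventually_mono simp: flat_def)
  ultimately show ?thesis by (subst (asm) DERIV_cong_ev[OF refl _ refl]) auto
next
  case less
  have "((\<lambda>t. 0) has_real_derivative 0) (at t)" by simp
  moreover have "\<forall>\<^sub>F s in nhds t. 0 = flat p s"
    using eventually_nhds_in_open[of "{..<0}" t] less by (auto elim!: eventually_mono simp: flat_def)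
  ultimately show ?thesis using less by (subst (asm) DERIV_cong_ev[OF refl _ refl]) (auto simp: flat_def)
next
  case equal
  \<comment> \<open>\<open>pCons 0 p\<close> is X p, so the expression is the right-hand difference
    quotient of \<open>flat p\<close> at 0.\<close>
  have "((\<lambda>s. poly (pCons 0 p) (inverse s) * exp (- inverse s)) \<longlongrightarrow> 0) (at_right 0)"
    using filterlim_compose[OF poly_times_exp_minus_tendsto_0 filterlim_inverse_at_top_right] .
  hence "((\<lambda>h. (flat p (0 + h) - flat p 0) / h) \<longlongrightarrow> 0) (at_right 0)"
    by (rule Lim_transform_eventually)
      (auto simp: eventually_at_right_field flat_def field_simps intro!: exI[of _ 1])
  moreover have "((\<lambda>h. (flat p (0 + h) - flat p 0) / h) \<longlongrightarrow> 0) (at_left 0)"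
    by (rule Lim_transform_eventually[OF tendsto_const])
      (auto simp: eventually_at_left_field flat_def intro!: exI[of _ "-1"])
  ultimately show ?thesis unfolding equal
    by (simp add: DERIV_def filterlim_at_split flat_def)
qed

lemma smooth_flat: "smooth (flat p)"
proof -
  have "smooth_upto k (flat p)" for k
    by (induction k arbitrary: p) (auto intro!: flat_has_derivative)
  thus ?thesis by (simp add: smooth_def)
qed

section \<open>Primitives and smooth steps\<close>

definition primitive :: "(real \<Rightarrow> real) \<Rightarrow> real \<Rightarrow> real" where
  "primitive f t = integral {0..t} f"

lemma primitive_nonpos [simp]: "t \<le> 0 \<Longrightarrow> primitive f t = 0"
  by (cases "t = 0") (auto simp: primitive_def)

lemma primitive_has_derivative:
  assumes cont: "continuous_on UNIV f" and zero: "\<And>t. t \<le> 0 \<Longrightarrow> f t = 0"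
  shows "(primitive f has_real_derivative f t) (at t)"
proof -
  \<comment> \<open>This point lies to the left of both 0 and \<open>t\<close>: the integral from
    \<open>a\<close> agrees with the one from 0 since \<open>f\<close> vanishes between, and
    \<open>t\<close> is interior to the interval of integration.\<close>
  define a where "a = - \<bar>t\<bar> - 1"
  have "((\<lambda>x. integral {a..x} f) has_real_derivative f t) (at t within {a..\<bar>t\<bar> + 1})"
    by (rule integral_has_real_derivative) (auto simp: a_def intro: continuous_on_subset[OF cont])
  hence D: "((\<lambda>x. integral {a..x} f) has_real_derivative f t) (at t)"
    by (subst (asm) at_within_interior) (auto simp: a_def)
  have "integral {a..x} f = primitive f x" if "x > a" for x
  proof (cases "x \<le> 0")
    case True
    hence "integral {a..x} f = integral {a..x} (\<lambda>_. 0)" by (intro integral_cong) (auto simp: zero)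
    thus ?thesis using True by simp
  next
    case False
    have "integral {a..0} f + integral {0..x} f = integral {a..x} f"
      using False by (intro Henstock_Kurzweil_Integration.integral_combine integrable_continuous_real continuous_on_subset[OF cont]) (auto simp: a_def)
    moreover have "integral {a..0} f = integral {a..0} (\<lambda>_. 0)" by (intro integral_cong) (auto simp: zero)
    ultimately show ?thesis by (simp add: primitive_def)
  qed
  hence "\<forall>\<^sub>F x in nhds t. integral {a..x} f = primitive f x"
    using eventually_nhds_in_open[of "{a<..}" t] by (force elim!: eventually_mono simp: a_def)
  thus ?thesis using D by (subst (asm) DERIV_cong_ev[OF refl _ refl]) auto
qed

lemma smooth_primitive:
  assumes "smooth f" "\<And>t. t \<le> 0 \<Longrightarrow> f t = 0"
  shows "smooth (primitive f)"
  using assms by (intro smooth_antideriv[OF primitive_has_derivative] smooth_imp_continuous)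

text \<open>The normalized primitive of the bump exp(-1/t) exp(-1/(1-t)) on (0, 1).\<close>

lemma smooth_step_exists:
  obtains B where "smooth B" "mono B" "\<And>t. t \<le> 0 \<Longrightarrow> B t = 0" "\<And>t. t \<ge> 1 \<Longrightarrow> B t = 1"
proof -
  define b where "b t = flat 1 t * flat 1 (1 - t)" for t
  have sb: "smooth b"
    unfolding b_def using smooth_affine[OF smooth_flat, of 1 "-1" 1] by (intro smooth_mult smooth_flat) simp
  have nn: "b t \<ge> 0" and z: "t \<le> 0 \<Longrightarrow> b t = 0" and z1: "t \<ge> 1 \<Longrightarrow> b t = 0"
    and pos: "0 < t \<Longrightarrow> t < 1 \<Longrightarrow> b t > 0" for t
    by (auto simp: b_def flat_def)
  define B where "B = primitive b"
  have D: "(B has_real_derivative b t) (at t)" for t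
    unfolding B_def by (intro primitive_has_derivative smooth_imp_continuous sb z)
  have mono: "B s \<le> B t" if "s \<le> t" for s t
    using DERIV_nonneg_imp_nondecreasing[OF that] D nn by blast
  have "B 0 < B 1"
  proof (rule DERIV_pos_imp_increasing_open[of 0 1 B])
    show "continuous_on {0..1} B" using D by (blast intro: continuous_at_imp_continuous_on DERIV_isCont)
    show "\<exists>y. (B has_real_derivative y) (at x) \<and> 0 < y" if "0 < x" "x < 1" for x
      using D[of x] pos[OF that] by blast
  qed simp
  hence B1: "B 1 > 0" by (simp add: B_def)
  have B1': "B t = B 1" if "t \<ge> 1" for t
  proof (cases "t = 1")
    case False
    have D0: "(B has_real_derivative 0) (at x)" if "x > 1" for x
      using D[of x] z1[of x] that by simp
    have "continuous_on {1..t} B" using D by (blast intro: continuous_at_imp_continuous_on DERIV_isCont)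
    thus ?thesis using that False D0 by (intro DERIV_isconst2[of 1 t B t]) auto
  qed auto
  show ?thesis
  proof (rule that[of "\<lambda>t. inverse (B 1) * B t"])
    show "smooth (\<lambda>t. inverse (B 1) * B t)"
      unfolding B_def by (intro smooth_mult smooth_const smooth_primitive sb z)
    show "mono (\<lambda>t. inverse (B 1) * B t)"
      using mono B1 by (intro monoI mult_left_mono) auto
    show "inverse (B 1) * B t = 0" if "t \<le> 0" for t using that by (simp add: B_def)
    show "inverse (B 1) * B t = 1" if "t \<ge> 1" for t using B1'[OF that] B1 by simp
  qed
qed

text \<open>A partition of unity by integer translates. The support is fixed to \<open>[0, 3]\<close> so that exactly
  three translates have to be considered.\<close>

definition unit_kernel :: "(real \<Rightarrow> real) \<Rightarrow> bool" where
  "unit_kernel P \<longleftrightarrow> smooth P \<and> (\<forall>t. P t \<ge> 0) \<and> (\<forall>t. t \<le> 0 \<or> t \<ge> 3 \<longrightarrow> P t = 0) \<and>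
     (\<forall>s\<in>{0..1}. P s + P (s + 1) + P (s + 2) = 1)"

text \<open>The derivative of \<open>R\<close> is a difference of translates of \<open>r\<close>. Hence a lattice difference of
  averages is an average of a partial derivative, and a partial derivative of an interpolant is an
  interpolant of lattice differences, in both cases with constant one.\<close>

lemma unit_kernel_pair_exists:
  obtains r R where "unit_kernel r" "unit_kernel R"
    "\<And>t. (R has_real_derivative r t - r (t - 1)) (at t)"
proof -
  obtain B where B: "smooth B" "mono B" "\<And>t. t \<le> 0 \<Longrightarrow> B t = 0" "\<And>t. t \<ge> 1 \<Longrightarrow> B t = 1"
    by (rule smooth_step_exists) blast
  \<comment> \<open>\<open>C\<close> is the primitive of \<open>r\<close> rising from 0 to 1 on
    [0, 2]. Hence \<open>R\<close> is the convolution of \<open>r\<close> with the indicator of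
    [0, 1]; this widens the support from [0, 2] to [0, 3], and the sums of translates telescope for
    both.\<close>
  define r where "r t = B t - B (t - 1)" for t
  define D where "D = primitive B"
  define C where "C t = D t - D (t - 1)" for t
  define R where "R t = C t - C (t - 1)" for t
  have D: "(D has_real_derivative B t) (at t)" for t
    unfolding D_def by (intro primitive_has_derivative smooth_imp_continuous B)
  have shift: "((\<lambda>t. t - 1) has_real_derivative 1) (at t)" for t :: real
    by (auto intro!: derivative_eq_intros)
  have D1: "((\<lambda>t. D (t - 1)) has_real_derivative B (t - 1)) (at t)" for t
    using DERIV_chain2[OF D shift] by simp
  have C: "(C has_real_derivative r t) (at t)" for t
    unfolding C_def r_def by (intro DERIV_diff D D1)
  have C1: "((\<lambda>t. C (t - 1)) has_real_derivative r (t - 1)) (at t)" for t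
    using DERIV_chain2[OF C shift] by simp
  have R: "(R has_real_derivative r t - r (t - 1)) (at t)" for t
    unfolding R_def by (intro DERIV_diff C C1)
  have r: "smooth r" unfolding r_def by (intro smooth_diff smooth_shift B)
  have rnn: "r t \<ge> 0" for t using \<open>mono B\<close> by (auto simp: r_def mono_def)
  have Dlin: "D t = D 1 + (t - 1)" if "t \<ge> 1" for t
  proof (cases "t = 1")
    case False
    have "D t - t = D 1 - 1"
    proof (rule DERIV_isconst2[of 1 t "\<lambda>t. D t - t" t])
      show "continuous_on {1..t} (\<lambda>t. D t - t)"
        using D by (intro continuous_intros) (blast intro: continuous_at_imp_continuous_on DERIV_isCont)
      show "((\<lambda>t. D t - t) has_real_derivative 0) (at x)" if "1 < x" for x
        using DERIV_diff[OF D DERIV_ident, of x] that by (simp add: B)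
    qed (use that False in auto)
    thus ?thesis by simp
  qed auto
  have C0: "C t = 0" if "t \<le> 0" for t using that by (simp add: C_def D_def)
  have C2: "C t = 1" if "t \<ge> 2" for t using Dlin[of t] Dlin[of "t - 1"] that by (simp add: C_def)
  have Cmono: "C s \<le> C t" if "s \<le> t" for s t
    using DERIV_nonneg_imp_nondecreasing[OF that] C rnn by blast
  show ?thesis
  proof (rule that[of r R])
    show "unit_kernel r" unfolding unit_kernel_def
    proof (intro conjI allI ballI impI)
      fix t :: real assume "t \<le> 0 \<or> 3 \<le> t" thus "r t = 0" by (auto simp: r_def B)
    next
      fix s :: real assume "s \<in> {0..1}" thus "r s + r (s + 1) + r (s + 2) = 1"
        using B(3)[of "s - 1"] B(4)[of "s + 2"] by (auto simp: r_def algebra_simps)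
    qed (use r rnn in auto)
    show "unit_kernel R" unfolding unit_kernel_def
    proof (intro conjI allI ballI impI)
      show "smooth R" by (rule smooth_antideriv[OF R]) (intro smooth_diff smooth_shift r)
    next
      fix t :: real assume "t \<le> 0 \<or> 3 \<le> t" thus "R t = 0" by (auto simp: R_def C0 C2)
    next
      fix s :: real assume "s \<in> {0..1}" thus "R s + R (s + 1) + R (s + 2) = 1"
        using C0[of "s - 1"] C2[of "s + 2"] by (auto simp: R_def algebra_simps)
    qed (use Cmono in \<open>auto simp: R_def\<close>)
  qed (use R in auto)
qed

section \<open>Product kernels\<close>

definition vprod :: "('d::finite \<Rightarrow> real \<Rightarrow> real) \<Rightarrow> real ^ 'd \<Rightarrow> real" where
  "vprod f y = (\<Prod>i\<in>UNIV. f i (y $ i))"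

lemma vprod_has_derivative:
  assumes "\<And>i. smooth (f i)"
  shows "(vprod f has_derivative
    (\<lambda>h. \<Sum>i\<in>UNIV. (deriv (f i) (x $ i) * h $ i) * (\<Prod>j\<in>UNIV - {i}. f j (x $ j)))) (at x)"
proof -
  have "((\<lambda>y. f i (y $ i)) has_derivative (\<lambda>h. deriv (f i) (x $ i) * h $ i)) (at x)" for i
    by (rule has_derivative_compose[OF bounded_linear.has_derivative[OF bounded_linear_vec_nth has_derivative_ident]
      smooth_has_derivative[OF assms, unfolded has_field_derivative_def]])
  thus ?thesis unfolding vprod_def by (intro has_derivative_prod)
qed

lemma partial_deriv_vprod:
  assumes "\<And>i. smooth (f i)"
  shows "partial_deriv j (vprod f) = vprod (f(j := deriv (f j)))"
proof
  fix x
  have "partial_deriv j (vprod f) x =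
      (\<Sum>i\<in>UNIV. (deriv (f i) (x $ i) * (if i = j then 1 else 0)) * (\<Prod>j\<in>UNIV - {i}. f j (x $ j)))"
    unfolding partial_deriv_def
    by (subst frechet_derivative_at[OF vprod_has_derivative[where f = f, OF assms], symmetric])
       (auto simp: axis_def intro!: sum.cong)
  also have "\<dots> = deriv (f j) (x $ j) * (\<Prod>j\<in>UNIV - {j}. f j (x $ j))"
    by (simp add: if_distrib if_distribR cong: if_cong)
  also have "\<dots> = vprod (f(j := deriv (f j))) x"
    unfolding vprod_def by (subst prod.remove[of UNIV j]) auto
  finally show "partial_deriv j (vprod f) x = vprod (f(j := deriv (f j))) x" .
qed

text \<open>A partial derivative replaces one factor by its derivative, so the induction stays
  within products of smooth functions.\<close>

lemma C_k_vprod: "(\<And>i. smooth (f i)) \<Longrightarrow> C_k k (vprod f)"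
proof (induction k arbitrary: f)
  case 0
  have "vprod f differentiable at x" for x
    using vprod_has_derivative[where f = f and x = x, OF 0] by (auto simp: differentiable_def)
  thus ?case by (auto intro!: continuous_at_imp_continuous_on differentiable_imp_continuous_within)
next
  case (Suc k)
  have "vprod f differentiable at x" for x
    using vprod_has_derivative[where f = f and x = x, OF Suc.prems] by (auto simp: differentiable_def)
  moreover have "C_k k (partial_deriv i (vprod f))" for i
    unfolding partial_deriv_vprod[where f = f, OF Suc.prems]
    by (rule Suc.IH) (auto intro: Suc.prems smooth_deriv)
  ultimately show ?case by simp
qed

lemma test_function_vprod:
  assumes "\<And>i. smooth (f i)" and supp: "\<And>i t. \<bar>t\<bar> > M \<Longrightarrow> f i t = 0"
  shows "test_function (vprod f)"
proof -
  have "\<bar>x $ i\<bar> \<le> M" if "vprod f x \<noteq> 0" for x i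
    using that supp[where t = "x $ i" and i = i] by (force simp: vprod_def not_le)
  hence "norm x \<le> real CARD('a) * M" if "vprod f x \<noteq> 0" for x
    using that order_trans[OF norm_le_l1_cart[of x] sum_bounded_above[of UNIV "\<lambda>i. \<bar>x $ i\<bar>" M]] by simp
  hence "bounded {x. vprod f x \<noteq> 0}"
    unfolding bounded_iff by auto
  thus ?thesis using C_k_vprod[of f] assms(1) by (auto simp: test_function_def compact_closure)
qed

lemma nn_integral_vprod:
  fixes f :: "'d::finite \<Rightarrow> real \<Rightarrow> real"
  assumes [measurable]: "\<And>i. f i \<in> borel_measurable borel" and nn: "\<And>i t. f i t \<ge> 0"
  shows "(\<integral>\<^sup>+y. ennreal (vprod f y) \<partial>lborel) = (\<Prod>i\<in>UNIV. \<integral>\<^sup>+t. ennreal (f i t) \<partial>lborel)"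
proof -
  \<comment> \<open>The product formula for \<open>lborel\<close> is indexed by basis vectors;
    \<open>idx\<close> recovers the coordinate from the vector.\<close>
  define idx :: "real ^ 'd \<Rightarrow> 'd" where "idx = inv (\<lambda>i. axis i 1)"
  have inj: "inj (\<lambda>i :: 'd. axis i (1 :: real))" by (auto simp: inj_def axis_eq_axis)
  have idx: "idx (axis i 1) = i" for i unfolding idx_def using inj by (rule inv_f_f)
  have B: "(Basis :: (real ^ 'd) set) = (\<lambda>i. axis i 1) ` UNIV"
    by (auto simp: Basis_vec_def)
  have "(\<integral>\<^sup>+y. ennreal (vprod f y) \<partial>lborel) =
      (\<integral>\<^sup>+y. (\<Prod>b\<in>Basis. ennreal (f (idx b) (inner (y :: real ^ 'd) b))) \<partial>lborel)"
    unfolding B prod.reindex[OF inj] by (simp add: idx inner_axis vprod_def prod_ennreal nn)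
  also have "\<dots> = (\<Prod>b\<in>Basis. \<integral>\<^sup>+t. ennreal (f (idx b) t) \<partial>lborel)"
    by (rule nn_integral_lborel_prod) auto
  also have "\<dots> = (\<Prod>i\<in>UNIV. \<integral>\<^sup>+t. ennreal (f i t) \<partial>lborel)"
    unfolding B prod.reindex[OF inj] by (simp add: idx)
  finally show ?thesis .
qed

lemma borel_measurable_vec_nth [measurable (raw)]:
  "g \<in> borel_measurable M \<Longrightarrow> (\<lambda>x. (g x :: real ^ 'd) $ i) \<in> borel_measurable M"
  by (rule measurable_compose[where N = borel])
     (auto intro!: borel_measurable_continuous_onI continuous_intros)

lemma borel_measurable_of_int_floor [measurable (raw)]:
  "g \<in> borel_measurable M \<Longrightarrow> (\<lambda>x. of_int \<lfloor>g x :: real\<rfloor> :: real) \<in> borel_measurable M"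
  by measurable

section \<open>Sums and integrals of translated kernels\<close>

lemma unit_kernelD:
  assumes "unit_kernel P"
  shows "smooth P" "P t \<ge> 0" "t \<le> 0 \<Longrightarrow> P t = 0" "t \<ge> 3 \<Longrightarrow> P t = 0"
    "0 \<le> t \<Longrightarrow> t \<le> 1 \<Longrightarrow> P t + P (t + 1) + P (t + 2) = 1"
  using assms by (auto simp: unit_kernel_def)

lemma unit_kernel_measurable [measurable (raw)]:
  assumes "unit_kernel P" "g \<in> borel_measurable M" shows "(\<lambda>x. P (g x)) \<in> borel_measurable M"
proof -
  have "P \<in> borel_measurable borel"
    using assms(1) by (intro borel_measurable_continuous_onI smooth_imp_continuous unit_kernelD)
  from measurable_compose[OF assms(2) this] show ?thesis .
qed

lemma unit_kernel_sum_shifts: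
  assumes "unit_kernel P"
  shows "(\<Sum>n\<in>{\<lfloor>s\<rfloor> - 2..\<lfloor>s\<rfloor>}. P (s - of_int n)) = 1"
proof -
  have "{\<lfloor>s\<rfloor> - 2..\<lfloor>s\<rfloor>} = {\<lfloor>s\<rfloor>, \<lfloor>s\<rfloor> - 1, \<lfloor>s\<rfloor> - 2}" by auto
  moreover have "P (frac s) + P (frac s + 1) + P (frac s + 2) = 1"
    by (rule unit_kernelD[OF assms]) (auto simp: less_imp_le frac_lt_1)
  ultimately show ?thesis by (simp add: frac_def algebra_simps)
qed

lemma unit_kernel_shift_zero:
  assumes "unit_kernel P" "n \<notin> {\<lfloor>s\<rfloor> - 2..\<lfloor>s\<rfloor>}"
  shows "P (s - of_int n) = 0"
proof -
  have "n > \<lfloor>s\<rfloor> \<or> n < \<lfloor>s\<rfloor> - 2" using assms(2) by auto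
  hence "s - of_int n \<le> 0 \<or> s - of_int n \<ge> 3" by linarith
  thus ?thesis using unit_kernelD[OF assms(1)] by auto
qed

text \<open>Folding [0, 1), [1, 2) and [2, 3) onto [0, 1) turns the integrand into the sum of three
  translates, which is 1.\<close>

lemma nn_integral_unit_kernel:
  assumes P: "unit_kernel P"
  shows "(\<integral>\<^sup>+t. ennreal (P t) \<partial>lborel) = 1"
proof -
  note [measurable] = unit_kernel_measurable[OF P]
  have *: "(\<integral>\<^sup>+t. ennreal (P t) * indicator {c..<c + 1} t \<partial>lborel) =
      (\<integral>\<^sup>+t. ennreal (P (t + c)) * indicator {0..<1} t \<partial>lborel)" for c
    by (subst nn_integral_real_affine[of _ 1 c])
       (auto simp: algebra_simps indicator_def intro!: nn_integral_cong)
  have "(\<integral>\<^sup>+t. ennreal (P t) \<partial>lborel) =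
    (\<integral>\<^sup>+t. (ennreal (P t) * indicator {0..<0 + 1} t + ennreal (P t) * indicator {1..<1 + 1} t) +
      ennreal (P t) * indicator {2..<2 + 1} t \<partial>lborel)"
    using unit_kernelD[OF P] by (intro nn_integral_cong) (auto simp: indicator_def not_le not_less)
  also have "\<dots> = (\<integral>\<^sup>+t. ennreal (P (t + 0)) * indicator {0..<1} t \<partial>lborel) +
      (\<integral>\<^sup>+t. ennreal (P (t + 1)) * indicator {0..<1} t \<partial>lborel) +
      (\<integral>\<^sup>+t. ennreal (P (t + 2)) * indicator {0..<1} t \<partial>lborel)"
    unfolding *[symmetric] by (subst nn_integral_add | simp)+
  also have "\<dots> = (\<integral>\<^sup>+t. (ennreal (P (t + 0)) * indicator {0..<1} t + ennreal (P (t + 1)) * indicator {0..<1} t) +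
      ennreal (P (t + 2)) * indicator {0..<1} t \<partial>lborel)"
    by (subst nn_integral_add | simp)+
  also have "\<dots> = (\<integral>\<^sup>+t. indicator {0..<1::real} t \<partial>lborel)"
    using unit_kernelD[OF P]
    by (intro nn_integral_cong) (auto simp: indicator_def ennreal_plus[symmetric] simp del: ennreal_plus)
  finally show ?thesis by simp
qed

lemma nn_integral_unit_kernel_affine:
  assumes P: "unit_kernel P" and h: "h > 0"
  shows "(\<integral>\<^sup>+t. ennreal (P (t / h - c)) \<partial>lborel) = ennreal h"
proof -
  note [measurable] = unit_kernel_measurable[OF P]
  show ?thesis using h
    by (subst nn_integral_real_affine[of _ h "c * h"])
       (auto simp: field_simps nn_integral_unit_kernel[OF P])
qed

text \<open>Here the point \<open>s\<close> is fixed and the lattice index varies. The integrand is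
  constant on cells, so the integral is the sum over all translates times the mesh size. This second
  normalization is what makes averaging a contraction in L1.\<close>

lemma nn_integral_unit_kernel_floor:
  assumes P: "unit_kernel P" and h: "h > 0"
  shows "(\<integral>\<^sup>+t. ennreal (P (s - of_int \<lfloor>t / h\<rfloor>)) \<partial>lborel) = ennreal h"
proof -
  note [measurable] = unit_kernel_measurable[OF P]
  let ?I = "{\<lfloor>s\<rfloor> - 2..\<lfloor>s\<rfloor>}"
  have "(\<integral>\<^sup>+t. ennreal (P (s - of_int \<lfloor>t / h\<rfloor>)) \<partial>lborel) = ennreal h * (\<integral>\<^sup>+t. ennreal (P (s - of_int \<lfloor>t :: real\<rfloor>)) \<partial>lborel)"
    using h by (subst nn_integral_real_affine[of "\<lambda>t. ennreal (P (s - of_int \<lfloor>t / h\<rfloor>))" h 0]) auto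
  also have "(\<integral>\<^sup>+t. ennreal (P (s - of_int \<lfloor>t :: real\<rfloor>)) \<partial>lborel) =
      (\<integral>\<^sup>+t. (\<Sum>n\<in>?I. ennreal (P (s - of_int n)) * indicator {of_int n..<of_int n + 1 :: real} t) \<partial>lborel)"
  proof (rule nn_integral_cong)
    fix t :: real
    have e: "indicator {of_int n..<of_int n + 1 :: real} t = (if n = \<lfloor>t\<rfloor> then 1 else (0 :: ennreal))" for n
      using floor_eq_iff[of t n] by (auto simp: indicator_def)
    show "ennreal (P (s - of_int \<lfloor>t\<rfloor>)) =
        (\<Sum>n\<in>?I. ennreal (P (s - of_int n)) * indicator {of_int n..<of_int n + 1 :: real} t)"
      unfolding e using unit_kernel_shift_zero[OF P, of "\<lfloor>t\<rfloor>" s]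
      by (simp add: if_distrib cong: if_cong)
  qed
  also have "\<dots> = (\<Sum>n\<in>?I. ennreal (P (s - of_int n)))"
    by (subst nn_integral_sum) (auto simp: nn_integral_cmult_indicator)
  also have "\<dots> = 1"
    using unit_kernel_sum_shifts[OF P, of s] by (subst sum_ennreal) (auto simp: unit_kernelD[OF P])
  finally show ?thesis by simp
qed

section \<open>Kernels attached to lattice points\<close>

definition vfloor :: "real ^ 'd::finite \<Rightarrow> int ^ 'd" where
  "vfloor y = (\<chi> i. \<lfloor>y $ i\<rfloor>)"

lemma vfloor_nth [simp]: "vfloor y $ i = \<lfloor>y $ i\<rfloor>"
  by (simp add: vfloor_def)

text \<open>Since kernels are supported in [0, 3], these are the only lattice points whose kernel
  can be nonzero at a point of the cell with corner \<open>m\<close>.\<close>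

definition cube :: "int ^ 'd::finite \<Rightarrow> (int ^ 'd) set" where
  "cube m = {x. \<forall>i. x $ i \<in> {m $ i - 2..m $ i}}"

lemma cube_eq_image: "cube m = vec_lambda ` (Pi\<^sub>E UNIV (\<lambda>i. {m $ i - 2..m $ i}))"
proof -
  have "x \<in> vec_lambda ` (Pi\<^sub>E UNIV (\<lambda>i. {m $ i - 2..m $ i}))" if "x \<in> cube m" for x
    using that by (intro image_eqI[of x _ "vec_nth x"]) (auto simp: cube_def)
  thus ?thesis by (auto simp: cube_def PiE_iff)
qed

lemma finite_cube [simp]: "finite (cube m)"
  unfolding cube_eq_image by (intro finite_imageI finite_PiE) auto

text \<open>The factor may depend on the coordinate: differentiating in direction \<open>i\<close>
  trades the kernel \<open>R\<close> for \<open>r\<close> in that coordinate alone. The total mass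
  is \<open>h\<close> to the power of the dimension, not 1.\<close>

definition ker :: "('d::finite \<Rightarrow> real \<Rightarrow> real) \<Rightarrow> real \<Rightarrow> int ^ 'd \<Rightarrow> real ^ 'd \<Rightarrow> real" where
  "ker P h x y = (\<Prod>i\<in>UNIV. P i (y $ i / h - of_int (x $ i)))"

lemma ker_eq_vprod: "ker P h x = vprod (\<lambda>i t. P i (t / h - of_int (x $ i)))"
  by (simp add: fun_eq_iff ker_def vprod_def)

lemma ker_nonneg: "\<forall>i. unit_kernel (P i) \<Longrightarrow> ker P h x y \<ge> 0"
  unfolding ker_def by (intro prod_nonneg) (auto intro: unit_kernelD)

lemma ker_nonzeroD:
  assumes P: "\<forall>i. unit_kernel (P i)" and nz: "ker P h x y \<noteq> 0"
  shows "0 < y $ i / h - of_int (x $ i)" "y $ i / h - of_int (x $ i) < 3" "x \<in> cube (vfloor (y /\<^sub>R h))"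
proof -
  have "P i (y $ i / h - of_int (x $ i)) \<noteq> 0" for i using nz by (auto simp: ker_def)
  hence *: "0 < y $ i / h - of_int (x $ i) \<and> y $ i / h - of_int (x $ i) < 3" for i
    using unit_kernelD(3,4)[OF P[rule_format]] by (meson not_le)
  thus "0 < y $ i / h - of_int (x $ i)" "y $ i / h - of_int (x $ i) < 3" by auto
  have "x $ i \<in> {\<lfloor>y $ i / h\<rfloor> - 2..\<lfloor>y $ i / h\<rfloor>}" for i
    using *[of i] by (auto; linarith)
  thus "x \<in> cube (vfloor (y /\<^sub>R h))" by (auto simp: cube_def divide_inverse_commute)
qed

lemma smooth_unit_kernel_scaled: "unit_kernel P \<Longrightarrow> smooth (\<lambda>t. P (t / h - c))"
  using smooth_affine[of P "1 / h" "- c"] unit_kernelD(1)[of P] by simp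

lemma continuous_on_ker:
  assumes "\<forall>i. unit_kernel (P i)"
  shows "continuous_on A (ker P h x)"
proof -
  have "C_k 0 (ker P h x)" unfolding ker_eq_vprod by (intro C_k_vprod smooth_unit_kernel_scaled assms[rule_format])
  thus ?thesis by (auto intro: continuous_on_subset)
qed

lemma ker_measurable [measurable (raw)]:
  assumes "\<forall>i. unit_kernel (P i)" "g \<in> borel_measurable M"
  shows "(\<lambda>z. ker P h x (g z)) \<in> borel_measurable M"
  using measurable_compose[OF assms(2) borel_measurable_continuous_onI[OF continuous_on_ker[OF assms(1)]]]
  by simp

lemma ker_vfloor_measurable:
  assumes P: "\<forall>i. unit_kernel (P i)"
  shows "(\<lambda>(y, z). ker P h (vfloor (y /\<^sub>R h)) z) \<in> borel_measurable (borel \<Otimes>\<^sub>M borel)"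
  unfolding ker_def split_beta' vfloor_nth vector_scaleR_component real_scaleR_def
  by (intro borel_measurable_prod unit_kernel_measurable[OF P[rule_format]]) measurable

lemma test_function_ker:
  assumes P: "\<forall>i. unit_kernel (P i)" and h: "h > 0"
  shows "test_function (ker P h x)"
proof -
  \<comment> \<open>Beyond this bound t / h exceeds every coordinate of \<open>x\<close> by more
    than 3 in absolute value, which leaves the support of each factor.\<close>
  define M where "M = h * (3 + (\<Sum>i\<in>UNIV. \<bar>of_int (x $ i)\<bar>))"
  have "P i (t / h - of_int (x $ i)) = 0" if "\<bar>t\<bar> > M" for i t
  proof -
    have "\<bar>of_int (x $ i) :: real\<bar> \<le> (\<Sum>i\<in>UNIV. \<bar>of_int (x $ i)\<bar>)"
      by (rule member_le_sum) auto
    hence "3 + \<bar>of_int (x $ i)\<bar> < \<bar>t / h\<bar>"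
      using that h by (simp add: M_def field_simps) (smt (verit) mult_left_mono)
    hence "t / h - of_int (x $ i) \<le> 0 \<or> t / h - of_int (x $ i) \<ge> 3" by linarith
    thus ?thesis using unit_kernelD[OF P[rule_format]] by auto
  qed
  thus ?thesis unfolding ker_eq_vprod
    by (intro test_function_vprod[of _ M] smooth_unit_kernel_scaled P[rule_format])
qed

lemma nn_integral_ker:
  assumes P: "\<forall>i :: 'd::finite. unit_kernel (P i)" and h: "h > 0"
  shows "(\<integral>\<^sup>+y. ennreal (ker P h x y) \<partial>lborel) = ennreal (h ^ CARD('d))"
proof -
  have "(\<integral>\<^sup>+y. ennreal (ker P h x y) \<partial>lborel) = (\<Prod>i\<in>(UNIV :: 'd set). ennreal h)"
    unfolding ker_eq_vprod
    by (subst nn_integral_vprod)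
       (auto intro!: unit_kernel_measurable[OF P[rule_format]] unit_kernelD[OF P[rule_format]] prod.cong simp: nn_integral_unit_kernel_affine[OF P[rule_format] h])
  thus ?thesis using h by (simp add: ennreal_power)
qed

lemma nn_integral_ker_vfloor:
  assumes P: "\<forall>i :: 'd::finite. unit_kernel (P i)" and h: "h > 0"
  shows "(\<integral>\<^sup>+y. ennreal (ker P h (vfloor (y /\<^sub>R h)) z) \<partial>lborel) = ennreal (h ^ CARD('d))"
proof -
  have "(\<integral>\<^sup>+y. ennreal (ker P h (vfloor (y /\<^sub>R h)) z) \<partial>lborel) =
      (\<integral>\<^sup>+y. ennreal (vprod (\<lambda>i t. P i (z $ i / h - of_int \<lfloor>t / h\<rfloor>)) y) \<partial>lborel)"
    by (simp add: ker_def vprod_def divide_inverse_commute)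
  also have "\<dots> = (\<Prod>i\<in>(UNIV :: 'd set). ennreal h)"
    by (subst nn_integral_vprod)
       (auto intro!: unit_kernel_measurable[OF P[rule_format]] unit_kernelD[OF P[rule_format]] prod.cong borel_measurable_diff
          borel_measurable_of_int_floor borel_measurable_divide simp: nn_integral_unit_kernel_floor[OF P[rule_format] h])
  finally show ?thesis using h by (simp add: ennreal_power)
qed

lemma integral_ker:
  assumes P: "\<forall>i :: 'd::finite. unit_kernel (P i)" and h: "h > 0"
  shows "integrable lborel (ker P h x)" "(LBINT y. ker P h x y) = h ^ CARD('d)"
proof -
  have [measurable]: "ker P h x \<in> borel_measurable lborel" using ker_measurable[OF P measurable_ident, of h x] by simp
  have "has_bochner_integral lborel (ker P h x) (h ^ CARD('d))"
    using h by (intro has_bochner_integral_nn_integral) (auto simp: nn_integral_ker[OF P h] ker_nonneg[OF P])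
  thus "integrable lborel (ker P h x)" "(LBINT y. ker P h x y) = h ^ CARD('d)"
    by (auto simp: has_bochner_integral_iff)
qed

text \<open>Distributivity turns the sum over the box into a product of one-dimensional sums of
  translates, each equal to 1.\<close>

lemma sum_ker_cube:
  assumes P: "\<forall>i. unit_kernel (P i)"
  shows "(\<Sum>x\<in>cube (vfloor (y /\<^sub>R h)). ker P h x y) = 1"
proof -
  let ?I = "\<lambda>i. {\<lfloor>y $ i / h\<rfloor> - 2..\<lfloor>y $ i / h\<rfloor>}"
  have "cube (vfloor (y /\<^sub>R h)) = vec_lambda ` (Pi\<^sub>E UNIV ?I)"
    by (simp add: cube_eq_image divide_inverse_commute)
  hence "(\<Sum>x\<in>cube (vfloor (y /\<^sub>R h)). ker P h x y) =
      (\<Sum>x\<in>Pi\<^sub>E UNIV ?I. \<Prod>i\<in>UNIV. P i (y $ i / h - of_int (x i)))"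
    by (simp add: ker_def sum.reindex inj_on_def fun_eq_iff vec_eq_iff)
  also have "\<dots> = (\<Prod>i\<in>UNIV. \<Sum>n\<in>?I i. P i (y $ i / h - of_int n))"
    by (subst prod_sum_PiE) auto
  finally show ?thesis by (simp add: unit_kernel_sum_shifts[OF P[rule_format]])
qed

lemma sum_ker_eq_1:
  assumes P: "\<forall>i. unit_kernel (P i)" and "finite F" "cube (vfloor (y /\<^sub>R h)) \<subseteq> F"
  shows "(\<Sum>x\<in>F. ker P h x y) = 1"
  using sum.mono_neutral_left[of F "cube (vfloor (y /\<^sub>R h))" "\<lambda>x. ker P h x y"]
    ker_nonzeroD(3)[OF P] sum_ker_cube[OF P, of h y] assms(2,3) by (metis DiffE)

lemma sum_ker_le_1:
  assumes P: "\<forall>i. unit_kernel (P i)" and "finite F"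
  shows "(\<Sum>x\<in>F. ker P h x y) \<le> 1"
  using sum_mono2[of "F \<union> cube (vfloor (y /\<^sub>R h))" F "\<lambda>x. ker P h x y"]
    sum_ker_eq_1[OF P, of "F \<union> cube (vfloor (y /\<^sub>R h))" h y] ker_nonneg[OF P] assms(2) by auto

text \<open>The shifted term r (t - 1) is the factor belonging to the neighbouring lattice point in
  direction \<open>i\<close>, and the chain rule contributes 1 / h. This identity links derivatives
  to lattice differences in both halves of the proof.\<close>

lemma partial_deriv_ker:
  assumes P: "\<forall>i. unit_kernel (P i)" and r: "unit_kernel r" and h: "h > 0"
    and D: "\<And>t. (P i has_real_derivative r t - r (t - 1)) (at t)"
  shows "partial_deriv i (ker P h x) y =
    (ker (P(i := r)) h x y - ker (P(i := r)) h (x + axis i 1) y) / h"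
proof -
  define f where "f = (\<lambda>i t. P i (t / h - of_int (x $ i)))"
  have d: "deriv (f i) t = (r (t / h - of_int (x $ i)) - r (t / h - of_int (x $ i) - 1)) / h" for t
    unfolding f_def
    by (rule DERIV_imp_deriv) (rule DERIV_chain2[OF D, THEN DERIV_cong], (rule derivative_eq_intros | use h in simp)+)
  have "partial_deriv i (ker P h x) y = vprod (f(i := deriv (f i))) y"
    unfolding ker_eq_vprod f_def[symmetric]
    by (subst partial_deriv_vprod) (auto simp: f_def intro!: smooth_unit_kernel_scaled P[rule_format])
  also have "\<dots> = deriv (f i) (y $ i) * (\<Prod>j\<in>UNIV - {i}. P j (y $ j / h - of_int (x $ j)))"
    unfolding vprod_def by (subst prod.remove[of UNIV i]) (auto simp: f_def intro!: prod.cong)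
  also have "\<dots> = (ker (P(i := r)) h x y - ker (P(i := r)) h (x + axis i 1) y) / h"
  proof -
    have a: "ker (P(i := r)) h x y = r (y $ i / h - of_int (x $ i)) * (\<Prod>j\<in>UNIV - {i}. P j (y $ j / h - of_int (x $ j)))"
      unfolding ker_def by (subst prod.remove[of UNIV i]) (auto intro!: prod.cong)
    have b: "ker (P(i := r)) h (x + axis i 1) y = r (y $ i / h - of_int (x $ i) - 1) * (\<Prod>j\<in>UNIV - {i}. P j (y $ j / h - of_int (x $ j)))"
      unfolding ker_def by (subst prod.remove[of UNIV i]) (auto intro!: prod.cong simp: axis_def algebra_simps)
    show ?thesis unfolding a b d by (simp add: algebra_simps diff_divide_distrib)
  qed
  finally show ?thesis .
qed

section \<open>Convergence of averages\<close>

text \<open>Young's inequality, with the scale chosen so that the two sides balance.\<close>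

lemma integral_weight_powr_le:
  fixes v w :: "'a \<Rightarrow> real"
  assumes p: "p \<ge> 1" and w: "integrable M w" "\<And>x. w x \<ge> 0" "(\<integral>x. w x \<partial>M) \<le> 1"
    and v [measurable]: "v \<in> borel_measurable M" and I: "integrable M (\<lambda>x. w x * \<bar>v x\<bar> powr p)"
  shows "integrable M (\<lambda>x. w x * v x)"
    and "\<bar>\<integral>x. w x * v x \<partial>M\<bar> powr p \<le> (\<integral>x. w x * \<bar>v x\<bar> powr p \<partial>M)"
proof -
  note [measurable] = borel_measurable_integrable[OF w(1)]
  have young: "\<bar>v x\<bar> * s powr (p - 1) \<le> \<bar>v x\<bar> powr p / p + (1 - 1 / p) * s powr p" if "s > 0" for x s
  proof (cases "v x = 0")
    case False
    have "(\<bar>v x\<bar> powr p) powr (1 / p) * (s powr p) powr (1 - 1 / p) \<le>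
        1 / p * \<bar>v x\<bar> powr p + (1 - 1 / p) * s powr p"
      using that p False by (intro Youngs_inequality_0) auto
    moreover have "p * (1 - 1 / p) = p - 1" using p by (simp add: field_simps)
    ultimately show ?thesis using p by (simp add: powr_powr)
  qed (use p in auto)
  have dom: "integrable M (\<lambda>x. w x * \<bar>v x\<bar> powr p / p + (1 - 1 / p) * w x)"
    using w I by auto
  show int: "integrable M (\<lambda>x. w x * v x)"
  proof (rule Bochner_Integration.integrable_bound[OF dom], measurable, rule AE_I2)
    fix x
    have "w x * \<bar>v x\<bar> \<le> w x * (\<bar>v x\<bar> powr p / p + (1 - 1 / p))"
      using young[of 1 x] w(2)[of x] by (intro mult_left_mono) auto
    thus "norm (w x * v x) \<le> norm (w x * \<bar>v x\<bar> powr p / p + (1 - 1 / p) * w x)"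
      using w(2)[of x] by (simp add: abs_mult algebra_simps)
  qed
  define A where "A = (\<integral>x. w x * \<bar>v x\<bar> \<partial>M)"
  define J where "J = (\<integral>x. w x * \<bar>v x\<bar> powr p \<partial>M)"
  have intA: "integrable M (\<lambda>x. w x * \<bar>v x\<bar>)"
    using integrable_abs[OF int] w(2) by (simp add: abs_mult)
  have A: "\<bar>\<integral>x. w x * v x \<partial>M\<bar> \<le> A"
    using integral_abs_bound[of M "\<lambda>x. w x * v x"] w(2) by (simp add: A_def abs_mult)
  have "A powr p \<le> J"
  proof (cases "A > 0")
    case True
    have "A * A powr (p - 1) = (\<integral>x. w x * \<bar>v x\<bar> * A powr (p - 1) \<partial>M)"
      by (simp add: A_def)
    also have "\<dots> \<le> (\<integral>x. w x * \<bar>v x\<bar> powr p / p + (1 - 1 / p) * A powr p * w x \<partial>M)"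
    proof (rule integral_mono)
      fix x
      show "w x * \<bar>v x\<bar> * A powr (p - 1) \<le> w x * \<bar>v x\<bar> powr p / p + (1 - 1 / p) * A powr p * w x"
        using mult_left_mono[OF young[OF True, of x] w(2)[of x]] by (simp add: algebra_simps)
    qed (use intA I w in auto)
    also have "\<dots> = J / p + (1 - 1 / p) * A powr p * (\<integral>x. w x \<partial>M)"
      using I w by (simp add: J_def)
    also have "\<dots> \<le> J / p + (1 - 1 / p) * A powr p"
      using w p by (intro add_left_mono mult_left_le) auto
    also have "A * A powr (p - 1) = A powr p" using True by (simp add: powr_mult_base)
    finally have "A powr p / p \<le> J / p" by (simp add: algebra_simps)
    thus ?thesis using p by (simp add: divide_right_mono field_simps)
  next
    case False
    hence "A = 0" unfolding A_def using w(2) by (intro antisym integral_nonneg_AE) auto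
    thus ?thesis using w(2) p unfolding J_def by (auto intro!: integral_nonneg_AE)
  qed
  thus "\<bar>\<integral>x. w x * v x \<partial>M\<bar> powr p \<le> (\<integral>x. w x * \<bar>v x\<bar> powr p \<partial>M)"
    using A p unfolding J_def by (smt (verit) powr_mono2)
qed

lemma sum_weight_powr_le:
  fixes c w :: "'a \<Rightarrow> real"
  assumes "p \<ge> 1" "finite F" "\<And>x. x \<in> F \<Longrightarrow> w x \<ge> 0" "(\<Sum>x\<in>F. w x) \<le> 1"
  shows "\<bar>\<Sum>x\<in>F. w x * c x\<bar> powr p \<le> (\<Sum>x\<in>F. w x * \<bar>c x\<bar> powr p)"
proof -
  \<comment> \<open>The weights are extended by 0 because the integral version asks for
    nonnegativity at every point.\<close>
  let ?w = "\<lambda>x. if x \<in> F then w x else 0"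
  have "\<bar>\<integral>x. ?w x * c x \<partial>count_space F\<bar> powr p \<le> (\<integral>x. ?w x * \<bar>c x\<bar> powr p \<partial>count_space F)"
  proof (rule integral_weight_powr_le(2)[OF assms(1)])
    show "(\<integral>x. ?w x \<partial>count_space F) \<le> 1"
      using assms by (simp add: lebesgue_integral_count_space_finite)
  qed (use assms in \<open>auto intro: integrable_count_space\<close>)
  thus ?thesis using assms(2) by (simp add: lebesgue_integral_count_space_finite)
qed

section \<open>Step functions on lattice cells\<close>

lemma vfloor_measurable [measurable]: "vfloor \<in> measurable borel (count_space UNIV)"
proof (subst measurable_count_space_eq2_countable, safe)
  fix a :: "int ^ 'a"
  have "vfloor -` {a} \<inter> space borel = {y \<in> space borel. \<forall>i\<in>UNIV. of_int (a $ i) \<le> y $ i \<and> y $ i < of_int (a $ i) + 1}"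
    by (auto simp: vec_eq_iff floor_eq_iff)
  also have "\<dots> \<in> sets borel" by measurable
  finally show "vfloor -` {a} \<inter> space borel \<in> sets borel" .
qed auto

lemma emeasure_lattice_cell:
  fixes x :: "int ^ 'd::finite"
  assumes h: "h > 0"
  shows "emeasure lborel {y. vfloor (y /\<^sub>R h) = x} = ennreal (h ^ CARD('d))"
proof -
  have "emeasure lborel {y. vfloor (y /\<^sub>R h) = x} = (\<integral>\<^sup>+y. indicator {y. vfloor (y /\<^sub>R h) = x} y \<partial>lborel)"
    by (subst nn_integral_indicator) auto
  also have "\<dots> = (\<integral>\<^sup>+y. ennreal (vprod (\<lambda>i. indicator {h * of_int (x $ i)..<h * of_int (x $ i) + h}) y) \<partial>lborel)"
  proof (rule nn_integral_cong)
    fix y :: "real ^ 'd"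
    have "(y $ i \<in> {h * of_int (x $ i)..<h * of_int (x $ i) + h}) = (\<lfloor>y $ i / h\<rfloor> = x $ i)" for i
      using h by (auto simp: floor_eq_iff field_simps)
    hence "vprod (\<lambda>i. indicator {h * of_int (x $ i)..<h * of_int (x $ i) + h}) y =
        (\<Prod>i\<in>UNIV. if \<lfloor>y $ i / h\<rfloor> = x $ i then 1 else 0 :: real)"
      by (simp add: vprod_def indicator_def of_bool_def)
    also have "\<dots> = indicator {y. vfloor (y /\<^sub>R h) = x} y"
      by (auto simp: vec_eq_iff indicator_def divide_inverse_commute)
    finally show "indicator {y. vfloor (y /\<^sub>R h) = x} y =
        ennreal (vprod (\<lambda>i. indicator {h * of_int (x $ i)..<h * of_int (x $ i) + h}) y)"
      by (simp add: indicator_def)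
  qed
  also have "\<dots> = (\<Prod>i\<in>(UNIV :: 'd set). ennreal h)"
    using h by (subst nn_integral_vprod) (auto intro!: prod.cong simp: ennreal_indicator)
  finally show ?thesis using h by (simp add: ennreal_power)
qed

text \<open>Tonelli's theorem with the counting measure: the cells partition space and all have the
  same volume. This converts lattice sums into integrals throughout.\<close>

lemma integral_vfloor:
  fixes f :: "int ^ 'd::finite \<Rightarrow> real"
  assumes h: "h > 0" and f: "f summable_on UNIV" "\<And>x. f x \<ge> 0"
  shows "(\<integral>\<^sup>+y. ennreal (f (vfloor (y /\<^sub>R h))) \<partial>lborel) = ennreal (h ^ CARD('d) * infsum f UNIV)"
proof -
  have "ennreal (f (vfloor (y /\<^sub>R h))) =
      (\<integral>\<^sup>+x. ennreal (f x) * indicator {y. vfloor (y /\<^sub>R h) = x} y \<partial>count_space UNIV)" for y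
  proof -
    have "(\<integral>\<^sup>+x. ennreal (f x) * indicator {y. vfloor (y /\<^sub>R h) = x} y \<partial>count_space UNIV) =
        (\<integral>\<^sup>+x. ennreal (f (vfloor (y /\<^sub>R h))) * indicator {vfloor (y /\<^sub>R h)} x \<partial>count_space UNIV)"
      by (intro nn_integral_cong) (auto simp: indicator_def)
    thus ?thesis by (subst (asm) nn_integral_cmult_indicator) auto
  qed
  hence "(\<integral>\<^sup>+y. ennreal (f (vfloor (y /\<^sub>R h))) \<partial>lborel) =
      (\<integral>\<^sup>+x. (\<integral>\<^sup>+y. ennreal (f x) * indicator {y. vfloor (y /\<^sub>R h) = x} y \<partial>lborel) \<partial>count_space UNIV)"
    by (simp add: nn_integral_count_space_nn_integral)
  also have "\<dots> = (\<integral>\<^sup>+x. ennreal (f x) * ennreal (h ^ CARD('d)) \<partial>count_space UNIV)"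
    by (intro nn_integral_cong, subst nn_integral_cmult_indicator) (auto simp: emeasure_lattice_cell[OF h])
  also have "\<dots> = (\<integral>\<^sup>+x. ennreal (f x) \<partial>count_space UNIV) * ennreal (h ^ CARD('d))"
    by (rule nn_integral_multc) auto
  also have "(\<integral>\<^sup>+x. ennreal (f x) \<partial>count_space UNIV) = ennreal (infsum f UNIV)"
  proof -
    have "Infinite_Set_Sum.abs_summable_on f UNIV"
      using f by (simp add: abs_summable_equivalent[symmetric])
    thus ?thesis using f by (simp add: nn_integral_conv_infsetsum infsetsum_infsum)
  qed
  finally show ?thesis using h f by (simp add: ennreal_mult' mult.commute infsum_nonneg)
qed

section \<open>The averaging operator and its convergence in L1\<close>

definition avg :: "('d::finite \<Rightarrow> real \<Rightarrow> real) \<Rightarrow> real \<Rightarrow> (real ^ 'd \<Rightarrow> real) \<Rightarrow> int ^ 'd \<Rightarrow> real" where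
  "avg P h v x = (LBINT z. ker P h x z * v z) / h ^ CARD('d)"

text \<open>Each coordinate differs by at most 3 h, the width of the support, and the norm is
  bounded by the sum of the coordinates.\<close>

lemma ker_locality:
  fixes y z :: "real ^ 'd::finite" and h :: real
  assumes P: "\<forall>i. unit_kernel (P i)" and h: "h > 0" and nz: "ker P h (vfloor (y /\<^sub>R h)) z \<noteq> 0"
  shows "dist y z \<le> 3 * h * CARD('d)"
proof -
  have "\<bar>(y - z) $ i\<bar> \<le> 3 * h" for i
  proof -
    have "\<bar>y $ i / h - z $ i / h\<bar> \<le> 3"
      using ker_nonzeroD(1,2)[OF P nz, of i] by (simp add: divide_inverse_commute) linarith
    thus ?thesis using h by (simp add: field_simps abs_le_iff)
  qed
  hence "norm (y - z) \<le> real CARD('d) * (3 * h)"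
    using order_trans[OF norm_le_l1_cart[of "y - z"] sum_bounded_above[of UNIV "\<lambda>i. \<bar>(y - z) $ i\<bar>" "3 * h"]] by simp
  thus ?thesis by (simp add: dist_norm algebra_simps)
qed

lemma avg_local:
  fixes y :: "real ^ 'd::finite" and h :: real
  assumes P: "\<forall>i. unit_kernel (P i)" and h: "h > 0"
    and eq: "\<And>z. dist y z \<le> 3 * h * CARD('d) \<Longrightarrow> v z = w z"
  shows "avg P h v (vfloor (y /\<^sub>R h)) = avg P h w (vfloor (y /\<^sub>R h))"
  unfolding avg_def using eq ker_locality[OF P h]
  by (intro arg_cong2[where f = "(/)"] Bochner_Integration.integral_cong refl) (metis mult_zero_left)

lemma avg_const:
  fixes P :: "'d::finite \<Rightarrow> real \<Rightarrow> real"
  assumes P: "\<forall>i. unit_kernel (P i)" and h: "h > 0"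
  shows "avg P h (\<lambda>_. c) x = c"
  using integral_ker[OF P h, of x] h by (simp add: avg_def)

lemma avg_vfloor_measurable [measurable (raw)]:
  "g \<in> borel_measurable M \<Longrightarrow> (\<lambda>y. avg P h v (vfloor (g y /\<^sub>R h))) \<in> borel_measurable M"
proof -
  assume g: "g \<in> borel_measurable M"
  have "avg P h v \<in> measurable (count_space UNIV) borel" by simp
  moreover have "(\<lambda>y. vfloor (g y /\<^sub>R h)) \<in> measurable M (count_space UNIV)"
    using g by measurable
  ultimately show ?thesis by (rule measurable_compose[rotated])
qed

lemma integrable_ker_mult:
  fixes v :: "real ^ 'd::finite \<Rightarrow> real"
  assumes P: "\<forall>i. unit_kernel (P i)" and v: "integrable lborel v"
  shows "integrable lborel (\<lambda>z. ker P h x z * v z)"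
proof (rule Bochner_Integration.integrable_bound[OF v])
  show "(\<lambda>z. ker P h x z * v z) \<in> borel_measurable lborel"
    using v ker_measurable[OF P measurable_ident, of h x] by (intro borel_measurable_times) auto
  have "ker P h x z \<le> 1" for z using sum_ker_le_1[OF P, of "{x}" h z] by simp
  thus "AE z in lborel. norm (ker P h x z * v z) \<le> norm (v z)"
    using ker_nonneg[OF P, of h x] by (auto simp: abs_mult intro!: mult_left_le_one_le)
qed

lemma avg_diff:
  assumes "\<forall>i. unit_kernel (P i)" "integrable lborel v" "integrable lborel w"
  shows "avg P h (\<lambda>z. v z - w z) x = avg P h v x - avg P h w x"
  using assms by (simp add: avg_def right_diff_distrib diff_divide_distrib integrable_ker_mult)

lemma avg_add:
  assumes "\<forall>i. unit_kernel (P i)" "integrable lborel v" "integrable lborel w"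
  shows "avg P h (\<lambda>z. v z + w z) x = avg P h v x + avg P h w x"
  using assms by (simp add: avg_def distrib_left add_divide_distrib integrable_ker_mult)

text \<open>After exchanging the integrals, the kernel is integrated over the cell variable, where
  its mass is again \<open>h\<close> to the power of the dimension and cancels the normalization of
  \<open>avg\<close>.\<close>

lemma avg_contraction:
  fixes v :: "real ^ 'd::finite \<Rightarrow> real"
  assumes P: "\<forall>i. unit_kernel (P i)" and h: "h > 0" and v: "integrable lborel v"
  shows "integrable lborel (\<lambda>y. avg P h v (vfloor (y /\<^sub>R h)))" (is ?A)
    and "(LBINT y. \<bar>avg P h v (vfloor (y /\<^sub>R h))\<bar>) \<le> (LBINT y. \<bar>v y\<bar>)" (is ?B)
proof -
  note [measurable] = borel_measurable_integrable[OF v]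
  have [measurable]: "(\<lambda>(y, z). ker P h (vfloor (y /\<^sub>R h)) z) \<in> borel_measurable (lborel \<Otimes>\<^sub>M lborel)"
    using ker_vfloor_measurable[OF P] by (simp cong: measurable_cong_sets)
  have "(\<integral>\<^sup>+y. ennreal \<bar>avg P h v (vfloor (y /\<^sub>R h))\<bar> \<partial>lborel) \<le>
      (\<integral>\<^sup>+y. (\<integral>\<^sup>+z. ennreal (ker P h (vfloor (y /\<^sub>R h)) z * \<bar>v z\<bar> / h ^ CARD('d)) \<partial>lborel) \<partial>lborel)"
  proof (rule nn_integral_mono)
    fix y
    let ?k = "ker P h (vfloor (y /\<^sub>R h))"
    have "\<bar>avg P h v (vfloor (y /\<^sub>R h))\<bar> \<le> (LBINT z. \<bar>?k z * v z / h ^ CARD('d)\<bar>)"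
      using integral_abs_bound[of lborel "\<lambda>z. ?k z * v z / h ^ CARD('d)"] h by (simp add: avg_def)
    also have "ennreal \<dots> = (\<integral>\<^sup>+z. ennreal \<bar>?k z * v z / h ^ CARD('d)\<bar> \<partial>lborel)"
      by (rule nn_integral_eq_integral[symmetric]) (auto intro!: integrable_ker_mult P v)
    finally show "ennreal \<bar>avg P h v (vfloor (y /\<^sub>R h))\<bar> \<le>
        (\<integral>\<^sup>+z. ennreal (?k z * \<bar>v z\<bar> / h ^ CARD('d)) \<partial>lborel)"
      using h ker_nonneg[OF P, of h] by (simp add: abs_mult ennreal_leI)
  qed
  also have "\<dots> = (\<integral>\<^sup>+z. (\<integral>\<^sup>+y. ennreal (ker P h (vfloor (y /\<^sub>R h)) z * \<bar>v z\<bar> / h ^ CARD('d)) \<partial>lborel) \<partial>lborel)"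
    by (rule lborel_pair.Fubini') measurable
  also have "\<dots> = (\<integral>\<^sup>+z. ennreal \<bar>v z\<bar> \<partial>lborel)"
  proof (rule nn_integral_cong)
    fix z
    have "(\<integral>\<^sup>+y. ennreal (ker P h (vfloor (y /\<^sub>R h)) z * \<bar>v z\<bar> / h ^ CARD('d)) \<partial>lborel) =
        (\<integral>\<^sup>+y. ennreal (\<bar>v z\<bar> / h ^ CARD('d)) * ennreal (ker P h (vfloor (y /\<^sub>R h)) z) \<partial>lborel)"
      using h ker_nonneg[OF P, of h] by (intro nn_integral_cong) (simp add: ennreal_mult[symmetric] mult.commute)
    also have "\<dots> = ennreal (\<bar>v z\<bar> / h ^ CARD('d)) * ennreal (h ^ CARD('d))"
      by (subst nn_integral_cmult) (auto simp: nn_integral_ker_vfloor[OF P h])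
    finally show "(\<integral>\<^sup>+y. ennreal (ker P h (vfloor (y /\<^sub>R h)) z * \<bar>v z\<bar> / h ^ CARD('d)) \<partial>lborel) = ennreal \<bar>v z\<bar>"
      using h by (simp add: ennreal_mult[symmetric])
  qed
  also have "\<dots> = ennreal (LBINT y. \<bar>v y\<bar>)"
    by (rule nn_integral_eq_integral) (use v in auto)
  finally have *: "(\<integral>\<^sup>+y. ennreal \<bar>avg P h v (vfloor (y /\<^sub>R h))\<bar> \<partial>lborel) \<le> ennreal (LBINT y. \<bar>v y\<bar>)" .
  show ?A
    using * by (auto simp: integrable_iff_bounded intro: le_less_trans)
  have "ennreal (LBINT y. \<bar>avg P h v (vfloor (y /\<^sub>R h))\<bar>) \<le> ennreal (LBINT y. \<bar>v y\<bar>)"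
    using * by (subst (asm) nn_integral_eq_integral) (use \<open>?A\<close> in auto)
  thus ?B by (subst (asm) ennreal_le_iff) auto
qed

definition avg_L1 :: "('d::finite \<Rightarrow> real \<Rightarrow> real) \<Rightarrow> (nat \<Rightarrow> real) \<Rightarrow> (real ^ 'd \<Rightarrow> real) \<Rightarrow> bool" where
  "avg_L1 P h v \<longleftrightarrow> (\<lambda>n. \<integral>y. \<bar>avg P (h n) v (vfloor (y /\<^sub>R h n)) - v y\<bar> \<partial>lborel) \<longlonglongrightarrow> 0"

text \<open>An argument with three errors of size e / 3: the contraction property controls the
  averages of v - w, uniformly in the mesh.\<close>

lemma avg_L1_approx:
  fixes v :: "real ^ 'd::finite \<Rightarrow> real"
  assumes P: "\<forall>i. unit_kernel (P i)" and h: "\<And>n. h n > 0" and v: "integrable lborel v"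
    and approx: "\<And>e. e > 0 \<Longrightarrow> \<exists>w. integrable lborel w \<and> avg_L1 P h w \<and> (LBINT y. \<bar>v y - w y\<bar>) < e"
  shows "avg_L1 P h v"
  unfolding avg_L1_def
proof (rule LIMSEQ_I)
  fix e :: real assume e: "e > 0"
  obtain w where w: "integrable lborel w" "avg_L1 P h w" "(LBINT y. \<bar>v y - w y\<bar>) < e / 3"
    using approx[of "e / 3"] e by auto
  obtain N where N: "\<And>n. n \<ge> N \<Longrightarrow> \<bar>\<integral>y. \<bar>avg P (h n) w (vfloor (y /\<^sub>R h n)) - w y\<bar> \<partial>lborel\<bar> < e / 3"
    using LIMSEQ_D[OF w(2)[unfolded avg_L1_def], of "e / 3"] e by auto
  show "\<exists>N. \<forall>n\<ge>N. norm ((LBINT y. \<bar>avg P (h n) v (vfloor (y /\<^sub>R h n)) - v y\<bar>) - 0) < e"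
  proof (intro exI[of _ N] allI impI)
    fix n assume "n \<ge> N"
    let ?T = "\<lambda>v y. avg P (h n) v (vfloor (y /\<^sub>R h n))"
    note A = avg_contraction[OF P h[of n]]
    have iv: "integrable lborel (?T v)" "integrable lborel (?T w)" "integrable lborel (?T (\<lambda>z. v z - w z))"
      using v w by (auto intro: A)
    have "(LBINT y. \<bar>?T v y - v y\<bar>) \<le>
        (LBINT y. \<bar>?T (\<lambda>z. v z - w z) y\<bar> + \<bar>?T w y - w y\<bar> + \<bar>v y - w y\<bar>)"
      using v w iv by (intro integral_mono) (auto simp: avg_diff[OF P])
    also have "\<dots> = (LBINT y. \<bar>?T (\<lambda>z. v z - w z) y\<bar>) + (LBINT y. \<bar>?T w y - w y\<bar>) + (LBINT y. \<bar>v y - w y\<bar>)"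
      using v w iv by simp
    also have "\<dots> < e" using A(2)[of "\<lambda>z. v z - w z"] v w N[OF \<open>n \<ge> N\<close>] by auto
    finally show "norm ((LBINT y. \<bar>?T v y - v y\<bar>) - 0) < e" by simp
  qed
qed

text \<open>Inside \<open>U\<close> the averages are eventually equal to 1 by locality. At the
  boundary, which may have positive measure, nothing is known pointwise. But the averages have total
  mass at most that of \<open>U\<close>, so the mass outside is at most the mass missing inside;
  hence the factor 2.\<close>

lemma avg_L1_open:
  fixes U :: "(real ^ 'd::finite) set"
  assumes P: "\<forall>i. unit_kernel (P i)" and h: "\<And>n. h n > 0" "h \<longlonglongrightarrow> 0"
    and U: "open U" "emeasure lborel U < \<infinity>"
  shows "avg_L1 P h (indicator U)"
proof -
  let ?T = "\<lambda>n y. avg P (h n) (indicator U) (vfloor (y /\<^sub>R h n))"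
  have [measurable]: "U \<in> sets borel" using U by simp
  have iU: "integrable lborel (indicator U :: _ \<Rightarrow> real)" using U by (simp add: integrable_indicator_iff)
  have T: "0 \<le> ?T n y" "?T n y \<le> 1" for n y
  proof -
    show "0 \<le> ?T n y" unfolding avg_def using h(1)[of n] ker_nonneg[OF P]
      by (intro divide_nonneg_nonneg Bochner_Integration.integral_nonneg) (auto simp: less_imp_le)
    have "(LBINT z. ker P (h n) (vfloor (y /\<^sub>R h n)) z * indicator U z) \<le>
        (LBINT z. ker P (h n) (vfloor (y /\<^sub>R h n)) z)"
      using ker_nonneg[OF P] integral_ker[OF P h(1)] iU
      by (intro integral_mono integrable_ker_mult P mult_left_le) auto
    thus "?T n y \<le> 1" unfolding avg_def using h(1)[of n] integral_ker[OF P h(1)] by simp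
  qed
  have iT: "integrable lborel (?T n)" for n by (rule avg_contraction[OF P h(1) iU])
  have iTU: "integrable lborel (\<lambda>y. indicator U y * (1 - ?T n y))" for n
    by (rule Bochner_Integration.integrable_bound[OF iU]) (use T in \<open>auto simp: indicator_def\<close>)
  have "(\<lambda>n. \<integral>y. indicator U y * (1 - ?T n y) \<partial>lborel) \<longlonglongrightarrow> (\<integral>y. 0 \<partial>(lborel :: (real ^ 'd) measure))"
  proof (rule integral_dominated_convergence[OF _ _ iU])
    have "(\<lambda>n. indicator U y * (1 - ?T n y)) \<longlonglongrightarrow> 0" for y
    proof (cases "y \<in> U")
      case True
      then obtain d where d: "d > 0" "\<And>z. dist y z < d \<Longrightarrow> z \<in> U"
        using U(1) by (metis dist_commute open_dist)
      have "(\<lambda>n. 3 * h n * CARD('d)) \<longlonglongrightarrow> 3 * 0 * real CARD('d)" by (intro tendsto_intros h)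
      hence "eventually (\<lambda>n. 3 * h n * CARD('d) < d) sequentially"
        using d by (intro order_tendstoD) auto
      hence "eventually (\<lambda>n. 0 = indicator U y * (1 - ?T n y)) sequentially"
      proof eventually_elim
        case (elim n)
        have "?T n y = avg P (h n) (\<lambda>_. 1) (vfloor (y /\<^sub>R h n))"
          using d elim by (intro avg_local P h) (auto simp: indicator_def)
        thus ?case by (simp add: avg_const[OF P h(1)])
      qed
      thus ?thesis by (rule Lim_transform_eventually[OF tendsto_const])
    qed auto
    thus "AE y in lborel. (\<lambda>n. indicator U y * (1 - ?T n y)) \<longlonglongrightarrow> 0" by auto
  qed (use T in \<open>auto simp: indicator_def\<close>)
  hence lim: "(\<lambda>n. 2 * (LBINT y. indicator U y * (1 - ?T n y))) \<longlonglongrightarrow> 0"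
    by (auto dest: tendsto_mult_left[where c = 2])
  have le: "(LBINT y. \<bar>?T n y - indicator U y\<bar>) \<le> 2 * (LBINT y. indicator U y * (1 - ?T n y))" for n
  proof -
    have "(LBINT y. \<bar>?T n y - indicator U y\<bar>) =
        (LBINT y. ?T n y - indicator U y + 2 * (indicator U y * (1 - ?T n y)))"
      using T by (intro Bochner_Integration.integral_cong) (auto simp: indicator_def abs_if not_less intro: antisym)
    also have "\<dots> = (LBINT y. ?T n y) - (LBINT y. indicator U y) + 2 * (LBINT y. indicator U y * (1 - ?T n y))"
      using iT iU iTU by simp
    also have "(LBINT y. ?T n y) \<le> (LBINT y. indicator U y)"
      using avg_contraction(2)[OF P h(1) iU, of n] T by simp
    finally show ?thesis by simp
  qed
  show ?thesis unfolding avg_L1_def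
    by (rule tendsto_sandwich[OF _ _ tendsto_const lim]) (use le in auto)
qed

text \<open>Outer regularity reduces indicators of measurable sets to open ones; linear combinations
  and dominated limits then reach every integrable function.\<close>

lemma avg_L1_integrable:
  fixes v :: "real ^ 'd::finite \<Rightarrow> real"
  assumes P: "\<forall>i. unit_kernel (P i)" and h: "\<And>n. h n > 0" "h \<longlonglongrightarrow> 0" and v: "integrable lborel v"
  shows "avg_L1 P h v"
  using v
proof (induction v rule: integrable_induct)
  case (base A c)
  have A [measurable]: "A \<in> sets borel" using base by simp
  have iA: "integrable lborel (indicator A :: _ \<Rightarrow> real)" using base by (simp add: integrable_indicator_iff)
  have "avg_L1 P h (indicator A)"
  proof (rule avg_L1_approx[OF P h(1) iA])
    fix e :: real assume e: "e > 0"
    obtain U where U: "open U" "A \<subseteq> U" "emeasure lborel (U - A) < ennreal e"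
      using outer_regular_lborel[OF A, of e] e by auto
    have "emeasure lborel U \<le> emeasure lborel A + emeasure lborel (U - A)"
      using U by (subst plus_emeasure) (auto simp: Un_absorb1)
    also have "\<dots> < \<infinity>" using base less_trans[OF U(3) ennreal_less_top] by (auto simp: less_top)
    finally have fin: "emeasure lborel U < \<infinity>" .
    have "(LBINT y. \<bar>indicator A y - indicator U y :: real\<bar>) = (LBINT y. indicator (U - A) y)"
      using U by (intro Bochner_Integration.integral_cong) (auto simp: indicator_def)
    also have "\<dots> = measure lborel (U - A)" using U by simp
    also have "\<dots> < e"
    proof -
      have "emeasure lborel (U - A) = ennreal (measure lborel (U - A))"
        using less_trans[OF U(3) ennreal_less_top] by (intro emeasure_eq_ennreal_measure) simp
      thus ?thesis using U(3) by (simp add: ennreal_less_iff)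
    qed
    finally show "\<exists>w. integrable lborel w \<and> avg_L1 P h w \<and> (LBINT y. \<bar>indicator A y - w y\<bar>) < e"
      using U fin avg_L1_open[OF P h U(1) fin] by (intro exI[of _ "indicator U"]) (auto simp: integrable_indicator_iff)
  qed
  hence "(\<lambda>n. \<bar>c\<bar> * (LBINT y. \<bar>avg P (h n) (indicator A) (vfloor (y /\<^sub>R h n)) - indicator A y\<bar>)) \<longlonglongrightarrow> \<bar>c\<bar> * 0"
    unfolding avg_L1_def by (intro tendsto_intros)
  moreover have "avg P (h n) (\<lambda>y. indicator A y * c) x = c * avg P (h n) (indicator A) x" for n x
    by (simp add: avg_def mult.assoc[symmetric])
  hence "\<bar>avg P (h n) (\<lambda>y. indicator A y * c) x - indicator A y * c\<bar> =
      \<bar>c\<bar> * \<bar>avg P (h n) (indicator A) x - indicator A y\<bar>" for n x y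
    by (simp add: abs_mult[symmetric] right_diff_distrib mult.commute)
  ultimately show ?case
    by (simp add: avg_L1_def)
next
  case (add f g)
  let ?T = "\<lambda>n v y. avg P (h n) v (vfloor (y /\<^sub>R h n))"
  note A = avg_contraction(1)[OF P h(1)]
  have iT: "integrable lborel (?T n f)" "integrable lborel (?T n g)" "integrable lborel (?T n (\<lambda>y. f y + g y))" for n
    using add by (auto intro!: A)
  have lim: "(\<lambda>n. (LBINT y. \<bar>?T n f y - f y\<bar>) + (LBINT y. \<bar>?T n g y - g y\<bar>)) \<longlonglongrightarrow> 0"
    by (rule tendsto_add_zero) (use add in \<open>auto simp: avg_L1_def\<close>)
  have le: "(LBINT y. \<bar>?T n (\<lambda>y. f y + g y) y - (f y + g y)\<bar>) \<le>
      (LBINT y. \<bar>?T n f y - f y\<bar>) + (LBINT y. \<bar>?T n g y - g y\<bar>)" for n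
  proof -
    have "(LBINT y. \<bar>?T n (\<lambda>y. f y + g y) y - (f y + g y)\<bar>) \<le> (LBINT y. \<bar>?T n f y - f y\<bar> + \<bar>?T n g y - g y\<bar>)"
      using add iT[of n] by (intro integral_mono) (auto simp: avg_add[OF P])
    thus ?thesis using add iT[of n] by simp
  qed
  show ?case unfolding avg_L1_def
    by (rule tendsto_sandwich[OF _ _ tendsto_const lim]) (use le in auto)
next
  case (lim f s)
  show ?case
  proof (rule avg_L1_approx[OF P h(1) lim(4)])
    fix e :: real assume e: "e > 0"
    have "(\<lambda>i. \<integral>y. \<bar>f y - s i y\<bar> \<partial>lborel) \<longlonglongrightarrow> (\<integral>y. 0 \<partial>(lborel :: (real ^ 'd) measure))"
    proof (rule integral_dominated_convergence[where w = "\<lambda>y. 3 * \<bar>f y\<bar>"])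
      show "AE y in lborel. (\<lambda>i. \<bar>f y - s i y\<bar>) \<longlonglongrightarrow> 0"
      proof (rule AE_I2)
        fix y :: "real ^ 'd"
        have "(\<lambda>i. s i y) \<longlonglongrightarrow> f y" using lim(2)[of y] by simp
        hence "(\<lambda>i. \<bar>f y - s i y\<bar>) \<longlonglongrightarrow> \<bar>f y - f y\<bar>"
          by (rule tendsto_rabs[OF tendsto_diff[OF tendsto_const]])
        thus "(\<lambda>i. \<bar>f y - s i y\<bar>) \<longlonglongrightarrow> 0" by simp
      qed
      show "AE y in lborel. norm \<bar>f y - s i y\<bar> \<le> 3 * \<bar>f y\<bar>" for i
      proof (rule AE_I2)
        fix y show "norm \<bar>f y - s i y\<bar> \<le> 3 * \<bar>f y\<bar>"
          using lim(3)[of y i] abs_triangle_ineq4[of "f y" "s i y"] by simp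
      qed
    qed (use lim(1,4) in auto)
    hence "eventually (\<lambda>i. (LBINT y. \<bar>f y - s i y\<bar>) < e) sequentially"
      using e by (intro order_tendstoD) auto
    then obtain i where "(LBINT y. \<bar>f y - s i y\<bar>) < e" by (auto simp: eventually_sequentially)
    thus "\<exists>w. integrable lborel w \<and> avg_L1 P h w \<and> (LBINT y. \<bar>f y - w y\<bar>) < e"
      using lim(1,5) by blast
  qed
qed

lemma avg_converges_AE:
  fixes v :: "real ^ 'd::finite \<Rightarrow> real"
  assumes P: "\<forall>i. unit_kernel (P i)" and v: "locally_integrable v"
  obtains h where "\<And>n. h n > 0" "h \<longlonglongrightarrow> 0"
    "AE y in lborel. y \<in> ball 0 R \<longrightarrow> (\<lambda>n. avg P (h n) v (vfloor (y /\<^sub>R h n))) \<longlonglongrightarrow> v y"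
proof -
  \<comment> \<open>\<open>v\<close> is only locally integrable. At points of the ball of radius
    \<open>R\<close> the averages of \<open>w\<close> and \<open>v\<close> coincide once the kernels
    reach less than distance 1.\<close>
  define w where "w = (\<lambda>y. indicator (cball 0 (R + 1)) y * v y)"
  define h0 where "h0 n = inverse (real (Suc n))" for n
  have h0: "h0 n > 0" "h0 \<longlonglongrightarrow> 0" for n
    unfolding h0_def using LIMSEQ_inverse_real_of_nat by auto
  have w: "integrable lborel w"
    using v by (auto simp: locally_integrable_def w_def set_integrable_def)
  let ?T = "\<lambda>h v y. avg P h v (vfloor (y /\<^sub>R h))"
  have iT: "integrable lborel (\<lambda>y. ?T (h0 n) w y - w y)" for n
    using w by (intro Bochner_Integration.integrable_diff avg_contraction P h0)
  have "(\<lambda>n. \<integral>y. norm (?T (h0 n) w y - w y) \<partial>lborel) \<longlonglongrightarrow> 0"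
    using avg_L1_integrable[OF P h0 w] by (simp add: avg_L1_def)
  \<comment> \<open>Convergence in L1 gives pointwise convergence only along a subsequence, which is
    why the meshes are produced by the lemma instead of being prescribed.\<close>
  from tendsto_L1_AE_subseq[OF iT this] obtain r where r: "strict_mono r"
    "AE y in lborel. (\<lambda>n. ?T (h0 (r n)) w y - w y) \<longlonglongrightarrow> 0" by blast
  show ?thesis
  proof (rule that[of "h0 \<circ> r"])
    show h: "(h0 \<circ> r) \<longlonglongrightarrow> 0" using h0(2) r(1) by (rule LIMSEQ_subseq_LIMSEQ)
    show "AE y in lborel. y \<in> ball 0 R \<longrightarrow> (\<lambda>n. ?T ((h0 \<circ> r) n) v y) \<longlonglongrightarrow> v y"
      using r(2)
    proof eventually_elim
      case (elim y)
      show ?case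
      proof
        assume y: "y \<in> ball 0 R"
        have "(\<lambda>n. 3 * (h0 \<circ> r) n * CARD('d)) \<longlonglongrightarrow> 3 * 0 * real CARD('d)" by (intro tendsto_intros h)
        hence "eventually (\<lambda>n. 3 * (h0 \<circ> r) n * CARD('d) < 1) sequentially"
          by (rule order_tendstoD(2)) simp
        hence ev: "eventually (\<lambda>n. ?T (h0 (r n)) w y = ?T ((h0 \<circ> r) n) v y) sequentially"
        proof eventually_elim
          case (elim n)
          have "?T (h0 (r n)) w y = ?T (h0 (r n)) v y"
          proof (rule avg_local[OF P h0(1)])
            fix z assume "dist y z \<le> 3 * h0 (r n) * CARD('d)"
            hence "dist y z < 1" using elim by simp
            hence "dist 0 z \<le> R + 1" using y dist_triangle[of 0 z y] by simp
            thus "w z = v z" by (simp add: w_def)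
          qed
          thus ?case by simp
        qed
        have lim: "(\<lambda>n. ?T (h0 (r n)) w y) \<longlonglongrightarrow> w y"
          using elim by (simp add: LIM_zero_iff)
        have "w y = v y" using y by (simp add: w_def)
        thus "(\<lambda>n. ?T ((h0 \<circ> r) n) v y) \<longlonglongrightarrow> v y"
          using Lim_transform_eventually[OF lim ev] by simp
      qed
    qed
  qed (use h0 in auto)
qed

section \<open>Function spaces on the lattice\<close>

lemma summable_on_iff_integrable_real:
  fixes f :: "'a \<Rightarrow> real"
  shows "f summable_on A \<longleftrightarrow> integrable (count_space A) f"
  using abs_summable_equivalent[of f A] summable_on_iff_abs_summable_on_real[of f A]
  by (simp add: Infinite_Set_Sum.abs_summable_on_def)

lemma infsum_eq_integral_real:
  fixes f :: "'a \<Rightarrow> real"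
  assumes "f summable_on A"
  shows "infsum f A = (\<integral>x. f x \<partial>count_space A)"
  using infsetsum_infsum[of f A] assms summable_on_iff_integrable_real[of f A]
  by (simp add: Infinite_Set_Sum.abs_summable_on_def infsetsum_def)

lemma infsum_dominated_convergence:
  fixes f :: "nat \<Rightarrow> 'a \<Rightarrow> real"
  assumes "\<And>x. (\<lambda>n. f n x) \<longlonglongrightarrow> g x" "w summable_on UNIV" "\<And>n x. \<bar>f n x\<bar> \<le> w x"
  shows "\<And>n. f n summable_on UNIV" "g summable_on UNIV" "(\<lambda>n. infsum (f n) UNIV) \<longlonglongrightarrow> infsum g UNIV"
proof -
  note * = integrable_dominated_convergence2[of g "count_space UNIV" f w]
    integrable_dominated_convergence[of g "count_space UNIV" f w]
    integral_dominated_convergence[of g "count_space UNIV" f w]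
  have f: "integrable (count_space UNIV) (f n)" for n
    using assms summable_on_iff_integrable_real[of w UNIV] by (intro *(1)) auto
  have g: "integrable (count_space UNIV) g"
    using assms summable_on_iff_integrable_real[of w UNIV] by (intro *(2)) auto
  show f': "f n summable_on UNIV" for n using f by (simp add: summable_on_iff_integrable_real)
  show g': "g summable_on UNIV" using g by (simp add: summable_on_iff_integrable_real)
  have "(\<lambda>n. \<integral>x. f n x \<partial>count_space UNIV) \<longlonglongrightarrow> (\<integral>x. g x \<partial>count_space UNIV)"
    using assms summable_on_iff_integrable_real[of w UNIV] by (intro *(3)) auto
  thus "(\<lambda>n. infsum (f n) UNIV) \<longlonglongrightarrow> infsum g UNIV"
    by (simp add: infsum_eq_integral_real f' g')
qed

lemma summable_on_bounded_sums:
  fixes f :: "'a \<Rightarrow> real"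
  assumes "\<And>x. f x \<ge> 0" "\<And>F. finite F \<Longrightarrow> sum f F \<le> C"
  shows "f summable_on UNIV" "infsum f UNIV \<le> C"
proof -
  show s: "f summable_on UNIV"
    using assms by (intro nonneg_bdd_above_summable_on) (auto intro!: bdd_aboveI[of _ C])
  show "infsum f UNIV \<le> C"
    using assms by (intro infsum_le_finite_sums s) auto
qed

lemma summable_on_comparison_real:
  fixes f g :: "'a \<Rightarrow> real"
  assumes "g summable_on UNIV" "\<And>x. \<bar>f x\<bar> \<le> g x"
  shows "f summable_on UNIV"
  using infsum_dominated_convergence(2)[of "\<lambda>_. f" f g] assms by auto

lemma infsum_member_le:
  fixes f :: "'a \<Rightarrow> real"
  assumes "f summable_on UNIV" "\<And>x. f x \<ge> 0"
  shows "f x \<le> infsum f UNIV"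
  using finite_sum_le_infsum[OF assms(1), of "{x}"] assms(2) by simp

lemma infsum_sum_real:
  fixes f :: "'b \<Rightarrow> 'a \<Rightarrow> real"
  assumes "finite I" "\<And>i. i \<in> I \<Longrightarrow> f i summable_on A"
  shows "(\<Sum>\<^sub>\<infinity>x\<in>A. \<Sum>i\<in>I. f i x) = (\<Sum>i\<in>I. infsum (f i) A)"
proof -
  have "(\<lambda>x. \<Sum>i\<in>I. f i x) summable_on A \<and> (\<Sum>\<^sub>\<infinity>x\<in>A. \<Sum>i\<in>I. f i x) = (\<Sum>i\<in>I. infsum (f i) A)"
    using assms
  proof (induction I rule: finite_induct)
    case (insert i I)
    hence IH: "(\<lambda>x. \<Sum>i\<in>I. f i x) summable_on A" "(\<Sum>\<^sub>\<infinity>x\<in>A. \<Sum>i\<in>I. f i x) = (\<Sum>i\<in>I. infsum (f i) A)"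
      and s: "f i summable_on A" by auto
    have "(\<lambda>x. \<Sum>j\<in>insert i I. f j x) = (\<lambda>x. f i x + (\<Sum>j\<in>I. f j x))"
      using insert(1,2) by simp
    thus ?case using summable_on_add[OF s IH(1)] infsum_add[OF s IH(1)] IH(2) insert(1,2) by simp
  qed simp
  thus ?thesis ..
qed

lemma summable_on_finite_support:
  fixes f :: "'a \<Rightarrow> real"
  assumes "finite {x. f x \<noteq> 0}"
  shows "f summable_on UNIV"
proof -
  have "f summable_on {x. f x \<noteq> 0} \<longleftrightarrow> f summable_on UNIV"
    by (rule summable_on_cong_neutral) auto
  thus ?thesis using assms by simp
qed

lemma summable_on_imp_finite_superlevel:
  fixes f :: "'a \<Rightarrow> real"
  assumes s: "f summable_on UNIV" and nn: "\<And>x. f x \<ge> 0" and e: "e > 0"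
  shows "finite {x. f x > e}"
proof (rule ccontr)
  assume "infinite {x. f x > e}"
  then obtain F where F: "finite F" "card F = nat \<lceil>infsum f UNIV / e\<rceil> + 1" "F \<subseteq> {x. f x > e}"
    using infinite_arbitrarily_large by metis
  have "infsum f UNIV / e < real (card F)" using F(2) by linarith
  hence "infsum f UNIV < real (card F) * e" using e by (simp add: field_simps)
  also have "\<dots> \<le> sum f F" using F(3) by (intro sum_bounded_below) auto
  also have "\<dots> \<le> infsum f UNIV" using nn by (intro finite_sum_le_infsum s F) auto
  finally show False by simp
qed

section \<open>Energy, power sums and vanishing at infinity\<close>

definition unit_vec :: "'d::finite \<Rightarrow> int ^ 'd" where
  "unit_vec i = axis i 1"

definition sq_diff :: "(int ^ 'd::finite \<Rightarrow> real) \<Rightarrow> 'd \<Rightarrow> int ^ 'd \<Rightarrow> real" where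
  "sq_diff u i x = (u (x + unit_vec i) - u x)\<^sup>2"

text \<open>An infinite sum that does not converge is 0 by convention, so \<open>energy\<close>
  alone does not reveal finiteness.\<close>

definition finite_energy :: "(int ^ 'd::finite \<Rightarrow> real) \<Rightarrow> bool" where
  "finite_energy u \<longleftrightarrow> (\<forall>i. sq_diff u i summable_on UNIV)"

definition energy :: "(int ^ 'd::finite \<Rightarrow> real) \<Rightarrow> real" where
  "energy u = (\<Sum>i\<in>UNIV. infsum (sq_diff u i) UNIV)"

definition power_sum :: "real \<Rightarrow> ('a \<Rightarrow> real) \<Rightarrow> real" where
  "power_sum p u = (\<Sum>\<^sub>\<infinity>x. \<bar>u x\<bar> powr p)"

definition ell2 :: "('a \<Rightarrow> real) \<Rightarrow> bool" where
  "ell2 u \<longleftrightarrow> (\<lambda>x. (u x)\<^sup>2) summable_on UNIV"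

definition sq_sum :: "('a \<Rightarrow> real) \<Rightarrow> real" where
  "sq_sum u = (\<Sum>\<^sub>\<infinity>x. (u x)\<^sup>2)"

text \<open>Convergence to 0 at infinity in the discrete topology. It is the common substitute for
  membership in a summability space: it gives finite supports after truncation and excludes nonzero
  constants.\<close>

definition vanishing :: "('a \<Rightarrow> real) \<Rightarrow> bool" where
  "vanishing u \<longleftrightarrow> (\<forall>e>0. finite {x. \<bar>u x\<bar> > e})"

lemma sq_diff_nonneg [simp]: "sq_diff u i x \<ge> 0" by (simp add: sq_diff_def)
lemma energy_nonneg [simp]: "energy u \<ge> 0" by (auto simp: energy_def intro!: sum_nonneg infsum_nonneg)
lemma power_sum_nonneg [simp]: "power_sum p u \<ge> 0" by (auto simp: power_sum_def intro!: infsum_nonneg)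
lemma sq_sum_nonneg [simp]: "sq_sum u \<ge> 0" by (auto simp: sq_sum_def intro!: infsum_nonneg)

lemma abs_powr_2: "\<bar>x :: real\<bar> powr 2 = x\<^sup>2"
  by (cases "x = 0") auto

lemma power_sum_2: "power_sum 2 u = sq_sum u"
  by (simp add: power_sum_def sq_sum_def abs_powr_2)

lemma bij_plus: "bij (\<lambda>x :: 'a::group_add. x + a)"
  by (rule bij_betw_byWitness[where f' = "\<lambda>x. x - a"]) auto

lemma summable_on_shift: "(\<lambda>x :: 'a::group_add. f (x + a)) summable_on UNIV \<longleftrightarrow> f summable_on UNIV"
  by (rule summable_on_reindex_bij_betw) (rule bij_plus)

lemma infsum_shift: "(\<Sum>\<^sub>\<infinity>x :: 'a::group_add. f (x + a)) = infsum f UNIV"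
  by (rule infsum_reindex_bij_betw) (rule bij_plus)

text \<open>An integer vector whose absolute values add up to 1 has a single nonzero entry, and that
  entry is 1 or -1.\<close>

lemma neighbours_eq:
  "{y. adj x y} = (\<lambda>i. x + unit_vec i) ` UNIV \<union> (\<lambda>i. x - unit_vec i) ` UNIV"
proof (intro equalityI subsetI)
  fix y assume "y \<in> {y. adj x y}"
  hence s: "(\<Sum>i\<in>UNIV. \<bar>x $ i - y $ i\<bar>) = 1" by (simp add: adj_def)
  then obtain i where i: "x $ i \<noteq> y $ i" by (metis (no_types, lifting) abs_0 diff_self sum.neutral zero_neq_one)
  have "(\<Sum>i\<in>UNIV. \<bar>x $ i - y $ i\<bar>) = \<bar>x $ i - y $ i\<bar> + (\<Sum>j\<in>UNIV - {i}. \<bar>x $ j - y $ j\<bar>)"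
    by (rule sum.remove) auto
  moreover have "(\<Sum>j\<in>UNIV - {i}. \<bar>x $ j - y $ j\<bar>) \<ge> 0" by (rule sum_nonneg) auto
  moreover have "\<bar>x $ i - y $ i\<bar> \<ge> 1" using i by linarith
  ultimately have a: "\<bar>x $ i - y $ i\<bar> = 1" and "(\<Sum>j\<in>UNIV - {i}. \<bar>x $ j - y $ j\<bar>) = 0" using s by linarith+
  hence "\<forall>j\<in>UNIV - {i}. \<bar>x $ j - y $ j\<bar> = 0" by (subst (asm) sum_nonneg_eq_0_iff) auto
  hence z: "y $ j = x $ j" if "j \<noteq> i" for j using that by auto
  have "y = x + unit_vec i \<or> y = x - unit_vec i"
  proof (cases "x $ i < y $ i")
    case True
    hence "y $ i = x $ i + 1" using a by linarith
    hence "y $ j = (x + unit_vec i) $ j" for j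
      using z[of j] by (cases "j = i") (simp_all add: unit_vec_def axis_def)
    thus ?thesis by (simp add: vec_eq_iff)
  next
    case False
    hence "y $ i = x $ i - 1" using a by linarith
    hence "y $ j = (x - unit_vec i) $ j" for j
      using z[of j] by (cases "j = i") (simp_all add: unit_vec_def axis_def)
    thus ?thesis by (simp add: vec_eq_iff)
  qed
  thus "y \<in> (\<lambda>i. x + unit_vec i) ` UNIV \<union> (\<lambda>i. x - unit_vec i) ` UNIV" by auto
next
  fix y assume "y \<in> (\<lambda>i. x + unit_vec i) ` UNIV \<union> (\<lambda>i. x - unit_vec i) ` UNIV"
  moreover have "(\<Sum>j\<in>UNIV. \<bar>unit_vec i $ j\<bar>) = 1" for i :: 'a
    by (simp add: unit_vec_def axis_def if_distrib cong: if_cong)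
  ultimately show "y \<in> {y. adj x y}" by (auto simp: adj_def)
qed

lemma sum_neighbours:
  fixes u :: "int ^ 'd::finite \<Rightarrow> real"
  shows "(\<Sum>y\<in>{y. adj x y}. \<bar>u y - u x\<bar>\<^sup>2) = (\<Sum>i\<in>UNIV. sq_diff u i x + sq_diff u i (x - unit_vec i))"
proof -
  have ne: "unit_vec i \<noteq> - unit_vec j" for i j :: 'd
  proof
    assume "unit_vec i = - unit_vec j"
    hence "unit_vec i $ i = (- unit_vec j) $ i" by simp
    thus False by (auto simp: unit_vec_def axis_def split: if_splits)
  qed
  have inj: "inj (unit_vec :: 'd \<Rightarrow> _)" by (auto simp: inj_def unit_vec_def axis_eq_axis)
  have "(\<Sum>y\<in>{y. adj x y}. \<bar>u y - u x\<bar>\<^sup>2) =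
      (\<Sum>y\<in>(\<lambda>i. x + unit_vec i) ` UNIV. \<bar>u y - u x\<bar>\<^sup>2) + (\<Sum>y\<in>(\<lambda>i. x - unit_vec i) ` UNIV. \<bar>u y - u x\<bar>\<^sup>2)"
    unfolding neighbours_eq
  proof (rule sum.union_disjoint)
    show "(\<lambda>i. x + unit_vec i) ` UNIV \<inter> (\<lambda>i. x - unit_vec i) ` UNIV = {}"
    proof (rule equals0I)
      fix y assume "y \<in> (\<lambda>i. x + unit_vec i) ` UNIV \<inter> (\<lambda>i. x - unit_vec i) ` UNIV"
      then obtain i j where "y = x + unit_vec i" "y = x - unit_vec j" by blast
      hence "x + unit_vec i = x + (- unit_vec j)" by simp
      thus False using ne[of i j] add_left_cancel[of x "unit_vec i" "- unit_vec j"] by simp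
    qed
  qed auto
  also have "\<dots> = (\<Sum>i\<in>UNIV. \<bar>u (x + unit_vec i) - u x\<bar>\<^sup>2) + (\<Sum>i\<in>UNIV. \<bar>u (x - unit_vec i) - u x\<bar>\<^sup>2)"
    using inj by (subst (1 2) sum.reindex) (auto simp: inj_def)
  finally show ?thesis by (simp add: sum.distrib sq_diff_def power2_commute)
qed

text \<open>The sum over all neighbours meets every edge from both ends, which cancels the factor
  1/2; the backward differences are translates of the forward ones.\<close>

lemma grad_norm_eq:
  assumes "finite_energy u"
  shows "grad_norm u = sqrt (energy u)"
proof -
  have s: "sq_diff u i summable_on UNIV" for i using assms by (simp add: finite_energy_def)
  have s': "(\<lambda>x. sq_diff u i (x - unit_vec i)) summable_on UNIV" for i
    using summable_on_shift[of "sq_diff u i" "- unit_vec i"] s by simp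
  have i': "(\<Sum>\<^sub>\<infinity>x. sq_diff u i (x - unit_vec i)) = infsum (sq_diff u i) UNIV" for i
    using infsum_shift[of "sq_diff u i" "- unit_vec i"] by simp
  have "(\<Sum>\<^sub>\<infinity>x. \<Sum>y\<in>{y. adj x y}. \<bar>u y - u x\<bar>\<^sup>2) =
      (\<Sum>i\<in>UNIV. \<Sum>\<^sub>\<infinity>x. sq_diff u i x + sq_diff u i (x - unit_vec i))"
    unfolding sum_neighbours by (rule infsum_sum_real) (auto intro!: summable_on_add s s')
  also have "\<dots> = (\<Sum>i\<in>UNIV. infsum (sq_diff u i) UNIV + infsum (sq_diff u i) UNIV)"
    by (simp add: infsum_add s s' i')
  also have "\<dots> = 2 * energy u" by (simp add: energy_def sum.distrib sum_distrib_left)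
  finally show ?thesis by (simp add: grad_norm_def)
qed

lemma lq_norm_powr:
  assumes "q > 0" shows "lq_norm q u powr a = power_sum q u powr (a / q)"
  using assms by (simp add: lq_norm_def power_sum_def powr_powr)

lemma lq_norm_2: "(lq_norm 2 u)\<^sup>2 = sq_sum u"
  using lq_norm_powr[of 2 u 2] by (simp add: power_sum_2 lq_norm_def)

lemma ell2_iff: "ell2 u \<longleftrightarrow> (\<lambda>x. \<bar>u x\<bar> powr 2) summable_on UNIV"
  by (simp add: ell2_def abs_powr_2)

lemma sq_diff_le: "sq_diff u i x \<le> 2 * (u (x + unit_vec i))\<^sup>2 + 2 * (u x)\<^sup>2"
  using sum_squares_bound[of "u (x + unit_vec i)" "- u x"] by (simp add: sq_diff_def power2_eq_square algebra_simps)

lemma ell2_imp_finite_energy: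
  assumes "ell2 u" shows "finite_energy u"
  unfolding finite_energy_def
proof
  fix i
  have "(\<lambda>x. 2 * (u (x + unit_vec i))\<^sup>2 + 2 * (u x)\<^sup>2) summable_on UNIV"
    using assms summable_on_shift[of "\<lambda>x. (u x)\<^sup>2" "unit_vec i"]
    by (intro summable_on_add summable_on_cmult_right) (auto simp: ell2_def)
  thus "sq_diff u i summable_on UNIV"
    by (rule summable_on_comparison_real) (use sq_diff_le[of u i] in auto)
qed

lemma power_summable_imp_vanishing:
  assumes "p > 0" "(\<lambda>x. \<bar>u x\<bar> powr p) summable_on UNIV"
  shows "vanishing u"
  unfolding vanishing_def
proof (intro allI impI)
  fix e :: real assume e: "e > 0"
  have "{x. \<bar>u x\<bar> > e} \<subseteq> {x. \<bar>u x\<bar> powr p > e powr p}"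
    using assms e by (auto intro: powr_less_mono2)
  thus "finite {x. \<bar>u x\<bar> > e}"
    using summable_on_imp_finite_superlevel[OF assms(2), of "e powr p"] e
    by (auto intro: finite_subset)
qed

lemma ell2_imp_vanishing: "ell2 u \<Longrightarrow> vanishing u"
  using power_summable_imp_vanishing[of 2 u] by (simp add: ell2_iff)

text \<open>Every single square is at most the whole sum, so the p-th power is dominated by a
  constant multiple of the square. There is no Euclidean counterpart without a gradient.\<close>

lemma ell2_power_summable:
  assumes "ell2 u" "p \<ge> 2"
  shows "(\<lambda>x. \<bar>u x\<bar> powr p) summable_on UNIV" "power_sum p u \<le> sq_sum u powr (p / 2)"
proof -
  have s: "(\<lambda>x. (u x)\<^sup>2) summable_on UNIV" using assms by (simp add: ell2_def)
  have b: "\<bar>u x\<bar> powr p \<le> sq_sum u powr (p / 2 - 1) * (u x)\<^sup>2" for x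
  proof -
    have "\<bar>u x\<bar> powr p = (\<bar>u x\<bar> powr 2) powr (p / 2 - 1) * \<bar>u x\<bar> powr 2"
      by (simp add: powr_powr powr_add[symmetric] algebra_simps del: powr_numeral)
    also have "\<dots> \<le> sq_sum u powr (p / 2 - 1) * \<bar>u x\<bar> powr 2"
      using assms(2) infsum_member_le[OF s, of x]
      by (intro mult_right_mono powr_mono2) (auto simp: abs_powr_2 sq_sum_def)
    finally show ?thesis by (simp add: abs_powr_2)
  qed
  have s': "(\<lambda>x. sq_sum u powr (p / 2 - 1) * (u x)\<^sup>2) summable_on UNIV"
    by (intro summable_on_cmult_right s)
  show sp: "(\<lambda>x. \<bar>u x\<bar> powr p) summable_on UNIV"
    by (rule summable_on_comparison_real[OF s']) (use b in auto)
  have "power_sum p u \<le> (\<Sum>\<^sub>\<infinity>x. sq_sum u powr (p / 2 - 1) * (u x)\<^sup>2)"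
    unfolding power_sum_def by (intro infsum_mono sp s' b)
  also have "\<dots> = sq_sum u powr (p / 2 - 1) * sq_sum u" by (simp add: infsum_cmult_right' sq_sum_def)
  also have "\<dots> = sq_sum u powr (p / 2)"
    by (cases "sq_sum u = 0") (auto simp: powr_diff)
  finally show "power_sum p u \<le> sq_sum u powr (p / 2)" .
qed

text \<open>Zero energy makes the function constant along a ray in one coordinate direction, and a
  nonzero constant on infinitely many points contradicts vanishing.\<close>

lemma energy_zero_imp_zero:
  assumes u: "vanishing u" "finite_energy u" "energy u = 0"
  shows "u = (\<lambda>_. 0)"
proof
  fix x
  \<comment> \<open>Any direction will do; the index type is nonempty.\<close>
  define i where "i = (undefined :: 'a)"
  have "infsum (sq_diff u i) UNIV = 0"
    using u(3) unfolding energy_def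
    by (subst (asm) sum_nonneg_eq_0_iff) (auto intro: infsum_nonneg)
  hence "sq_diff u i y = 0" for y
    using u(2) by (intro nonneg_infsum_le_0D[where A = UNIV]) (auto simp: finite_energy_def)
  hence step: "u (y + unit_vec i) = u y" for y by (simp add: sq_diff_def)
  have const: "u (x + of_nat n * unit_vec i) = u x" for n :: nat
  proof (induction n)
    case (Suc n)
    have "x + of_nat (Suc n) * unit_vec i = (x + of_nat n * unit_vec i) + unit_vec i"
      by (simp add: algebra_simps)
    thus ?case using Suc step[of "x + of_nat n * unit_vec i"] by metis
  qed simp
  show "u x = 0"
  proof (rule ccontr)
    assume "u x \<noteq> 0"
    hence "\<bar>u x\<bar> / 2 > 0" by simp
    hence "finite {y. \<bar>u y\<bar> > \<bar>u x\<bar> / 2}" using u(1) unfolding vanishing_def by blast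
    moreover have "range (\<lambda>n. x + of_nat n * unit_vec i) \<subseteq> {y. \<bar>u y\<bar> > \<bar>u x\<bar> / 2}"
      using const \<open>u x \<noteq> 0\<close> by auto
    ultimately have "finite (range (\<lambda>n. x + of_nat n * unit_vec i))" by (rule rev_finite_subset)
    moreover have "inj (\<lambda>n :: nat. x + of_nat n * unit_vec i)"
    proof (rule injI)
      fix m n :: nat assume "x + of_nat m * unit_vec i = x + of_nat n * unit_vec i"
      hence "(of_nat m * unit_vec i) $ i = (of_nat n * unit_vec i) $ i" by simp
      thus "m = n" by (simp add: unit_vec_def vector_component of_nat_index)
    qed
    ultimately show False using finite_imageD by blast
  qed
qed

lemma ell2_nonzero_pos:
  fixes u :: "int ^ 'd::finite \<Rightarrow> real"
  assumes u: "ell2 u" "u \<noteq> (\<lambda>_. 0)"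
  shows "sq_sum u > 0" "energy u > 0"
proof -
  obtain x where "u x \<noteq> 0" using u by auto
  hence "0 < (u x)\<^sup>2" by simp
  also have "\<dots> \<le> sq_sum u" unfolding sq_sum_def
    using u by (intro infsum_member_le[where f = "\<lambda>x. (u x)\<^sup>2"]) (auto simp: ell2_def)
  finally show "sq_sum u > 0" .
  show "energy u > 0"
    using energy_zero_imp_zero[OF ell2_imp_vanishing[OF u(1)] ell2_imp_finite_energy[OF u(1)]] u(2)
      energy_nonneg[of u] by linarith
qed

text \<open>Truncating values instead of cutting off in space needs no decay rate of \<open>u\<close>, so it
  serves \<open>H1_lattice\<close> and \<open>D12_lattice\<close> alike.\<close>

definition clamp_level :: "real \<Rightarrow> real \<Rightarrow> real" where
  "clamp_level e t = max (- e) (min e t)"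

lemma clamp_level_props:
  "e \<ge> 0 \<Longrightarrow> \<bar>clamp_level e t\<bar> \<le> \<bar>t\<bar>" "e \<ge> 0 \<Longrightarrow> \<bar>clamp_level e t\<bar> \<le> e"
  "\<bar>clamp_level e s - clamp_level e t\<bar> \<le> \<bar>s - t\<bar>"
  "\<bar>(s - clamp_level e s) - (t - clamp_level e t)\<bar> \<le> \<bar>s - t\<bar>"
  "\<bar>t\<bar> \<le> e \<Longrightarrow> clamp_level e t = t"
  by (auto simp: clamp_level_def max_def min_def abs_le_iff abs_if split: if_splits)

definition level :: "nat \<Rightarrow> real" where "level n = inverse (real (Suc n))"

lemma level_props: "level n > 0" "level \<longlonglongrightarrow> 0"
  unfolding level_def using LIMSEQ_inverse_real_of_nat by auto

lemma clamp_level_tendsto: "(\<lambda>n. clamp_level (level n) t) \<longlonglongrightarrow> 0"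
  by (rule Lim_null_comparison[OF _ level_props(2)])
     (use clamp_level_props(2) level_props(1) in \<open>auto simp: less_imp_le\<close>)

text \<open>Soft thresholding: values are moved towards 0 by \<open>level n\<close> and stop there.
  A function that vanishes at infinity gets finite support, and since the threshold map is
  1-Lipschitz no lattice difference increases, unlike for a hard cutoff.\<close>

definition cut :: "(int ^ 'd::finite \<Rightarrow> real) \<Rightarrow> nat \<Rightarrow> int ^ 'd \<Rightarrow> real" where
  "cut u n x = u x - clamp_level (level n) (u x)"

lemma cut_tendsto: "(\<lambda>n. cut u n x) \<longlonglongrightarrow> u x"
  unfolding cut_def using tendsto_diff[OF tendsto_const[of "u x"] clamp_level_tendsto[of "u x"]] by simp

lemma cut_le: "\<bar>cut u n x\<bar> \<le> \<bar>u x\<bar>"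
  using clamp_level_props(4)[of "u x" "level n" 0] clamp_level_props(1)[of "level n" 0] level_props(1)[of n]
  by (simp add: cut_def)

lemma sq_diff_cut_le: "sq_diff (cut u n) i x \<le> sq_diff u i x"
  unfolding sq_diff_def cut_def abs_le_square_iff[symmetric] by (rule clamp_level_props(4))

lemma finite_support_cut:
  assumes "vanishing u" shows "finite {x. cut u n x \<noteq> 0}"
proof (rule finite_subset)
  show "{x. cut u n x \<noteq> 0} \<subseteq> {x. \<bar>u x\<bar> > level n}"
  proof safe
    fix x assume "cut u n x \<noteq> 0"
    thus "\<bar>u x\<bar> > level n" using clamp_level_props(5)[of "u x" "level n"] unfolding cut_def by linarith
  qed
  show "finite {x. \<bar>u x\<bar> > level n}" using assms level_props by (simp add: vanishing_def)
qed

lemma finite_support_ell2: "finite {x. u x \<noteq> 0} \<Longrightarrow> ell2 u"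
  unfolding ell2_def by (intro summable_on_finite_support) auto

lemma energy_tendsto:
  assumes "finite_energy u" "\<And>n i x. sq_diff (v n) i x \<le> sq_diff u i x" "\<And>x. (\<lambda>n. v n x) \<longlonglongrightarrow> w x"
  shows "(\<lambda>n. energy (v n)) \<longlonglongrightarrow> energy w" "\<And>n. finite_energy (v n)"
proof -
  have lim: "(\<lambda>n. sq_diff (v n) i x) \<longlonglongrightarrow> sq_diff w i x" for i x
    unfolding sq_diff_def by (intro tendsto_intros assms)
  have s: "sq_diff u i summable_on UNIV" for i using assms by (simp add: finite_energy_def)
  show "(\<lambda>n. energy (v n)) \<longlonglongrightarrow> energy w"
    unfolding energy_def by (intro tendsto_sum infsum_dominated_convergence(3)[OF lim s]) (use assms in auto)
  show "finite_energy (v n)" for n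
    unfolding finite_energy_def using assms by (intro allI infsum_dominated_convergence(1)[OF lim s]) auto
qed

lemma power_sum_cut_tendsto:
  assumes "(\<lambda>x. \<bar>u x\<bar> powr p) summable_on UNIV" "p > 0"
  shows "(\<lambda>n. power_sum p (cut u n)) \<longlonglongrightarrow> power_sum p u"
  unfolding power_sum_def
proof (rule infsum_dominated_convergence(3)[OF _ assms(1)])
  show "(\<lambda>n. \<bar>cut u n x\<bar> powr p) \<longlonglongrightarrow> \<bar>u x\<bar> powr p" for x
    using assms(2) by (intro tendsto_powr2 tendsto_rabs cut_tendsto tendsto_const) auto
  show "\<bar>\<bar>cut u n x\<bar> powr p\<bar> \<le> \<bar>u x\<bar> powr p" for n x
    using assms(2) cut_le[of u n x] by (simp add: powr_mono2)
qed

lemma energy_cut_tendsto: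
  assumes "finite_energy u" shows "(\<lambda>n. energy (cut u n)) \<longlonglongrightarrow> energy u"
  using assms sq_diff_cut_le cut_tendsto by (rule energy_tendsto)

lemma energy_diff_le:
  assumes "finite_energy u" "finite_energy v"
  shows "finite_energy (\<lambda>x. u x - v x)" "energy (\<lambda>x. u x - v x) \<le> 2 * energy u + 2 * energy v"
proof -
  have le: "sq_diff (\<lambda>x. u x - v x) i x \<le> 2 * sq_diff u i x + 2 * sq_diff v i x" for i x
  proof -
    define a where "a = u (x + unit_vec i) - u x"
    define b where "b = v (x + unit_vec i) - v x"
    have "sq_diff (\<lambda>x. u x - v x) i x = (a - b)\<^sup>2"
      unfolding sq_diff_def a_def b_def by (rule arg_cong[where f = "\<lambda>t. t\<^sup>2"]) simp
    moreover have "(a - b)\<^sup>2 \<le> 2 * a\<^sup>2 + 2 * b\<^sup>2"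
      using zero_le_power2[of "a + b"] by (simp add: power2_eq_square algebra_simps)
    ultimately show ?thesis by (simp add: sq_diff_def a_def b_def)
  qed
  have s: "(\<lambda>x. 2 * sq_diff u i x + 2 * sq_diff v i x) summable_on UNIV" for i
    using assms by (intro summable_on_add summable_on_cmult_right) (auto simp: finite_energy_def)
  show f: "finite_energy (\<lambda>x. u x - v x)"
    unfolding finite_energy_def
  proof
    show "sq_diff (\<lambda>x. u x - v x) i summable_on UNIV" for i
      by (rule summable_on_comparison_real[OF s[of i]]) (simp add: le)
  qed
  have "energy (\<lambda>x. u x - v x) \<le> (\<Sum>i\<in>UNIV. \<Sum>\<^sub>\<infinity>x. 2 * sq_diff u i x + 2 * sq_diff v i x)"
    unfolding energy_def using f by (intro sum_mono infsum_mono s le) (auto simp: finite_energy_def)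
  also have "\<dots> = (\<Sum>i\<in>UNIV. 2 * infsum (sq_diff u i) UNIV + 2 * infsum (sq_diff v i) UNIV)"
    using assms by (intro sum.cong refl, subst infsum_add)
      (auto simp: finite_energy_def infsum_cmult_right' intro!: summable_on_cmult_right)
  also have "\<dots> = 2 * energy u + 2 * energy v" by (simp add: energy_def sum.distrib sum_distrib_left)
  finally show "energy (\<lambda>x. u x - v x) \<le> 2 * energy u + 2 * energy v" .
qed

lemma cut_diff: "cut u m x - cut u n x = clamp_level (level n) (u x) - clamp_level (level m) (u x)"
  by (simp add: cut_def)

lemma energy_clamp_tendsto:
  assumes "finite_energy u"
  shows "(\<lambda>n. energy (\<lambda>x. clamp_level (level n) (u x))) \<longlonglongrightarrow> 0"
    "finite_energy (\<lambda>x. clamp_level (level n) (u x))"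
proof -
  define v where "v = (\<lambda>n x. clamp_level (level n) (u x))"
  have le: "sq_diff (v n) i x \<le> sq_diff u i x" for n i x
    unfolding v_def
    unfolding sq_diff_def abs_le_square_iff[symmetric] by (rule clamp_level_props(3))
  have lim: "(\<lambda>n. v n x) \<longlonglongrightarrow> 0" for x unfolding v_def by (rule clamp_level_tendsto)
  note * = energy_tendsto[where w = "\<lambda>_. 0", OF assms le lim]
  have "sq_diff (\<lambda>_ :: int ^ 'a. 0) = (\<lambda>_ _. 0)" by (simp add: sq_diff_def fun_eq_iff)
  hence "energy (\<lambda>_ :: int ^ 'a. 0) = 0" by (simp add: energy_def)
  thus "(\<lambda>n. energy (\<lambda>x. clamp_level (level n) (u x))) \<longlonglongrightarrow> 0"
    using *(1) by (simp add: v_def)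
  show "finite_energy (\<lambda>x. clamp_level (level n) (u x))"
    using *(2) by (simp add: v_def)
qed

text \<open>The difference of two truncations is the difference of two clamped functions, whose
  energies tend to 0 by dominated convergence. Hence the truncations form a Cauchy sequence.\<close>

lemma D12_latticeI:
  assumes u: "vanishing u" "finite_energy u"
  shows "u \<in> D12_lattice"
  unfolding D12_lattice_def completion_fin_supp_def
proof (intro CollectI exI[of _ "cut u"] conjI allI impI)
  show "finite {x. cut u n x \<noteq> 0}" for n by (rule finite_support_cut[OF u(1)])
  show "(\<lambda>n. cut u n x) \<longlonglongrightarrow> u x" for x by (rule cut_tendsto)
  fix e :: real assume e: "e > 0"
  let ?c = "\<lambda>n x. clamp_level (level n) (u x)"
  have "eventually (\<lambda>n. energy (?c n) < e\<^sup>2 / 4) sequentially"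
    using energy_clamp_tendsto(1)[OF u(2)] e by (intro order_tendstoD) auto
  then obtain M where M: "\<And>n. n \<ge> M \<Longrightarrow> energy (?c n) < e\<^sup>2 / 4" by (auto simp: eventually_sequentially)
  show "\<exists>M. \<forall>m\<ge>M. \<forall>n\<ge>M. grad_norm (\<lambda>x. cut u m x - cut u n x) < e"
  proof (intro exI[of _ M] allI impI)
    fix m n assume mn: "m \<ge> M" "n \<ge> M"
    note * = energy_diff_le[OF energy_clamp_tendsto(2)[OF u(2), of n] energy_clamp_tendsto(2)[OF u(2), of m]]
    have "energy (\<lambda>x. cut u m x - cut u n x) < e\<^sup>2"
      unfolding cut_diff using *(2) M[OF mn(1)] M[OF mn(2)] by linarith
    moreover have "finite_energy (\<lambda>x. cut u m x - cut u n x)" unfolding cut_diff by (rule *(1))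
    ultimately show "grad_norm (\<lambda>x. cut u m x - cut u n x) < e"
      using e by (simp add: grad_norm_eq real_less_lsqrt)
  qed
qed

lemma sq_sum_diff_le:
  assumes "ell2 u" "ell2 v"
  shows "ell2 (\<lambda>x. u x - v x)" "sq_sum (\<lambda>x. u x - v x) \<le> 2 * sq_sum u + 2 * sq_sum v"
proof -
  have le: "(u x - v x)\<^sup>2 \<le> 2 * (u x)\<^sup>2 + 2 * (v x)\<^sup>2" for x
    using zero_le_power2[of "u x + v x"] by (simp add: power2_eq_square algebra_simps)
  have s: "(\<lambda>x. 2 * (u x)\<^sup>2 + 2 * (v x)\<^sup>2) summable_on UNIV"
    using assms by (intro summable_on_add summable_on_cmult_right) (auto simp: ell2_def)
  show f: "ell2 (\<lambda>x. u x - v x)"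
    unfolding ell2_def using summable_on_comparison_real[OF s, of "\<lambda>x. (u x - v x)\<^sup>2"] le by simp
  have "sq_sum (\<lambda>x. u x - v x) \<le> (\<Sum>\<^sub>\<infinity>x. 2 * (u x)\<^sup>2 + 2 * (v x)\<^sup>2)"
    unfolding sq_sum_def using f by (intro infsum_mono s le) (auto simp: ell2_def)
  also have "\<dots> = 2 * sq_sum u + 2 * sq_sum v"
    using assms by (subst infsum_add)
      (auto simp: ell2_def sq_sum_def infsum_cmult_right' intro!: summable_on_cmult_right)
  finally show "sq_sum (\<lambda>x. u x - v x) \<le> 2 * sq_sum u + 2 * sq_sum v" .
qed

lemma ell2_mono:
  assumes "ell2 u" "\<And>x. \<bar>v x\<bar> \<le> \<bar>u x\<bar>"
  shows "ell2 v"
  unfolding ell2_def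
  by (rule summable_on_comparison_real[of "\<lambda>x. (u x)\<^sup>2"]) (use assms in \<open>auto simp: ell2_def abs_le_square_iff\<close>)

lemma H1_latticeI:
  assumes u: "ell2 u"
  shows "u \<in> H1_lattice"
  unfolding H1_lattice_def completion_fin_supp_def
proof (intro CollectI exI[of _ "cut u"] conjI allI impI)
  show "finite {x. cut u n x \<noteq> 0}" for n by (rule finite_support_cut[OF ell2_imp_vanishing[OF u]])
  show "(\<lambda>n. cut u n x) \<longlonglongrightarrow> u x" for x by (rule cut_tendsto)
  fix e :: real assume e: "e > 0"
  let ?c = "\<lambda>n x. clamp_level (level n) (u x)"
  note fe = ell2_imp_finite_energy[OF u]
  have le: "\<bar>?c n x\<bar> \<le> \<bar>u x\<bar>" for n x using clamp_level_props(1) level_props(1)[of n] by simp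
  have l2: "ell2 (?c n)" for n by (rule ell2_mono[OF u le])
  have "(\<lambda>n. sq_sum (?c n)) \<longlonglongrightarrow> sq_sum (\<lambda>_ :: int ^ 'a. 0)"
    unfolding sq_sum_def
  proof (rule infsum_dominated_convergence(3)[where w = "\<lambda>x. (u x)\<^sup>2"])
    show "(\<lambda>n. (?c n x)\<^sup>2) \<longlonglongrightarrow> 0\<^sup>2" for x by (intro tendsto_intros clamp_level_tendsto)
  qed (use u le in \<open>auto simp: ell2_def abs_le_square_iff\<close>)
  hence "eventually (\<lambda>n. sq_sum (?c n) < e\<^sup>2 / 8) sequentially"
    using e by (intro order_tendstoD) (auto simp: sq_sum_def)
  moreover have "eventually (\<lambda>n. energy (?c n) < e\<^sup>2 / 8) sequentially"
    using energy_clamp_tendsto(1)[OF fe] e by (intro order_tendstoD) auto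
  ultimately have "eventually (\<lambda>n. sq_sum (?c n) < e\<^sup>2 / 8 \<and> energy (?c n) < e\<^sup>2 / 8) sequentially"
    by (rule eventually_conj)
  then obtain M where M: "\<And>n. n \<ge> M \<Longrightarrow> sq_sum (?c n) < e\<^sup>2 / 8 \<and> energy (?c n) < e\<^sup>2 / 8"
    by (auto simp: eventually_sequentially)
  show "\<exists>M. \<forall>m\<ge>M. \<forall>n\<ge>M. sqrt ((grad_norm (\<lambda>x. cut u m x - cut u n x))\<^sup>2 + (lq_norm 2 (\<lambda>x. cut u m x - cut u n x))\<^sup>2) < e"
  proof (intro exI[of _ M] allI impI)
    fix m n assume mn: "m \<ge> M" "n \<ge> M"
    note * = energy_diff_le[OF energy_clamp_tendsto(2)[OF fe, of n] energy_clamp_tendsto(2)[OF fe, of m]]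
    note ** = sq_sum_diff_le[OF l2[of n] l2[of m]]
    have "(grad_norm (\<lambda>x. cut u m x - cut u n x))\<^sup>2 + (lq_norm 2 (\<lambda>x. cut u m x - cut u n x))\<^sup>2 < e\<^sup>2"
      unfolding cut_diff lq_norm_2 grad_norm_eq[OF *(1)] using *(2) **(2) M[OF mn(1)] M[OF mn(2)] by simp
    thus "sqrt ((grad_norm (\<lambda>x. cut u m x - cut u n x))\<^sup>2 + (lq_norm 2 (\<lambda>x. cut u m x - cut u n x))\<^sup>2) < e"
      using e by (simp add: real_less_lsqrt)
  qed
qed

text \<open>All late members of the Cauchy sequence are within distance 1 of one of them. This
  bounds finite partial sums, survives the pointwise limit, and leaves the limit at finite distance
  from a finitely supported function.\<close>

lemma H1_latticeD:
  assumes "u \<in> H1_lattice"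
  shows "ell2 u"
proof -
  from assms obtain \<phi> where fin: "\<And>n. finite {x. \<phi> n x \<noteq> 0}"
    and C: "\<And>e. e > 0 \<Longrightarrow> \<exists>M. \<forall>m\<ge>M. \<forall>n\<ge>M. sqrt ((grad_norm (\<lambda>x. \<phi> m x - \<phi> n x))\<^sup>2 + (lq_norm 2 (\<lambda>x. \<phi> m x - \<phi> n x))\<^sup>2) < e"
    and lim: "\<And>x. (\<lambda>n. \<phi> n x) \<longlonglongrightarrow> u x"
    unfolding H1_lattice_def completion_fin_supp_def by blast
  obtain M where M: "\<And>m. m \<ge> M \<Longrightarrow> sqrt ((grad_norm (\<lambda>x. \<phi> m x - \<phi> M x))\<^sup>2 + (lq_norm 2 (\<lambda>x. \<phi> m x - \<phi> M x))\<^sup>2) < 1"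
    using C[of 1] by auto
  have l2: "ell2 (\<phi> n)" for n by (rule finite_support_ell2[OF fin])
  have "sum (\<lambda>x. (u x - \<phi> M x)\<^sup>2) F \<le> 1" if F: "finite F" for F
  proof (rule LIMSEQ_le_const2)
    show "(\<lambda>n. sum (\<lambda>x. (\<phi> n x - \<phi> M x)\<^sup>2) F) \<longlonglongrightarrow> sum (\<lambda>x. (u x - \<phi> M x)\<^sup>2) F"
      by (intro tendsto_intros lim)
    have "sum (\<lambda>x. (\<phi> n x - \<phi> M x)\<^sup>2) F \<le> 1" if "n \<ge> M" for n
    proof -
      have "sum (\<lambda>x. (\<phi> n x - \<phi> M x)\<^sup>2) F \<le> sq_sum (\<lambda>x. \<phi> n x - \<phi> M x)"
        unfolding sq_sum_def using sq_sum_diff_le(1)[OF l2[of n] l2[of M]]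
        by (intro finite_sum_le_infsum F) (auto simp: ell2_def)
      also have "\<dots> \<le> 1" using M[OF that] unfolding lq_norm_2[symmetric]
        by (smt (verit) real_sqrt_less_iff real_sqrt_one zero_le_power2)
      finally show ?thesis .
    qed
    thus "\<exists>N. \<forall>n\<ge>N. sum (\<lambda>x. (\<phi> n x - \<phi> M x)\<^sup>2) F \<le> 1" by blast
  qed
  hence "ell2 (\<lambda>x. u x - \<phi> M x)" unfolding ell2_def by (intro summable_on_bounded_sums) auto
  moreover have "ell2 (\<lambda>x. - \<phi> M x)" by (rule ell2_mono[OF l2[of M]]) auto
  ultimately have "ell2 (\<lambda>x. (u x - \<phi> M x) - (- \<phi> M x))" by (rule sq_sum_diff_le(1))
  thus ?thesis by simp
qed

lemma H1_lattice_eq: "H1_lattice = {u. ell2 u}"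
  using H1_latticeI H1_latticeD by auto

text \<open>Written in squared norms, so both exponents are halved. They add up to q / 2, which
  gives invariance under scalar multiples and, since q > 2, the superadditivity used for
  attainment.\<close>

lemma Q_lattice_subcritical:
  fixes u :: "int ^ 'd::finite \<Rightarrow> real"
  assumes "2 < q" "ereal q < two_star CARD('d)" "ell2 u"
  defines "d \<equiv> real CARD('d)"
  shows "Q_lattice q u = power_sum q u /
    (sq_sum u powr ((d + (2 - d) * (q / 2)) / 2) * energy u powr ((q / 2 - 1) * d / 2))"
  using assms lq_norm_powr[of q u q] lq_norm_powr[of 2 u]
  by (simp add: Q_lattice_def Let_def grad_norm_eq ell2_imp_finite_energy power_sum_2 powr_half_sqrt[symmetric] powr_powr)

lemma Q_lattice_critical:
  fixes u :: "int ^ 'd::finite \<Rightarrow> real"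
  assumes "2 < q" "ereal q = two_star CARD('d)" "finite_energy u"
  shows "Q_lattice q u = power_sum q u / energy u powr (q / 2)"
  using assms lq_norm_powr[of q u q]
  by (simp add: Q_lattice_def Let_def grad_norm_eq powr_half_sqrt[symmetric] powr_powr)

section \<open>Discretization of Sobolev functions\<close>

text \<open>The kernel plays two roles: divided by its mass it is a probability density in
  \<open>z\<close>, which gives Jensen's inequality, and summed over \<open>x\<close> it is at most
  1, which prevents a loss from overlapping supports.\<close>

lemma power_sum_avg_le:
  fixes v :: "real ^ 'd::finite \<Rightarrow> real"
  assumes P: "\<forall>i. unit_kernel (P i)" and h: "h > 0" and p: "p \<ge> 1"
    and v [measurable]: "v \<in> borel_measurable lborel" and I: "integrable lborel (\<lambda>z. \<bar>v z\<bar> powr p)"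
  shows "(\<lambda>x. \<bar>avg P h v x\<bar> powr p) summable_on UNIV"
    and "power_sum p (avg P h v) \<le> (LBINT z. \<bar>v z\<bar> powr p) / h ^ CARD('d)"
proof -
  let ?H = "h ^ CARD('d)"
  have H: "?H > 0" using h by simp
  have J: "\<bar>avg P h v x\<bar> powr p \<le> (LBINT z. ker P h x z / ?H * \<bar>v z\<bar> powr p)" for x
  proof -
    have "\<bar>\<integral>z. ker P h x z / ?H * v z \<partial>lborel\<bar> powr p \<le> (LBINT z. ker P h x z / ?H * \<bar>v z\<bar> powr p)"
    proof (rule integral_weight_powr_le(2)[OF p])
      show "integrable lborel (\<lambda>z. ker P h x z / ?H)" "(LBINT z. ker P h x z / ?H) \<le> 1"
        using integral_ker[OF P h, of x] h by simp_all
      show "integrable lborel (\<lambda>z. ker P h x z / ?H * \<bar>v z\<bar> powr p)"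
        using integrable_ker_mult[OF P I, of h x] by simp
    qed (use ker_nonneg[OF P] H in \<open>auto intro: divide_nonneg_pos\<close>)
    thus ?thesis by (simp add: avg_def)
  qed
  have bd: "(\<Sum>x\<in>F. \<bar>avg P h v x\<bar> powr p) \<le> (LBINT z. \<bar>v z\<bar> powr p) / ?H" if F: "finite F" for F
  proof -
    have "(\<Sum>x\<in>F. \<bar>avg P h v x\<bar> powr p) \<le> (\<Sum>x\<in>F. \<integral>z. ker P h x z / ?H * \<bar>v z\<bar> powr p \<partial>lborel)"
      by (intro sum_mono J)
    also have "\<dots> = (LBINT z. (\<Sum>x\<in>F. ker P h x z / ?H * \<bar>v z\<bar> powr p))"
      using integrable_ker_mult[OF P I, of h] by (intro Bochner_Integration.integral_sum[symmetric]) simp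
    also have "\<dots> \<le> (LBINT z. \<bar>v z\<bar> powr p / ?H)"
    proof (rule integral_mono)
      show "(\<Sum>x\<in>F. ker P h x z / ?H * \<bar>v z\<bar> powr p) \<le> \<bar>v z\<bar> powr p / ?H" for z
        unfolding sum_distrib_right[symmetric] sum_divide_distrib[symmetric]
        using sum_ker_le_1[OF P F, of h z] H mult_right_mono[of "\<Sum>x\<in>F. ker P h x z" 1 "\<bar>v z\<bar> powr p / ?H"] by simp
      show "integrable lborel (\<lambda>z. \<Sum>x\<in>F. ker P h x z / ?H * \<bar>v z\<bar> powr p)"
        using integrable_ker_mult[OF P I, of h] by (intro Bochner_Integration.integrable_sum) simp
    qed (use I in simp)
    finally show ?thesis by simp
  qed
  show "(\<lambda>x. \<bar>avg P h v x\<bar> powr p) summable_on UNIV"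
    by (rule summable_on_bounded_sums(1)[OF _ bd]) auto
  show "power_sum p (avg P h v) \<le> (LBINT z. \<bar>v z\<bar> powr p) / ?H"
    unfolding power_sum_def by (rule summable_on_bounded_sums(2)[OF _ bd]) auto
qed

lemma integrable_ker_mult_local:
  fixes v :: "real ^ 'd::finite \<Rightarrow> real"
  assumes P: "\<forall>i. unit_kernel (P i)" and h: "h > 0" and v: "locally_integrable v"
  shows "integrable lborel (\<lambda>z. ker P h x z * v z)"
proof -
  let ?S = "closure {z. ker P h x z \<noteq> 0}"
  have "compact ?S" using test_function_ker[OF P h] by (simp add: test_function_def)
  hence "integrable lborel (\<lambda>z. indicator ?S z * v z)"
    using v by (simp add: locally_integrable_def set_integrable_def)
  from integrable_ker_mult[OF P this, of h x]
  have "integrable lborel (\<lambda>z. ker P h x z * (indicator ?S z * v z))" .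
  moreover have "ker P h x z * (indicator ?S z * v z) = ker P h x z * v z" for z
    using closure_subset[of "{z. ker P h x z \<noteq> 0}"] by (cases "ker P h x z = 0") (auto simp: indicator_def)
  ultimately show ?thesis by simp
qed

lemma locally_integrable_component:
  fixes g :: "real ^ 'd::finite \<Rightarrow> real ^ 'd"
  assumes "locally_integrable g" shows "locally_integrable (\<lambda>z. g z $ i)"
  unfolding locally_integrable_def set_integrable_def
proof (intro allI impI)
  fix S :: "(real ^ 'd) set" assume "compact S"
  hence "integrable lborel (\<lambda>z. indicator S z *\<^sub>R g z)"
    using assms by (auto simp: locally_integrable_def set_integrable_def)
  from integrable_bounded_linear[OF bounded_linear_vec_nth[of i] this]
  show "integrable lborel (\<lambda>z. indicator S z *\<^sub>R g z $ i)" by simp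
qed

lemma locally_integrable_measurable:
  fixes g :: "real ^ 'd::finite \<Rightarrow> 'b::euclidean_space"
  assumes "locally_integrable g" shows "g \<in> borel_measurable lborel"
proof (rule borel_measurable_LIMSEQ_metric)
  show "(\<lambda>z. indicator (cball 0 (real n)) z *\<^sub>R g z) \<in> borel_measurable lborel" for n
    using assms by (auto simp: locally_integrable_def set_integrable_def dest!: spec[of _ "cball 0 (real n)"])
  fix z :: "real ^ 'd"
  obtain N where N: "norm z < real N" using reals_Archimedean2 by blast
  have "eventually (\<lambda>n. g z = indicator (cball 0 (real n)) z *\<^sub>R g z) sequentially"
    using eventually_ge_at_top[of N] by eventually_elim (use N in \<open>auto simp: indicator_def\<close>)
  thus "(\<lambda>n. indicator (cball 0 (real n)) z *\<^sub>R g z) \<longlonglongrightarrow> g z"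
    by (rule Lim_transform_eventually[OF tendsto_const])
qed

lemma norm_powr_2: "norm (x :: real ^ 'd::finite) powr 2 = (\<Sum>i\<in>UNIV. (x $ i)\<^sup>2)"
proof -
  have "norm x powr 2 = (norm x)\<^sup>2" by (cases "x = 0") auto
  also have "\<dots> = (\<Sum>i\<in>UNIV. (x $ i)\<^sup>2)" by (simp add: norm_vec_def L2_set_def sum_nonneg)
  finally show ?thesis .
qed

lemma in_Lp_2_components:
  fixes g :: "real ^ 'd::finite \<Rightarrow> real ^ 'd"
  assumes "in_Lp 2 g"
  shows "(\<lambda>z. g z $ i) \<in> borel_measurable lborel" "integrable lborel (\<lambda>z. \<bar>g z $ i\<bar> powr 2)"
    "(LBINT z. norm (g z) powr 2) = (\<Sum>i\<in>UNIV. \<integral>z. \<bar>g z $ i\<bar> powr 2 \<partial>lborel)"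
proof -
  have [measurable]: "g \<in> borel_measurable lborel" and I: "integrable lborel (\<lambda>z. norm (g z) powr 2)"
    using assms by (auto simp: in_Lp_def)
  show m: "(\<lambda>z. g z $ i) \<in> borel_measurable lborel" for i by measurable
  show I': "integrable lborel (\<lambda>z. \<bar>g z $ i\<bar> powr 2)" for i
  proof (rule Bochner_Integration.integrable_bound[OF I])
    show "(\<lambda>z. \<bar>g z $ i\<bar> powr 2) \<in> borel_measurable lborel" using m by measurable
    show "AE z in lborel. norm (\<bar>g z $ i\<bar> powr 2) \<le> norm (norm (g z) powr 2)"
    proof (rule AE_I2)
      show "norm (\<bar>g z $ i\<bar> powr 2) \<le> norm (norm (g z) powr 2)" for z
        using powr_mono2[OF _ _ component_le_norm_cart[of "g z" i], of 2] by simp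
    qed
  qed
  show "(LBINT z. norm (g z) powr 2) = (\<Sum>i\<in>UNIV. \<integral>z. \<bar>g z $ i\<bar> powr 2 \<partial>lborel)"
    using I' by (simp add: norm_powr_2 abs_powr_2 Bochner_Integration.integral_sum)
qed

text \<open>Pointwise convergence is available only on balls and along a sequence of meshes. So a
  level \<open>c\<close> below the integral is fixed: a large ball already carries more than
  \<open>c\<close>, and the limit inferior then exceeds \<open>c\<close> for some mesh.\<close>

lemma avg_Fatou:
  fixes v :: "real ^ 'd::finite \<Rightarrow> real"
  assumes P: "\<forall>i. unit_kernel (P i)" and v: "v \<in> borel_measurable lborel" "locally_integrable v"
    and q: "q \<ge> 1" and I: "integrable lborel (\<lambda>z. \<bar>v z\<bar> powr q)"
    and c: "0 \<le> c" "c < (LBINT z. \<bar>v z\<bar> powr q)"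
  obtains h where "h > 0" "c < h ^ CARD('d) * power_sum q (avg P h v)"
proof -
  note [measurable] = v(1)
  let ?f = "\<lambda>z. \<bar>v z\<bar> powr q"
  have "(\<lambda>n. \<integral>z. indicator (ball 0 (real n)) z * ?f z \<partial>lborel) \<longlonglongrightarrow> (LBINT z. ?f z)"
  proof (rule integral_dominated_convergence[OF _ _ I])
    show "AE z in lborel. (\<lambda>n. indicator (ball 0 (real n)) z * ?f z) \<longlonglongrightarrow> ?f z"
    proof (rule AE_I2)
      fix z :: "real ^ 'd"
      obtain N where N: "norm z < real N" using reals_Archimedean2 by blast
      have "eventually (\<lambda>n. ?f z = indicator (ball 0 (real n)) z * ?f z) sequentially"
        using eventually_ge_at_top[of N] by eventually_elim (use N in \<open>auto simp: indicator_def\<close>)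
      thus "(\<lambda>n. indicator (ball 0 (real n)) z * ?f z) \<longlonglongrightarrow> ?f z"
        by (rule Lim_transform_eventually[OF tendsto_const])
    qed
  qed (auto simp: indicator_def)
  hence "eventually (\<lambda>n. c < (LBINT z. indicator (ball 0 (real n)) z * ?f z)) sequentially"
    using c by (intro order_tendstoD) auto
  then obtain N where N: "c < (LBINT z. indicator (ball 0 (real N)) z * ?f z)"
    by (auto simp: eventually_sequentially)
  obtain h where h: "\<And>n. h n > 0" "h \<longlonglongrightarrow> 0"
    and lim: "AE y in lborel. y \<in> ball 0 (real N) \<longrightarrow> (\<lambda>n. avg P (h n) v (vfloor (y /\<^sub>R h n))) \<longlonglongrightarrow> v y"
    using avg_converges_AE[OF P v(2), of "real N"] by blast
  let ?T = "\<lambda>n y. \<bar>avg P (h n) v (vfloor (y /\<^sub>R h n))\<bar> powr q"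
  have "ennreal c < ennreal (LBINT z. indicator (ball 0 (real N)) z * ?f z)"
    using N c by (simp add: ennreal_less_iff)
  also have "\<dots> = (\<integral>\<^sup>+z. ennreal (indicator (ball 0 (real N)) z * ?f z) \<partial>lborel)"
    by (rule nn_integral_eq_integral[symmetric], rule Bochner_Integration.integrable_bound[OF I])
       (auto simp: indicator_def)
  also have "\<dots> \<le> (\<integral>\<^sup>+y. liminf (\<lambda>n. ennreal (?T n y)) \<partial>lborel)"
  proof (rule nn_integral_mono_AE)
    show "AE y in lborel. ennreal (indicator (ball 0 (real N)) y * ?f y) \<le> liminf (\<lambda>n. ennreal (?T n y))"
      using lim
    proof eventually_elim
      case (elim y)
      show ?case
      proof (cases "y \<in> ball 0 (real N)")
        case True
        hence "(\<lambda>n. ?T n y) \<longlonglongrightarrow> ?f y"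
          using elim q by (intro tendsto_powr2 tendsto_rabs tendsto_const) auto
        hence "liminf (\<lambda>n. ennreal (?T n y)) = ennreal (?f y)"
          by (intro lim_imp_Liminf tendsto_ennrealI) auto
        thus ?thesis using True by simp
      qed simp
    qed
  qed
  also have "\<dots> \<le> liminf (\<lambda>n. \<integral>\<^sup>+y. ennreal (?T n y) \<partial>lborel)"
    by (rule nn_integral_liminf) measurable
  finally have "eventually (\<lambda>n. ennreal c < (\<integral>\<^sup>+y. ennreal (?T n y) \<partial>lborel)) sequentially"
    by (rule less_LiminfD)
  then obtain n where n: "ennreal c < (\<integral>\<^sup>+y. ennreal (?T n y) \<partial>lborel)"
    by (auto simp: eventually_sequentially)
  have "(\<integral>\<^sup>+y. ennreal (?T n y) \<partial>lborel) = ennreal (h n ^ CARD('d) * power_sum q (avg P (h n) v))"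
    unfolding power_sum_def
    by (rule integral_vfloor[OF h(1) power_sum_avg_le(1)[OF P h(1) q v(1) I]]) simp
  with n c h(1)[of n] show ?thesis by (intro that[of "h n"]) (auto simp: ennreal_less_iff)
qed

section \<open>Averages and weak gradients\<close>

locale kernel_pair =
  fixes r R :: "real \<Rightarrow> real"
  assumes r: "unit_kernel r" and R: "unit_kernel R"
    and R_deriv: "\<And>t. (R has_real_derivative r t - r (t - 1)) (at t)"
begin

lemma r_all: "\<forall>i. unit_kernel ((\<lambda>_. r) i)" using r by simp

lemma Rr_all: "\<forall>j. unit_kernel (((\<lambda>_. r)(i := R)) j)" using r R by simp

text \<open>The weak gradient is tested with the kernel that has \<open>R\<close> in coordinate
  \<open>i\<close> and \<open>r\<close> elsewhere. Differentiation turns \<open>R\<close> back into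
  a difference of \<open>r\<close>, so the defining identity of the weak gradient is the lattice
  difference of averages, exactly and not up to an error.\<close>

lemma sq_diff_avg:
  fixes v :: "real ^ 'd::finite \<Rightarrow> real"
  assumes g: "has_weak_gradient v g" and h: "h > 0"
  shows "sq_diff (avg (\<lambda>_. r) h v) i x = h\<^sup>2 * \<bar>avg ((\<lambda>_. r)(i := R)) h (\<lambda>z. g z $ i) x\<bar> powr 2"
proof -
  let ?P = "(\<lambda>_. r)(i := R)"
  let ?k = "ker (\<lambda>_. r) h"
  have v: "locally_integrable v" using g by (simp add: has_weak_gradient_def)
  note I = integrable_ker_mult_local[OF r_all h v]
  have pd: "partial_deriv i (ker ?P h x) = (\<lambda>y. (?k x y - ?k (x + unit_vec i) y) / h)"
  proof
    fix y
    have "?P(i := r) = (\<lambda>_. r)" by auto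
    moreover have "(?P i has_real_derivative r t - r (t - 1)) (at t)" for t using R_deriv by simp
    ultimately show "partial_deriv i (ker ?P h x) y = (?k x y - ?k (x + unit_vec i) y) / h"
      using partial_deriv_ker[OF Rr_all r h, of i i x y] by (simp only: unit_vec_def)
  qed
  have "(LBINT z. v z * partial_deriv i (ker ?P h x) z) = - (LBINT z. g z $ i * ker ?P h x z)"
  proof -
    have "test_function (ker ?P h x)" by (rule test_function_ker[OF Rr_all h])
    thus ?thesis using g unfolding has_weak_gradient_def by blast
  qed
  also have "(\<lambda>z. v z * partial_deriv i (ker ?P h x) z) = (\<lambda>z. (?k x z * v z - ?k (x + unit_vec i) z * v z) / h)"
    unfolding pd by (simp add: fun_eq_iff algebra_simps)
  also have "(LBINT z. (?k x z * v z - ?k (x + unit_vec i) z * v z) / h) =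
      ((LBINT z. ?k x z * v z) - (LBINT z. ?k (x + unit_vec i) z * v z)) / h"
    using I by simp
  finally have "(LBINT z. ?k (x + unit_vec i) z * v z) - (LBINT z. ?k x z * v z) =
      h * (LBINT z. ker ?P h x z * g z $ i)"
    using h by (simp add: field_simps mult.commute del: fun_upd_apply)
  hence "avg (\<lambda>_. r) h v (x + unit_vec i) - avg (\<lambda>_. r) h v x = h * avg ?P h (\<lambda>z. g z $ i) x"
    by (simp add: avg_def diff_divide_distrib[symmetric])
  thus ?thesis by (simp add: sq_diff_def power_mult_distrib abs_powr_2)
qed

lemma energy_avg_le:
  fixes v :: "real ^ 'd::finite \<Rightarrow> real"
  assumes g: "has_weak_gradient v g" "in_Lp 2 g" and h: "h > 0"
  shows "finite_energy (avg (\<lambda>_. r) h v)"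
    and "energy (avg (\<lambda>_. r) h v) \<le> h\<^sup>2 * (LBINT z. norm (g z) powr 2) / h ^ CARD('d)"
proof -
  note * = power_sum_avg_le[OF Rr_all h _ in_Lp_2_components(1,2)[OF g(2)]]
  show "finite_energy (avg (\<lambda>_. r) h v)"
    unfolding finite_energy_def sq_diff_avg[OF g(1) h] by (intro allI summable_on_cmult_right *(1)) simp
  have "sq_diff (avg (\<lambda>_. r) h v) i = (\<lambda>x. h\<^sup>2 * \<bar>avg ((\<lambda>_. r)(i := R)) h (\<lambda>z. g z $ i) x\<bar> powr 2)" for i
    using sq_diff_avg[OF g(1) h] by (simp add: fun_eq_iff)
  hence "energy (avg (\<lambda>_. r) h v) = (\<Sum>i\<in>UNIV. h\<^sup>2 * power_sum 2 (avg ((\<lambda>_. r)(i := R)) h (\<lambda>z. g z $ i)))"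
    by (simp add: energy_def infsum_cmult_right' power_sum_def)
  also have "\<dots> \<le> (\<Sum>i\<in>UNIV. h\<^sup>2 * ((LBINT z. \<bar>g z $ i\<bar> powr 2) / h ^ CARD('d)))"
    using h by (intro sum_mono mult_left_mono *(2)) auto
  also have "\<dots> = h\<^sup>2 * (LBINT z. norm (g z) powr 2) / h ^ CARD('d)"
    unfolding in_Lp_2_components(3)[OF g(2)] by (simp add: sum_distrib_left sum_divide_distrib)
  finally show "energy (avg (\<lambda>_. r) h v) \<le> h\<^sup>2 * (LBINT z. norm (g z) powr 2) / h ^ CARD('d)" .
qed

text \<open>The fundamental lemma of the calculus of variations in terms of averages: on every ball
  these converge to the function almost everywhere along some meshes.\<close>

lemma avg_zero_imp_AE_zero:
  fixes v :: "real ^ 'd::finite \<Rightarrow> real"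
  assumes v: "locally_integrable v" and z: "\<And>h x. h > 0 \<Longrightarrow> avg (\<lambda>_. r) h v x = 0"
  shows "AE y in lborel. v y = 0"
proof -
  have "AE y in lborel. y \<in> ball 0 (real N) \<longrightarrow> v y = 0" for N
  proof -
    obtain h where h: "\<And>n. h n > 0"
      "AE y in lborel. y \<in> ball 0 (real N) \<longrightarrow> (\<lambda>n. avg (\<lambda>_. r) (h n) v (vfloor (y /\<^sub>R h n))) \<longlonglongrightarrow> v y"
      using avg_converges_AE[OF r_all v, of "real N"] by blast
    from h(2) show ?thesis
      by eventually_elim (auto simp: z[OF h(1)] dest: LIMSEQ_unique[OF tendsto_const])
  qed
  hence "AE y in lborel. \<forall>N. y \<in> ball 0 (real N) \<longrightarrow> v y = 0" by (subst AE_all_countable) blast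
  thus ?thesis
  proof eventually_elim
    case (elim y)
    obtain N where "norm y < real N" using reals_Archimedean2 by blast
    thus ?case using elim by auto
  qed
qed

lemma weak_gradient_unique:
  fixes v :: "real ^ 'd::finite \<Rightarrow> real"
  assumes g: "has_weak_gradient v g" and g': "has_weak_gradient v g'"
  shows "AE z in lborel. g z = g' z"
proof -
  have "AE z in lborel. g z $ i = g' z $ i" for i
  proof -
    let ?f = "\<lambda>z. g z $ i - g' z $ i"
    have lg: "locally_integrable (\<lambda>z. g z $ i)" "locally_integrable (\<lambda>z. g' z $ i)"
      using g g' by (auto simp: has_weak_gradient_def intro: locally_integrable_component)
    have lf: "locally_integrable ?f"
      using lg by (auto simp: locally_integrable_def set_integrable_def right_diff_distrib intro: Bochner_Integration.integrable_diff)
    have z: "avg (\<lambda>_. r) h ?f x = 0" if h: "h > 0" for h x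
    proof -
      have "(LBINT z. g z $ i * ker (\<lambda>_. r) h x z) = (LBINT z. g' z $ i * ker (\<lambda>_. r) h x z)"
        using g g' test_function_ker[OF r_all h, of x] by (simp add: has_weak_gradient_def)
      thus ?thesis
        using integrable_ker_mult_local[OF r_all h lg(1), of x] integrable_ker_mult_local[OF r_all h lg(2), of x]
        by (simp add: avg_def right_diff_distrib mult.commute)
    qed
    from avg_zero_imp_AE_zero[OF lf z] show ?thesis by simp
  qed
  hence "AE z in lborel. \<forall>i\<in>UNIV. g z $ i = g' z $ i" by (intro AE_finite_allI) auto
  thus ?thesis by eventually_elim (auto simp: vec_eq_iff)
qed

text \<open>\<open>weak_gradient\<close> is an arbitrary choice; by uniqueness almost everywhere,
  norms may be computed with any explicit weak gradient, such as that of an interpolant.\<close>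

lemma weak_gradient_in_L2:
  fixes v :: "real ^ 'd::finite \<Rightarrow> real"
  assumes g: "has_weak_gradient v g" "in_Lp 2 g"
  shows "in_Lp 2 (weak_gradient v)" "Lp_norm 2 (weak_gradient v) = Lp_norm 2 g"
proof -
  have w: "has_weak_gradient v (weak_gradient v)" unfolding weak_gradient_def using g(1) by (rule someI[of "has_weak_gradient v"])
  hence m [measurable]: "weak_gradient v \<in> borel_measurable lborel"
    unfolding has_weak_gradient_def using locally_integrable_measurable by blast
  have [measurable]: "g \<in> borel_measurable lborel" using g(2) by (simp add: in_Lp_def)
  have "AE z in lborel. weak_gradient v z = g z" by (rule weak_gradient_unique[OF w g(1)])
  hence ae: "AE z in lborel. norm (weak_gradient v z) powr 2 = norm (g z) powr 2" by eventually_elim simp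
  show "Lp_norm 2 (weak_gradient v) = Lp_norm 2 g"
    unfolding Lp_norm_def using ae by (subst integral_cong_AE[of _ lborel "\<lambda>z. norm (g z) powr 2"]) auto
  have "integrable lborel (\<lambda>z. norm (weak_gradient v z) powr 2)"
    using g(2) ae by (subst integrable_cong_AE[of _ lborel "\<lambda>z. norm (g z) powr 2"]) (auto simp: in_Lp_def)
  thus "in_Lp 2 (weak_gradient v)" using m by (simp add: in_Lp_def)
qed

end

text \<open>This exponent of the l2 norm is positive below the critical exponent and vanishes at it.
  All later uses of subcriticality go through this sign.\<close>

lemma subcritical_exponent_pos:
  assumes "2 < q" "ereal q < two_star d" "d \<ge> 1"
  shows "real d + (2 - real d) * (q / 2) > 0"
proof (cases "d \<le> 2")
  case True
  hence "(2 - real d) * (q / 2) \<ge> 0" using assms by simp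
  thus ?thesis using assms by linarith
next
  case False
  hence "q < 2 * real d / (real d - 2)" using assms by (simp add: two_star_def)
  thus ?thesis using False by (simp add: field_simps)
qed

section \<open>Comparison of the two suprema\<close>

lemma K_lattice_upper:
  fixes u :: "int ^ 'd::finite \<Rightarrow> real"
  assumes "u \<noteq> (\<lambda>_. 0)" "if ereal q < two_star CARD('d) then ell2 u else vanishing u \<and> finite_energy u"
  shows "ereal (Q_lattice q u) \<le> K_lattice TYPE('d) q"
  unfolding K_lattice_def using assms H1_latticeI[of u] D12_latticeI[of u]
  by (intro SUP_upper) (auto split: if_splits)

lemma Q_lattice_nonneg: "Q_lattice q u \<ge> 0"
  by (auto simp: Q_lattice_def Let_def)

lemma K_lattice_nonneg: "K_lattice TYPE('d::finite) q \<ge> 0"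
proof -
  let ?u = "indicator {0} :: int ^ 'd \<Rightarrow> real"
  have l: "ell2 ?u" by (rule finite_support_ell2) (auto simp: indicator_def)
  have "?u \<noteq> (\<lambda>_. 0)" by (auto simp: fun_eq_iff indicator_def)
  hence "ereal (Q_lattice q ?u) \<le> K_lattice TYPE('d) q"
    using l ell2_imp_vanishing[OF l] ell2_imp_finite_energy[OF l] by (intro K_lattice_upper) auto
  thus ?thesis using Q_lattice_nonneg[of q ?u] by (auto intro: order_trans[rotated])
qed

lemma Lp_norm_powr:
  assumes "p > 0"
  shows "Lp_norm p f powr a = (LBINT x. norm (f x) powr p) powr (a / p)"
  using assms by (simp add: Lp_norm_def powr_powr)

lemma Q_euclid_subcritical:
  fixes v :: "real ^ 'd::finite \<Rightarrow> real"
  assumes "2 < q" "ereal q < two_star CARD('d)"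
  defines "d \<equiv> real CARD('d)"
  shows "Q_euclid q v = (LBINT x. \<bar>v x\<bar> powr q) /
    ((LBINT x. \<bar>v x\<bar> powr 2) powr ((d + (2 - d) * (q / 2)) / 2) *
     (LBINT x. norm (weak_gradient v x) powr 2) powr ((q / 2 - 1) * d / 2))"
  using assms by (simp add: Q_euclid_def Let_def Lp_norm_powr)

lemma Q_euclid_critical:
  fixes v :: "real ^ 'd::finite \<Rightarrow> real"
  assumes "2 < q" "ereal q = two_star CARD('d)"
  shows "Q_euclid q v = (LBINT x. \<bar>v x\<bar> powr q) /
     (LBINT x. norm (weak_gradient v x) powr 2) powr (q / 2)"
  using assms by (simp add: Q_euclid_def Let_def Lp_norm_powr)

text \<open>The exponents of the Gagliardo--Nirenberg quotient are exactly those for which it does not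
  depend on the mesh size \<open>h\<close>.\<close>

lemma mesh_scaling:
  fixes A G h a b :: real
  assumes h: "h > 0" and A: "A \<ge> 0" and G: "G \<ge> 0" and ab: "(2 - real n) * b - real n * a = - real n"
  shows "(A / h ^ n) powr a * (h\<^sup>2 * G / h ^ n) powr b = A powr a * G powr b / h ^ n"
proof -
  have hn: "h ^ n = h powr n" using h by (simp add: powr_realpow)
  have h2: "h\<^sup>2 powr b = h powr (2 * b)" using powr_powr[of h 2 b] h by simp
  have "(A / h ^ n) powr a * (h\<^sup>2 * G / h ^ n) powr b =
      A powr a * G powr b * (h powr (2 * b) / (h powr (n * a) * h powr (n * b)))"
    using A G h unfolding hn by (simp add: powr_divide powr_mult powr_powr h2 mult_ac)
  also have "h powr (2 * b) / (h powr (n * a) * h powr (n * b)) = h powr (2 * b - (n * a + n * b))"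
    by (simp add: powr_diff powr_add)
  also have "2 * b - (n * a + n * b) = - real n" using ab by (simp add: algebra_simps)
  finally show ?thesis using h hn by (simp add: powr_minus divide_inverse)
qed

lemma real_le_by_approx:
  assumes "S > 0" "D > (0 :: real)" "\<And>c. 0 \<le> c \<Longrightarrow> c < S \<Longrightarrow> ereal (c / D) \<le> K"
  shows "ereal (S / D) \<le> K"
proof (rule LIMSEQ_le_const2)
  have "(\<lambda>n. S * (1 - inverse (real (Suc n))) / D) \<longlonglongrightarrow> S * (1 - 0) / D"
    by (intro tendsto_intros LIMSEQ_inverse_real_of_nat) (use assms in auto)
  thus "(\<lambda>n. ereal (S * (1 - inverse (real (Suc n))) / D)) \<longlonglongrightarrow> ereal (S / D)" by simp
  show "\<exists>N. \<forall>n\<ge>N. ereal (S * (1 - inverse (real (Suc n))) / D) \<le> K"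
    using assms(1) by (intro exI[of _ 0] allI impI assms(3)) (auto simp: field_simps)
qed

context kernel_pair begin

text \<open>The mass estimate is conditional on square integrability, so that one statement serves
  both \<open>H1_euclid\<close> and \<open>D12_euclid\<close>; vanishing at infinity always comes
  from the q-th powers. Nonzero averages are forced by the strict inequality above c.\<close>

lemma discretization:
  fixes v :: "real ^ 'd::finite \<Rightarrow> real"
  assumes q: "q > 2" and v: "v \<in> borel_measurable lborel" "integrable lborel (\<lambda>z. \<bar>v z\<bar> powr q)"
    and g: "has_weak_gradient v g" "in_Lp 2 g"
    and c: "0 \<le> c" "c < (LBINT z. \<bar>v z\<bar> powr q)"
  obtains h u where "h > 0" "u \<noteq> (\<lambda>_ :: int ^ 'd. 0)" "vanishing u" "finite_energy u" "c < h ^ CARD('d) * power_sum q u"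
    "energy u > 0" "energy u \<le> h\<^sup>2 * (LBINT z. norm (g z) powr 2) / h ^ CARD('d)"
    "integrable lborel (\<lambda>z. \<bar>v z\<bar> powr 2) \<Longrightarrow> ell2 u \<and> sq_sum u > 0 \<and> sq_sum u \<le> (LBINT z. \<bar>v z\<bar> powr 2) / h ^ CARD('d)"
proof -
  have lv: "locally_integrable v" using g by (simp add: has_weak_gradient_def)
  obtain h where h: "h > 0" "c < h ^ CARD('d) * power_sum q (avg (\<lambda>_. r) h v)"
    using avg_Fatou[OF r_all v(1) lv _ v(2) c] q by auto
  define u where "u = avg (\<lambda>_. r) h v"
  have s: "(\<lambda>x. \<bar>u x\<bar> powr q) summable_on UNIV"
    unfolding u_def using q by (intro power_sum_avg_le r_all h v) auto
  have van: "vanishing u" by (rule power_summable_imp_vanishing[OF _ s]) (use q in auto)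
  note E = energy_avg_le[OF g h(1), folded u_def]
  have nz: "u \<noteq> (\<lambda>_. 0)"
  proof
    assume "u = (\<lambda>_. 0)"
    thus False using h c q by (simp add: u_def[symmetric] power_sum_def)
  qed
  have "energy u > 0" using energy_zero_imp_zero[OF van E(1)] nz energy_nonneg[of u] by linarith
  moreover have "ell2 u \<and> sq_sum u > 0 \<and> sq_sum u \<le> (LBINT z. \<bar>v z\<bar> powr 2) / h ^ CARD('d)"
    if I: "integrable lborel (\<lambda>z. \<bar>v z\<bar> powr 2)"
  proof -
    note * = power_sum_avg_le[OF r_all h(1) _ v(1) I, folded u_def]
    have l: "ell2 u" unfolding ell2_iff by (rule *(1)) simp
    show ?thesis using l *(2) ell2_nonzero_pos(1)[OF l nz] by (simp add: power_sum_2)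
  qed
  ultimately show ?thesis using that[of h u] h E nz van by (simp add: u_def)
qed

lemma Q_euclid_le_K_lattice_subcritical:
  fixes v :: "real ^ 'd::finite \<Rightarrow> real"
  assumes q: "2 < q" "ereal q < two_star CARD('d)" and v: "v \<in> H1_euclid"
  shows "ereal (Q_euclid q v) \<le> K_lattice TYPE('d) q"
proof (cases "Q_euclid q v > 0")
  \<comment> \<open>This covers vanishing denominators as well, since division by zero makes the
    quotient 0.\<close>
  case False
  hence "ereal (Q_euclid q v) \<le> 0" by simp
  thus ?thesis using K_lattice_nonneg[where 'd = 'd, of q] by (rule order_trans)
next
  case True
  let ?d = "real CARD('d)" and ?g = "weak_gradient v"
  define a where "a = (?d + (2 - ?d) * (q / 2)) / 2"
  define b where "b = (q / 2 - 1) * ?d / 2"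
  define A where "A = (LBINT x. \<bar>v x\<bar> powr 2)"
  define G where "G = (LBINT x. norm (?g x) powr 2)"
  define S where "S = (LBINT x. \<bar>v x\<bar> powr q)"
  have Q: "Q_euclid q v = S / (A powr a * G powr b)"
    unfolding Q_euclid_subcritical[OF q] A_def G_def S_def a_def b_def ..
  have a: "a > 0" using subcritical_exponent_pos[OF q] by (simp add: a_def)
  have b: "b > 0" using q by (simp add: b_def)
  have ab: "(2 - ?d) * b - ?d * a = - ?d" by (simp add: a_def b_def field_simps)
  have nn: "A \<ge> 0" "G \<ge> 0" "S \<ge> 0" by (auto simp: A_def G_def S_def)
  have pos: "S > 0" "A powr a * G powr b > 0"
    using True nn unfolding Q by (auto simp: zero_less_divide_iff)
  \<comment> \<open>A function that is not integrable has integral 0 by convention, so a positive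
    \<open>S\<close> yields membership in the q-th Lebesgue space without an embedding
    theorem.\<close>
  have I: "integrable lborel (\<lambda>z. \<bar>v z\<bar> powr q)"
    using pos(1) not_integrable_integral_eq unfolding S_def by fastforce
  have g: "has_weak_gradient v ?g"
    using v unfolding H1_euclid_def weak_gradient_def by (blast intro: someI[of "has_weak_gradient v"])
  have gL: "in_Lp 2 ?g" and vL: "in_Lp 2 v" using v by (auto simp: H1_euclid_def)
  hence vm: "v \<in> borel_measurable lborel" and I2: "integrable lborel (\<lambda>z. \<bar>v z\<bar> powr 2)"
    by (auto simp: in_Lp_def)
  show ?thesis unfolding Q
  proof (rule real_le_by_approx[OF pos])
    fix c assume c: "0 \<le> c" "c < S"
    obtain h and u :: "int ^ 'd \<Rightarrow> real" where h: "h > 0" and u: "u \<noteq> (\<lambda>_. 0)"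
      "c < h ^ CARD('d) * power_sum q u" "energy u > 0" "energy u \<le> h\<^sup>2 * G / h ^ CARD('d)"
      and "ell2 u \<and> sq_sum u > 0 \<and> sq_sum u \<le> A / h ^ CARD('d)"
      by (rule discretization[OF q(1) vm I g gL c[unfolded S_def], folded A_def G_def]) (use I2 in blast)
    hence l: "ell2 u" "sq_sum u > 0" "sq_sum u \<le> A / h ^ CARD('d)" by auto
    have "c / (A powr a * G powr b) \<le> (h ^ CARD('d) * power_sum q u) / (A powr a * G powr b)"
      using u pos by (intro divide_right_mono) auto
    also have "\<dots> = power_sum q u / ((A / h ^ CARD('d)) powr a * (h\<^sup>2 * G / h ^ CARD('d)) powr b)"
      by (subst mesh_scaling[OF h nn(1,2) ab]) (simp add: mult.commute)
    \<comment> \<open>Both exponents are positive, so the contraction of the two norms can only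
      shrink the denominator; it stays positive because \<open>u\<close> is nonzero.\<close>
    also have "\<dots> \<le> power_sum q u / (sq_sum u powr a * energy u powr b)"
      using u l a b pos by (intro divide_left_mono mult_mono powr_mono2 mult_pos_pos) auto
    also have "\<dots> = Q_lattice q u" unfolding Q_lattice_subcritical[OF q l(1)] a_def b_def ..
    finally have "c / (A powr a * G powr b) \<le> Q_lattice q u" .
    thus "ereal (c / (A powr a * G powr b)) \<le> K_lattice TYPE('d) q"
      using K_lattice_upper[of u q] u(1) l(1) q(2) by (auto intro: order_trans[rotated])
  qed
qed

lemma Q_euclid_le_K_lattice_critical:
  fixes v :: "real ^ 'd::finite \<Rightarrow> real"
  assumes d: "CARD('d) \<ge> 3" and q: "ereal q = two_star CARD('d)" and v: "v \<in> D12_euclid"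
  shows "ereal (Q_euclid q v) \<le> K_lattice TYPE('d) q"
proof (cases "Q_euclid q v > 0")
  case False
  hence "ereal (Q_euclid q v) \<le> 0" by simp
  thus ?thesis using K_lattice_nonneg[where 'd = 'd, of q] by (rule order_trans)
next
  case True
  let ?d = "real CARD('d)" and ?g = "weak_gradient v"
  have d3: "?d \<ge> 3" using d by simp
  have qd: "q = 2 * ?d / (?d - 2)" using q d by (simp add: two_star_def)
  have q2: "q > 2" unfolding qd using d3 by (simp add: less_divide_eq)
  define b where "b = q / 2"
  define G where "G = (LBINT x. norm (?g x) powr 2)"
  define S where "S = (LBINT x. \<bar>v x\<bar> powr q)"
  have Q: "Q_euclid q v = S / G powr b"
    unfolding Q_euclid_critical[OF q2 q] G_def S_def b_def ..
  have b: "b > 0" using q2 by (simp add: b_def)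
  \<comment> \<open>The scaling relation with exponent 0 for the mass, which is absent from the
    critical quotient. Accordingly \<open>mesh_scaling\<close> is used below with the dummy mass A =
    1.\<close>
  have ab: "(2 - ?d) * b - ?d * 0 = - ?d" using d3 by (simp add: b_def qd field_simps)
  have nn: "G \<ge> 0" "S \<ge> 0" by (auto simp: G_def S_def)
  have pos: "S > 0" "G powr b > 0"
    using True nn unfolding Q by (auto simp: zero_less_divide_iff)
  have g: "has_weak_gradient v ?g"
    using v unfolding D12_euclid_def weak_gradient_def by (blast intro: someI[of "has_weak_gradient v"])
  have gL: "in_Lp 2 ?g" and vL: "in_Lp q v" using v q[symmetric] by (auto simp: D12_euclid_def)
  hence vm: "v \<in> borel_measurable lborel" and I: "integrable lborel (\<lambda>z. \<bar>v z\<bar> powr q)"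
    by (auto simp: in_Lp_def)
  show ?thesis unfolding Q
  proof (rule real_le_by_approx[OF pos])
    fix c assume c: "0 \<le> c" "c < S"
    obtain h and u :: "int ^ 'd \<Rightarrow> real" where h: "h > 0" and u: "u \<noteq> (\<lambda>_. 0)" "vanishing u" "finite_energy u"
      "c < h ^ CARD('d) * power_sum q u" "energy u > 0" "energy u \<le> h\<^sup>2 * G / h ^ CARD('d)"
      by (rule discretization[OF q2 vm I g gL c[unfolded S_def], folded G_def])
    have "c / G powr b \<le> (h ^ CARD('d) * power_sum q u) / G powr b"
      using u pos by (intro divide_right_mono) auto
    also have "\<dots> = power_sum q u / (h\<^sup>2 * G / h ^ CARD('d)) powr b"
      using mesh_scaling[OF h zero_le_one nn(1) ab] h by (simp add: mult.commute)
    also have "\<dots> \<le> power_sum q u / energy u powr b"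
      using u b h pos by (intro divide_left_mono powr_mono2 mult_pos_pos) auto
    also have "\<dots> = Q_lattice q u" unfolding Q_lattice_critical[OF q2 q u(3)] b_def ..
    finally have "c / G powr b \<le> Q_lattice q u" .
    thus "ereal (c / G powr b) \<le> K_lattice TYPE('d) q"
      using K_lattice_upper[of u q] u(1-3) q by (auto intro: order_trans[rotated])
  qed
qed

lemma K_euclid_le_K_lattice:
  assumes "(2 < q \<and> ereal q < two_star CARD('d::finite)) \<or> (CARD('d) \<ge> 3 \<and> ereal q = two_star CARD('d))"
  shows "K_euclid TYPE('d) q \<le> K_lattice TYPE('d) q"
  unfolding K_euclid_def
  using assms Q_euclid_le_K_lattice_subcritical[where 'd = 'd, of q] Q_euclid_le_K_lattice_critical[where 'd = 'd, of q]
  by (intro SUP_least) (auto split: if_splits)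

end

section \<open>Smooth interpolation of lattice functions\<close>

lemma integrable_bounded_support:
  fixes f :: "real ^ 'd::finite \<Rightarrow> real"
  assumes "continuous_on UNIV f" "\<And>x. norm x > \<rho> \<Longrightarrow> f x = 0"
  shows "integrable lborel f"
proof -
  have "integrable lborel (\<lambda>x. indicator (cball 0 \<rho>) x *\<^sub>R f x)"
    by (rule borel_integrable_compact) (auto intro: continuous_on_subset[OF assms(1)])
  moreover have "(\<lambda>x. indicator (cball 0 \<rho>) x *\<^sub>R f x) = f"
  proof
    fix x show "indicator (cball 0 \<rho>) x *\<^sub>R f x = f x"
      using assms(2)[of x] by (cases "norm x > \<rho>") (auto simp: indicator_def)
  qed
  ultimately show ?thesis by (simp only:)
qed

section \<open>Integration by parts with compact support\<close>

lemma partial_deriv_along_line: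
  fixes G :: "real ^ 'd::finite \<Rightarrow> real"
  assumes "\<And>x. G differentiable at x"
  shows "((\<lambda>s. G (y + s *\<^sub>R axis i 1)) has_real_derivative partial_deriv i G (y + s *\<^sub>R axis i 1)) (at s)"
proof -
  let ?z = "y + s *\<^sub>R axis i 1"
  have G: "(G has_derivative frechet_derivative G (at ?z)) (at ?z)"
    using assms frechet_derivative_works by blast
  have "((\<lambda>s. y + s *\<^sub>R axis i 1) has_derivative (\<lambda>h. h *\<^sub>R axis i 1)) (at s)"
    by (auto intro!: derivative_eq_intros)
  from has_derivative_compose[OF this G]
  have "((\<lambda>s. G (y + s *\<^sub>R axis i 1)) has_derivative (\<lambda>h. frechet_derivative G (at ?z) (h *\<^sub>R axis i 1))) (at s)" .
  moreover have "frechet_derivative G (at ?z) (h *\<^sub>R axis i 1) = partial_deriv i G ?z * h" for h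
    using linear_scale[OF has_derivative_linear[OF G]] by (simp add: partial_deriv_def mult.commute)
  ultimately show ?thesis by (simp add: has_field_derivative_def)
qed

text \<open>Difference quotients have integral zero by translation invariance.\<close>

lemma integral_partial_deriv_eq_0:
  fixes G :: "real ^ 'd::finite \<Rightarrow> real"
  assumes diff: "\<And>x. G differentiable at x" and cont: "continuous_on UNIV (partial_deriv i G)"
    and supp: "\<And>x. norm x > \<rho> \<Longrightarrow> G x = 0"
  shows "(LBINT y. partial_deriv i G y) = 0"
proof -
  let ?e = "axis i 1 :: real ^ 'd"
  have contG: "continuous_on UNIV G"
    using diff by (auto intro!: continuous_at_imp_continuous_on differentiable_imp_continuous_within)
  have iG: "integrable lborel G" by (rule integrable_bounded_support[OF contG supp])
  have iG': "integrable lborel (\<lambda>y. G (y + c))" and shift: "(LBINT y. G (y + c)) = (LBINT y. G y)" for c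
  proof -
    have d: "distr lborel borel (\<lambda>y. y + c) = (lborel :: (real ^ 'd) measure)"
    proof -
      have "(\<lambda>y. y + c) = (+) c" by (simp add: fun_eq_iff add.commute)
      thus ?thesis using lborel_distr_plus[of c] by (simp only:)
    qed
    have [measurable]: "G \<in> borel_measurable borel" using contG by (rule borel_measurable_continuous_onI)
    show "integrable lborel (\<lambda>y. G (y + c))"
      using iG by (subst (asm) d[symmetric], subst (asm) integrable_distr_eq) auto
    show "(LBINT y. G (y + c)) = (LBINT y. G y)"
      by (subst (2) d[symmetric], subst integral_distr) auto
  qed
  define D where "D n y = (G (y + level n *\<^sub>R ?e) - G y) / level n" for n y
  have lev: "0 < level n" "level n \<le> 1" for n by (auto simp: level_def field_simps)
  \<comment> \<open>Steps have length at most 1. The difference quotients therefore vanish when the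
    norm of y exceeds \<open>\<rho> + 1\<close>, and otherwise the mean value point lies within
    radius \<open>\<rho> + 2\<close>.\<close>
  have "bounded (partial_deriv i G ` cball 0 (\<rho> + 2))"
    by (intro compact_imp_bounded compact_continuous_image continuous_on_subset[OF cont]) auto
  then obtain M where M: "\<And>y. y \<in> cball 0 (\<rho> + 2) \<Longrightarrow> \<bar>partial_deriv i G y\<bar> \<le> M"
    unfolding bounded_iff by (metis imageI real_norm_def)
  define w where "w = (\<lambda>y :: real ^ 'd. M * indicator (cball 0 (\<rho> + 1)) y)"
  have Dw: "\<bar>D n y\<bar> \<le> w y" for n y
  proof (cases "y \<in> cball 0 (\<rho> + 1)")
    case True
    obtain s where s: "0 < s" "s < level n"
      "G (y + level n *\<^sub>R ?e) - G (y + 0 *\<^sub>R ?e) = (level n - 0) * partial_deriv i G (y + s *\<^sub>R ?e)"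
      using MVT2[OF lev(1)[of n], of "\<lambda>s. G (y + s *\<^sub>R ?e)" "\<lambda>s. partial_deriv i G (y + s *\<^sub>R ?e)"]
        partial_deriv_along_line[OF diff] by blast
    have "D n y = partial_deriv i G (y + s *\<^sub>R ?e)" using s(3) lev(1)[of n] by (simp add: D_def)
    moreover have "norm (y + s *\<^sub>R ?e) \<le> \<rho> + 2"
      using norm_triangle_ineq[of y "s *\<^sub>R ?e"] True s lev(2)[of n] by simp
    ultimately show ?thesis using M[of "y + s *\<^sub>R ?e"] True by (simp add: w_def)
  next
    case False
    hence y: "norm y > \<rho> + 1" by simp
    hence "norm (y + level n *\<^sub>R ?e) > \<rho>"
      using norm_triangle_ineq4[of "y + level n *\<^sub>R ?e" "level n *\<^sub>R ?e"] lev[of n] by simp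
    thus ?thesis using False y by (simp add: D_def w_def supp)
  qed
  have "(\<lambda>n. \<integral>y. D n y \<partial>lborel) \<longlonglongrightarrow> (LBINT y. partial_deriv i G y)"
  proof (rule integral_dominated_convergence[where w = w])
    show "integrable lborel w"
      unfolding w_def by (simp add: integrable_indicator_iff emeasure_bounded_finite[OF bounded_cball, unfolded infinity_ennreal_def])
    show "partial_deriv i G \<in> borel_measurable lborel"
      using borel_measurable_continuous_onI[OF cont] by simp
    show "D n \<in> borel_measurable lborel" for n
      unfolding D_def using iG iG' by (intro borel_measurable_integrable Bochner_Integration.integrable_divide Bochner_Integration.integrable_diff)
    show "AE y in lborel. (\<lambda>n. D n y) \<longlonglongrightarrow> partial_deriv i G y"
    proof (rule AE_I2)
      fix y
      have "((\<lambda>h. (G (y + h *\<^sub>R ?e) - G y) / h) \<longlongrightarrow> partial_deriv i G y) (at 0)"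
        using partial_deriv_along_line[OF diff, where s = 0 and y = y and i = i] by (simp add: DERIV_def)
      moreover have "filterlim level (at 0) sequentially"
        using level_props by (simp add: filterlim_at less_imp_neq[symmetric])
      ultimately show "(\<lambda>n. D n y) \<longlonglongrightarrow> partial_deriv i G y"
        unfolding D_def by (rule filterlim_compose)
    qed
    show "AE y in lborel. norm (D n y) \<le> w y" for n using Dw by simp
  qed
  moreover have "(LBINT y. D n y) = 0" for n
    unfolding D_def using iG iG' shift by simp
  ultimately show ?thesis by (simp add: LIMSEQ_const_iff)
qed

lemma partial_deriv_outside_support:
  fixes f :: "real ^ 'd::finite \<Rightarrow> real"
  assumes "\<And>x. norm x > \<rho> \<Longrightarrow> f x = 0" "norm x > \<rho>"
  shows "partial_deriv i f x = 0"
proof -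
  have "((\<lambda>_. 0) has_derivative (\<lambda>_. 0)) (at x)" by simp
  moreover have "open {x :: real ^ 'd. \<rho> < norm x}"
    by (intro open_Collect_less continuous_intros)
  ultimately have "(f has_derivative (\<lambda>_. 0)) (at x)"
    by (rule has_derivative_transform_within_open) (use assms in auto)
  from fun_cong[OF frechet_derivative_at[OF this], of "axis i 1"] show ?thesis by (simp add: partial_deriv_def)
qed

lemma partial_deriv_mult:
  fixes f g :: "real ^ 'd::finite \<Rightarrow> real"
  assumes "f differentiable at x" "g differentiable at x"
  shows "partial_deriv i (\<lambda>x. f x * g x) x = f x * partial_deriv i g x + partial_deriv i f x * g x"
proof -
  have "((\<lambda>x. f x * g x) has_derivative
      (\<lambda>h. f x * frechet_derivative g (at x) h + frechet_derivative f (at x) h * g x)) (at x)"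
    using assms unfolding frechet_derivative_works by (rule has_derivative_mult)
  from fun_cong[OF frechet_derivative_at[OF this], of "axis i 1"] show ?thesis by (simp add: partial_deriv_def)
qed

lemma test_function_bounded_support:
  fixes \<phi> :: "real ^ 'd::finite \<Rightarrow> real"
  assumes "test_function \<phi>"
  obtains \<rho> where "\<And>x. norm x > \<rho> \<Longrightarrow> \<phi> x = 0"
proof -
  have "bounded {x. \<phi> x \<noteq> 0}"
    using assms bounded_subset[OF compact_imp_bounded closure_subset] by (auto simp: test_function_def)
  then obtain b where b: "\<And>x. \<phi> x \<noteq> 0 \<Longrightarrow> norm x \<le> b" by (auto simp: bounded_iff)
  show ?thesis
  proof (rule that)
    show "\<phi> x = 0" if "norm x > b" for x using b[of x] that by (meson not_le)
  qed
qed

text \<open>The product with the test function has bounded support, so its partial derivative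
  integrates to 0; the other factor may grow.\<close>

lemma integration_by_parts:
  fixes f \<phi> :: "real ^ 'd::finite \<Rightarrow> real"
  assumes f: "C_k (Suc 0) f" and \<phi>: "test_function \<phi>"
  shows "(LBINT y. f y * partial_deriv i \<phi> y) = - (LBINT y. partial_deriv i f y * \<phi> y)"
proof -
  have C: "C_k (Suc 0) \<phi>" using \<phi> unfolding test_function_def by blast
  have df: "f differentiable at x" and dp: "\<phi> differentiable at x" for x using f C by auto
  have cf': "continuous_on UNIV (partial_deriv i f)" and cp': "continuous_on UNIV (partial_deriv i \<phi>)"
    using f C by auto
  have cf: "continuous_on UNIV f" and cp: "continuous_on UNIV \<phi>"
    using df dp by (auto intro!: continuous_at_imp_continuous_on differentiable_imp_continuous_within)
  obtain \<rho> where \<rho>: "\<And>x. norm x > \<rho> \<Longrightarrow> \<phi> x = 0" using test_function_bounded_support[OF \<phi>] by blast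
  have pd: "partial_deriv i (\<lambda>x. f x * \<phi> x) = (\<lambda>x. f x * partial_deriv i \<phi> x + partial_deriv i f x * \<phi> x)"
    using partial_deriv_mult[OF df dp] by (simp add: fun_eq_iff)
  have "(LBINT y. f y * partial_deriv i \<phi> y + partial_deriv i f y * \<phi> y) = 0"
    unfolding pd[symmetric]
  proof (rule integral_partial_deriv_eq_0)
    show "continuous_on UNIV (partial_deriv i (\<lambda>x. f x * \<phi> x))"
      unfolding pd by (intro continuous_intros cf cf' cp cp')
    show "f x * \<phi> x = 0" if "norm x > \<rho>" for x using \<rho>[OF that] by simp
  qed (use df dp in simp)
  moreover have "integrable lborel (\<lambda>y. f y * partial_deriv i \<phi> y)"
    by (rule integrable_bounded_support[of _ \<rho>])
       (auto intro!: continuous_intros cf cp' simp: partial_deriv_outside_support[OF \<rho>])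
  moreover have "integrable lborel (\<lambda>y. partial_deriv i f y * \<phi> y)"
    by (rule integrable_bounded_support[of _ \<rho>]) (auto intro!: continuous_intros cf' cp simp: \<rho>)
  ultimately show ?thesis by simp
qed

lemma continuous_imp_locally_integrable:
  fixes f :: "real ^ 'd::finite \<Rightarrow> 'b::euclidean_space"
  assumes "continuous_on UNIV f" shows "locally_integrable f"
  unfolding locally_integrable_def set_integrable_def
  by (auto intro!: borel_integrable_compact continuous_on_subset[OF assms])

section \<open>Interpolants of finitely supported functions\<close>

definition interpolant :: "('d::finite \<Rightarrow> real \<Rightarrow> real) \<Rightarrow> (int ^ 'd) set \<Rightarrow> (int ^ 'd \<Rightarrow> real) \<Rightarrow> real ^ 'd \<Rightarrow> real" where
  "interpolant P F c y = (\<Sum>x\<in>F. ker P 1 x y * c x)"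

lemma continuous_on_interpolant:
  assumes "\<forall>i. unit_kernel (P i)" shows "continuous_on A (interpolant P F c)"
  unfolding interpolant_def by (intro continuous_intros continuous_on_ker assms)

text \<open>Jensen's inequality at each point with weights of sum at most 1, followed by integration
  of the kernels, whose mass is 1 at mesh size 1.\<close>

lemma interpolant_powr_le:
  fixes c :: "int ^ 'd::finite \<Rightarrow> real"
  assumes P: "\<forall>i. unit_kernel (P i)" and p: "p \<ge> 1" and F: "finite F"
  shows "integrable lborel (\<lambda>y. \<bar>interpolant P F c y\<bar> powr p)"
    and "(LBINT y. \<bar>interpolant P F c y\<bar> powr p) \<le> (\<Sum>x\<in>F. \<bar>c x\<bar> powr p)"
proof -
  have le: "\<bar>interpolant P F c y\<bar> powr p \<le> (\<Sum>x\<in>F. ker P 1 x y * \<bar>c x\<bar> powr p)" for y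
    unfolding interpolant_def by (intro sum_weight_powr_le p F ker_nonneg P sum_ker_le_1)
  note K = integral_ker[OF P, of 1, simplified]
  have I: "integrable lborel (\<lambda>y. \<Sum>x\<in>F. ker P 1 x y * \<bar>c x\<bar> powr p)" using K by simp
  have [measurable]: "interpolant P F c \<in> borel_measurable borel"
    using continuous_on_interpolant[OF P] by (rule borel_measurable_continuous_onI)
  show I': "integrable lborel (\<lambda>y. \<bar>interpolant P F c y\<bar> powr p)"
  proof (rule Bochner_Integration.integrable_bound[OF I])
    show "AE y in lborel. norm (\<bar>interpolant P F c y\<bar> powr p) \<le> norm (\<Sum>x\<in>F. ker P 1 x y * \<bar>c x\<bar> powr p)"
      using le by (intro AE_I2) (simp add: order_trans[OF le abs_ge_self])
  qed measurable
  have "(LBINT y. \<bar>interpolant P F c y\<bar> powr p) \<le> (LBINT y. (\<Sum>x\<in>F. ker P 1 x y * \<bar>c x\<bar> powr p))"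
    by (intro integral_mono I I' le)
  also have "\<dots> = (\<Sum>x\<in>F. \<bar>c x\<bar> powr p)" using K by (simp add: Bochner_Integration.integral_sum)
  finally show "(LBINT y. \<bar>interpolant P F c y\<bar> powr p) \<le> (\<Sum>x\<in>F. \<bar>c x\<bar> powr p)" .
qed

lemma C_k_ker:
  assumes "\<forall>i. unit_kernel (P i)" shows "C_k k (ker P h x)"
  unfolding ker_eq_vprod by (intro C_k_vprod smooth_unit_kernel_scaled assms[rule_format])

context kernel_pair begin

lemma R_all: "\<forall>i. unit_kernel ((\<lambda>_. R) i)" using R by simp

lemma rR_all: "\<forall>j. unit_kernel (((\<lambda>_. R)(i := r)) j)" using r R by simp

text \<open>The sum runs over the support, so the definition is meant for finitely supported
  functions; general ones are reached later through \<open>cut\<close>.\<close>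

definition smooth_ext :: "(int ^ 'd::finite \<Rightarrow> real) \<Rightarrow> real ^ 'd \<Rightarrow> real" where
  "smooth_ext u = interpolant (\<lambda>_. R) {x. u x \<noteq> 0} u"

text \<open>A backward difference can be nonzero only at a support point or at its translate by the
  unit vector, hence the index set. Coordinate \<open>i\<close> carries \<open>r\<close>, the kernel
  left over when \<open>R\<close> is differentiated.\<close>

definition smooth_ext_grad :: "(int ^ 'd::finite \<Rightarrow> real) \<Rightarrow> real ^ 'd \<Rightarrow> real ^ 'd" where
  "smooth_ext_grad u y = (\<chi> i. interpolant ((\<lambda>_. R)(i := r))
     ({x. u x \<noteq> 0} \<union> (\<lambda>x. x + unit_vec i) ` {x. u x \<noteq> 0}) (\<lambda>x. u x - u (x - unit_vec i)) y)"

text \<open>Summation by parts: the derivative of each kernel is a difference of neighbouring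
  kernels, and the shift is moved from the kernel to the values.\<close>

lemma smooth_ext_grad_eq:
  fixes u :: "int ^ 'd::finite \<Rightarrow> real"
  assumes F: "finite {x. u x \<noteq> 0}"
  shows "smooth_ext_grad u y $ i = (\<Sum>x\<in>{x. u x \<noteq> 0}. u x * partial_deriv i (ker (\<lambda>_. R) 1 x) y)"
proof -
  let ?F = "{x. u x \<noteq> 0}" and ?k = "ker ((\<lambda>_. R)(i := r)) 1" and ?s = "\<lambda>x. x + unit_vec i :: int ^ 'd"
  have pd: "partial_deriv i (ker (\<lambda>_. R) 1 x) y = ?k x y - ?k (x + unit_vec i) y" for x
    using partial_deriv_ker[OF R_all r zero_less_one, of i x y] R_deriv by (simp add: unit_vec_def del: fun_upd_apply)
  have 1: "(\<Sum>x\<in>?F \<union> ?s ` ?F. ?k x y * u x) = (\<Sum>x\<in>?F. ?k x y * u x)"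
    by (rule sum.mono_neutral_right) (use F in auto)
  have "(\<Sum>x\<in>?F \<union> ?s ` ?F. ?k x y * u (x - unit_vec i)) = (\<Sum>x\<in>?s ` ?F. ?k x y * u (x - unit_vec i))"
  proof (rule sum.mono_neutral_right)
    show "\<forall>x\<in>(?F \<union> ?s ` ?F) - ?s ` ?F. ?k x y * u (x - unit_vec i) = 0"
    proof
      fix x assume x: "x \<in> (?F \<union> ?s ` ?F) - ?s ` ?F"
      have "x = ?s (x - unit_vec i)" by simp
      hence "x - unit_vec i \<notin> ?F" using x by blast
      thus "?k x y * u (x - unit_vec i) = 0" by simp
    qed
  qed (use F in auto)
  also have "\<dots> = (\<Sum>x\<in>?F. ?k (x + unit_vec i) y * u x)"
    by (subst sum.reindex) (auto simp: inj_on_def)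
  finally have 2: "(\<Sum>x\<in>?F \<union> ?s ` ?F. ?k x y * u (x - unit_vec i)) = (\<Sum>x\<in>?F. ?k (x + unit_vec i) y * u x)" .
  show ?thesis
    using 1 2 by (simp add: smooth_ext_grad_def interpolant_def pd right_diff_distrib left_diff_distrib
        sum_subtractf mult.commute del: fun_upd_apply)
qed

lemma smooth_ext_weak_gradient:
  fixes u :: "int ^ 'd::finite \<Rightarrow> real"
  assumes F: "finite {x. u x \<noteq> 0}"
  shows "has_weak_gradient (smooth_ext u) (smooth_ext_grad u)"
  unfolding has_weak_gradient_def
proof (intro conjI allI impI)
  let ?F = "{x. u x \<noteq> 0}" and ?k = "ker (\<lambda>_ :: 'd. R) 1"
  show "locally_integrable (smooth_ext u)"
    unfolding smooth_ext_def by (intro continuous_imp_locally_integrable continuous_on_interpolant R_all)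
  have "continuous_on UNIV (smooth_ext_grad u)"
    unfolding smooth_ext_grad_def[abs_def]
    by (intro continuous_on_vec_lambda continuous_on_interpolant[OF rR_all])
  thus "locally_integrable (smooth_ext_grad u)" by (rule continuous_imp_locally_integrable)
  fix \<phi> :: "real ^ 'd \<Rightarrow> real" and i assume \<phi>: "test_function \<phi>"
  have C: "C_k (Suc 0) \<phi>" using \<phi> unfolding test_function_def by blast
  have cp': "continuous_on UNIV (partial_deriv i \<phi>)" using C by auto
  have "continuous_on UNIV \<phi>"
    using C by (auto intro!: continuous_at_imp_continuous_on differentiable_imp_continuous_within)
  have i1: "integrable lborel (\<lambda>y. ?k x y * partial_deriv i \<phi> y)" for x
    by (intro integrable_ker_mult_local R_all continuous_imp_locally_integrable cp') simp
  obtain \<rho> where \<rho>: "\<And>x. norm x > \<rho> \<Longrightarrow> \<phi> x = 0" using test_function_bounded_support[OF \<phi>] by blast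
  have i2: "integrable lborel (\<lambda>y. partial_deriv i (?k x) y * \<phi> y)" for x
    using C_k_ker[OF R_all, of "Suc 0" 1 x] \<open>continuous_on UNIV \<phi>\<close>
    by (intro integrable_bounded_support[of _ \<rho>] continuous_intros) (auto simp: \<rho>)
  have "(LBINT y. smooth_ext u y * partial_deriv i \<phi> y) =
      (LBINT y. (\<Sum>x\<in>?F. u x * (?k x y * partial_deriv i \<phi> y)))"
    by (simp add: smooth_ext_def interpolant_def sum_distrib_right sum_distrib_left mult_ac)
  also have "\<dots> = (\<Sum>x\<in>?F. u x * (LBINT y. ?k x y * partial_deriv i \<phi> y))"
    using i1 by (simp add: Bochner_Integration.integral_sum)
  also have "\<dots> = (\<Sum>x\<in>?F. u x * - (LBINT y. partial_deriv i (?k x) y * \<phi> y))"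
    by (intro sum.cong refl arg_cong2[where f = "(*)"] integration_by_parts C_k_ker R_all \<phi>)
  also have "\<dots> = - (LBINT y. (\<Sum>x\<in>?F. u x * (partial_deriv i (?k x) y * \<phi> y)))"
    using i2 by (simp add: Bochner_Integration.integral_sum sum_negf)
  also have "\<dots> = - (LBINT y. smooth_ext_grad u y $ i * \<phi> y)"
    by (simp add: smooth_ext_grad_eq[OF F] sum_distrib_right mult.assoc)
  finally show "(LBINT y. smooth_ext u y * partial_deriv i \<phi> y) = - (LBINT y. smooth_ext_grad u y $ i * \<phi> y)" .
qed

lemma smooth_ext_norms:
  fixes u :: "int ^ 'd::finite \<Rightarrow> real"
  assumes F: "finite {x. u x \<noteq> 0}" and p: "p \<ge> 1"
  shows "smooth_ext u \<in> borel_measurable lborel" "integrable lborel (\<lambda>y. \<bar>smooth_ext u y\<bar> powr p)"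
    "(LBINT y. \<bar>smooth_ext u y\<bar> powr p) \<le> power_sum p u"
    "in_Lp 2 (smooth_ext_grad u)" "(LBINT y. norm (smooth_ext_grad u y) powr 2) \<le> energy u"
proof -
  let ?F = "{x. u x \<noteq> 0}"
  show "smooth_ext u \<in> borel_measurable lborel"
    unfolding smooth_ext_def using borel_measurable_continuous_onI[OF continuous_on_interpolant[OF R_all]] by simp
  show "integrable lborel (\<lambda>y. \<bar>smooth_ext u y\<bar> powr p)"
    unfolding smooth_ext_def by (intro interpolant_powr_le R_all p F)
  have "(LBINT y. \<bar>smooth_ext u y\<bar> powr p) \<le> (\<Sum>x\<in>?F. \<bar>u x\<bar> powr p)"
    unfolding smooth_ext_def by (intro interpolant_powr_le R_all p F)
  also have "\<dots> \<le> power_sum p u"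
    unfolding power_sum_def by (intro finite_sum_le_infsum summable_on_finite_support) (use F in auto)
  finally show "(LBINT y. \<bar>smooth_ext u y\<bar> powr p) \<le> power_sum p u" .
  define c where "c i x = u x - u (x - unit_vec i)" for i x
  define F' where "F' i = ?F \<union> (\<lambda>x. x + unit_vec i) ` ?F" for i
  have F': "finite (F' i)" for i using F by (simp add: F'_def)
  have g: "smooth_ext_grad u y $ i = interpolant ((\<lambda>_. R)(i := r)) (F' i) (c i) y" for y i
    by (simp add: smooth_ext_grad_def F'_def c_def[abs_def])
  have mg: "smooth_ext_grad u \<in> borel_measurable lborel"
    using locally_integrable_measurable smooth_ext_weak_gradient[OF F] by (auto simp: has_weak_gradient_def)
  have ig: "integrable lborel (\<lambda>y. \<bar>smooth_ext_grad u y $ i\<bar> powr 2)"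
    and lg: "(LBINT y. \<bar>smooth_ext_grad u y $ i\<bar> powr 2) \<le> (\<Sum>x\<in>F' i. \<bar>c i x\<bar> powr 2)" for i
    unfolding g by (rule interpolant_powr_le[OF rR_all _ F']; simp)+
  have "integrable lborel (\<lambda>y. norm (smooth_ext_grad u y) powr 2)"
    unfolding norm_powr_2 using ig by (simp add: abs_powr_2)
  thus L: "in_Lp 2 (smooth_ext_grad u)" using mg by (simp add: in_Lp_def)
  have fe: "finite_energy u" by (rule ell2_imp_finite_energy[OF finite_support_ell2[OF F]])
  have "(\<Sum>x\<in>F' i. \<bar>c i x\<bar> powr 2) \<le> infsum (sq_diff u i) UNIV" for i
  proof -
    \<comment> \<open>The backward differences are translates of the forward ones in the energy, so
      the total is the same.\<close>
    have e: "\<bar>c i x\<bar> powr 2 = sq_diff u i (x - unit_vec i)" for x by (simp add: abs_powr_2 c_def sq_diff_def)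
    have s: "(\<lambda>x. sq_diff u i (x - unit_vec i)) summable_on UNIV"
      using summable_on_shift[of "sq_diff u i" "- unit_vec i"] fe by (simp add: finite_energy_def)
    have "(\<Sum>x\<in>F' i. sq_diff u i (x - unit_vec i)) \<le> (\<Sum>\<^sub>\<infinity>x. sq_diff u i (x - unit_vec i))"
      by (intro finite_sum_le_infsum s F') auto
    thus ?thesis using infsum_shift[of "sq_diff u i" "- unit_vec i"] by (simp add: e)
  qed
  thus "(LBINT y. norm (smooth_ext_grad u y) powr 2) \<le> energy u"
    unfolding in_Lp_2_components(3)[OF L] energy_def by (intro sum_mono order_trans[OF lg])
qed

end

section \<open>Lattice shifts controlled by the energy\<close>

definition shift_bounded :: "int ^ 'd::finite \<Rightarrow> bool" where
  "shift_bounded z \<longleftrightarrow> (\<exists>C\<ge>0. \<forall>u. ell2 u \<longrightarrow> sq_sum (\<lambda>x. u (x + z) - u x) \<le> C * energy u)"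

lemma ell2_shift:
  fixes u :: "int ^ 'd::finite \<Rightarrow> real"
  assumes "ell2 u" shows "ell2 (\<lambda>x. u (x + z))"
  using assms summable_on_shift[of "\<lambda>x. (u x)\<^sup>2" z] by (simp add: ell2_def)

lemma ell2_shift_diff:
  fixes u :: "int ^ 'd::finite \<Rightarrow> real"
  assumes "ell2 u" shows "ell2 (\<lambda>x. u (x + z) - u x)"
  by (intro sq_sum_diff_le(1) ell2_shift assms)

lemma sq_sum_shift:
  fixes u :: "int ^ 'd::finite \<Rightarrow> real"
  shows "sq_sum (\<lambda>x. u (x + z)) = sq_sum u"
  using infsum_shift[of "\<lambda>x. (u x)\<^sup>2" z] by (simp add: sq_sum_def)

lemma shift_bounded_0: "shift_bounded 0"
  unfolding shift_bounded_def by (auto intro!: exI[of _ 0] simp: sq_sum_def)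

lemma shift_bounded_unit_vec: "shift_bounded (unit_vec i)"
  unfolding shift_bounded_def
proof (intro exI[of _ 1] conjI allI impI)
  fix u :: "int ^ 'a \<Rightarrow> real"
  have "sq_sum (\<lambda>x. u (x + unit_vec i) - u x) = infsum (sq_diff u i) UNIV"
    by (simp add: sq_sum_def sq_diff_def[abs_def])
  also have "\<dots> \<le> energy u"
    unfolding energy_def by (rule member_le_sum) (auto intro: infsum_nonneg)
  finally show "sq_sum (\<lambda>x. u (x + unit_vec i) - u x) \<le> 1 * energy u" by simp
qed simp

lemma shift_bounded_minus:
  assumes "shift_bounded z" shows "shift_bounded (- z)"
proof -
  have "sq_sum (\<lambda>x. u (x + - z) - u x) = sq_sum (\<lambda>x. u (x + z) - u x)" for u :: "int ^ 'a \<Rightarrow> real"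
  proof -
    have "(u (x + - z) - u x)\<^sup>2 = (\<lambda>x. (u (x + z) - u x)\<^sup>2) (x + - z)" for x
      by (simp add: power2_commute)
    thus ?thesis unfolding sq_sum_def by (simp only: infsum_shift[where f = "\<lambda>x. (u (x + z) - u x)\<^sup>2"])
  qed
  thus ?thesis using assms by (simp add: shift_bounded_def)
qed

lemma shift_bounded_add:
  assumes "shift_bounded z" "shift_bounded w" shows "shift_bounded (z + w)"
proof -
  obtain C D where C: "C \<ge> 0" "\<And>u. ell2 u \<Longrightarrow> sq_sum (\<lambda>x. u (x + z) - u x) \<le> C * energy u"
    and D: "D \<ge> 0" "\<And>u. ell2 u \<Longrightarrow> sq_sum (\<lambda>x. u (x + w) - u x) \<le> D * energy u"
    using assms by (auto simp: shift_bounded_def)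
  have "sq_sum (\<lambda>x. u (x + (z + w)) - u x) \<le> (2 * C + 2 * D) * energy u" if u: "ell2 u" for u
  proof -
    \<comment> \<open>The sign of the second difference is chosen so that the difference over
      \<open>z + w\<close> is ?f (x + z) - ?g x, the form to which \<open>sq_sum_diff_le\<close>
      applies.\<close>
    let ?f = "\<lambda>x. u (x + w) - u x" and ?g = "\<lambda>x. u x - u (x + z)"
    have g: "ell2 ?g" by (intro sq_sum_diff_le(1) ell2_shift u)
    have "sq_sum (\<lambda>x. u (x + (z + w)) - u x) = sq_sum (\<lambda>x. ?f (x + z) - ?g x)"
      by (rule arg_cong[where f = sq_sum]) (simp add: fun_eq_iff add.assoc)
    also have "\<dots> \<le> 2 * sq_sum (\<lambda>x. ?f (x + z)) + 2 * sq_sum ?g"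
      by (intro sq_sum_diff_le(2) ell2_shift[of ?f] ell2_shift_diff u g)
    also have "sq_sum (\<lambda>x. ?f (x + z)) = sq_sum ?f" by (rule sq_sum_shift)
    also have "sq_sum ?g = sq_sum (\<lambda>x. u (x + z) - u x)" by (simp add: sq_sum_def power2_commute)
    finally show ?thesis using C(2)[OF u] D(2)[OF u] by (simp add: algebra_simps)
  qed
  thus ?thesis unfolding shift_bounded_def using C(1) D(1) by (intro exI[of _ "2 * C + 2 * D"]) auto
qed

text \<open>The shifts with a uniform constant form a subgroup, and the unit vectors generate the
  lattice.\<close>

lemma shift_bounded_all: "shift_bounded (z :: int ^ 'd::finite)"
proof -
  have nat: "shift_bounded (of_nat n * unit_vec i :: int ^ 'd)" for n i
  proof (induction n)
    case (Suc n)
    have "of_nat (Suc n) * unit_vec i = unit_vec i + (of_nat n * unit_vec i :: int ^ 'd)"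
      by (simp add: algebra_simps)
    thus ?case using shift_bounded_add[OF shift_bounded_unit_vec Suc] by metis
  qed (simp add: shift_bounded_0)
  \<comment> \<open>Each coordinate is split into positive and negative part, at least one of which
    is 0.\<close>
  define w where "w i = of_nat (nat (z $ i)) * unit_vec i + - (of_nat (nat (- z $ i)) * unit_vec i)" for i
  have w: "shift_bounded (w i)" for i
    unfolding w_def by (intro shift_bounded_add shift_bounded_minus nat)
  have "shift_bounded (\<Sum>i\<in>I. w i)" if "finite I" for I
    using that by (induction I rule: finite_induct) (simp_all add: shift_bounded_0 shift_bounded_add w)
  hence "shift_bounded (\<Sum>i\<in>UNIV. w i)" by simp
  moreover have "(\<Sum>i\<in>UNIV. w i) = z"
  proof -
    have "w i $ j = (if i = j then z $ i else 0)" for i j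
      by (auto simp: w_def unit_vec_def axis_def of_nat_index vector_component)
    thus ?thesis by (simp add: vec_eq_iff sum_component)
  qed
  ultimately show ?thesis by simp
qed

lemma cube_translate: "cube m = (\<lambda>z. m + z) ` cube 0"
proof (intro equalityI subsetI)
  fix x assume "x \<in> cube m"
  hence "m $ i - 2 \<le> x $ i \<and> x $ i \<le> m $ i" for i by (auto simp: cube_def)
  hence "- 2 \<le> x $ i - m $ i \<and> x $ i - m $ i \<le> 0" for i by (metis diff_le_0_iff_le diff_le_eq add.commute le_diff_eq uminus_add_conv_diff)
  hence "x - m \<in> cube 0" by (auto simp: cube_def)
  thus "x \<in> (\<lambda>z. m + z) ` cube 0" by (intro image_eqI[of x _ "x - m"]) auto
qed (auto simp: cube_def)

text \<open>The offsets in \<open>cube 0\<close> lead to the lattice points whose kernels reach the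
  cell of \<open>m\<close>.\<close>

definition oscillation :: "real \<Rightarrow> (int ^ 'd::finite \<Rightarrow> real) \<Rightarrow> int ^ 'd \<Rightarrow> real" where
  "oscillation q u m = (\<Sum>z\<in>cube 0. \<bar>u (m + z) - u m\<bar> powr q)"

text \<open>For each of the finitely many offsets, the q-th power sum of a difference is bounded
  through its l2 norm, and that norm through the energy. The outcome is of order E powr (q / 2),
  independently of the mass of the function.\<close>

lemma oscillation_bound:
  assumes q: "q \<ge> 2"
  obtains C where "C \<ge> 0" "\<And>u :: int ^ 'd::finite \<Rightarrow> real. ell2 u \<Longrightarrow> oscillation q u summable_on UNIV"
    "\<And>u :: int ^ 'd::finite \<Rightarrow> real. ell2 u \<Longrightarrow> infsum (oscillation q u) UNIV \<le> C * energy u powr (q / 2)"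
proof -
  have "\<forall>z :: int ^ 'd. \<exists>C\<ge>0. \<forall>u. ell2 u \<longrightarrow> sq_sum (\<lambda>x. u (x + z) - u x) \<le> C * energy u"
    using shift_bounded_all unfolding shift_bounded_def by blast
  then obtain C where C: "\<And>z :: int ^ 'd. C z \<ge> 0"
    "\<And>z u. ell2 u \<Longrightarrow> sq_sum (\<lambda>x. u (x + z) - u x) \<le> C z * energy u" by metis
  show ?thesis
  proof (rule that[of "\<Sum>z\<in>cube 0. C z powr (q / 2)"])
    show "(\<Sum>z\<in>cube 0. C z powr (q / 2)) \<ge> 0" by (intro sum_nonneg) auto
    fix u :: "int ^ 'd \<Rightarrow> real" assume u: "ell2 u"
    note l = ell2_shift_diff[OF u]
    have s: "(\<lambda>m. \<bar>u (m + z) - u m\<bar> powr q) summable_on UNIV" for z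
      using ell2_power_summable(1)[OF l q] .
    have "(\<lambda>m. \<Sum>z\<in>I. \<bar>u (m + z) - u m\<bar> powr q) summable_on UNIV" if "finite I" for I
      using that by (induction I rule: finite_induct) (simp_all add: summable_on_add s)
    thus "oscillation q u summable_on UNIV" by (simp add: oscillation_def[abs_def])
    have "infsum (oscillation q u) UNIV = (\<Sum>z\<in>cube 0. power_sum q (\<lambda>m. u (m + z) - u m))"
      unfolding oscillation_def[abs_def] power_sum_def by (intro infsum_sum_real s) simp
    also have "\<dots> \<le> (\<Sum>z\<in>cube 0. C z powr (q / 2) * energy u powr (q / 2))"
    proof (rule sum_mono)
      fix z :: "int ^ 'd"
      have "power_sum q (\<lambda>m. u (m + z) - u m) \<le> sq_sum (\<lambda>m. u (m + z) - u m) powr (q / 2)"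
        by (rule ell2_power_summable(2)[OF l q])
      also have "\<dots> \<le> (C z * energy u) powr (q / 2)"
        using q C(2)[OF u] by (intro powr_mono2) auto
      finally show "power_sum q (\<lambda>m. u (m + z) - u m) \<le> C z powr (q / 2) * energy u powr (q / 2)"
        using C(1) by (simp add: powr_mult)
    qed
    finally show "infsum (oscillation q u) UNIV \<le> (\<Sum>z\<in>cube 0. C z powr (q / 2)) * energy u powr (q / 2)"
      by (simp add: sum_distrib_right)
  qed
qed

text \<open>With t such that (1 + t) powr q = 1 + e, either a - b is at most t times b, or b is at
  most a - b divided by t. The two cases produce the two terms; no convexity enters, so every
  positive exponent is covered.\<close>

lemma powr_add_le:
  fixes q e :: real
  assumes q: "q > 0" and e: "e > 0"
  obtains C where "C \<ge> 0" "\<And>a b :: real. \<bar>a\<bar> powr q \<le> (1 + e) * \<bar>b\<bar> powr q + C * \<bar>a - b\<bar> powr q"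
proof -
  define t where "t = (1 + e) powr (1 / q) - 1"
  have t1: "(1 + t) powr q = 1 + e" using q e by (simp add: t_def powr_powr)
  have "(1 + e) powr (1 / q) > 1 powr (1 / q)" using q e by (intro powr_less_mono2) auto
  hence t: "t > 0" by (simp add: t_def)
  show ?thesis
  proof (rule that[of "(1 + 1 / t) powr q"])
    fix a b :: real
    have tri: "\<bar>a\<bar> \<le> \<bar>b\<bar> + \<bar>a - b\<bar>" by simp
    show "\<bar>a\<bar> powr q \<le> (1 + e) * \<bar>b\<bar> powr q + (1 + 1 / t) powr q * \<bar>a - b\<bar> powr q"
    proof (cases "\<bar>a - b\<bar> \<le> t * \<bar>b\<bar>")
      case True
      hence "\<bar>a\<bar> \<le> (1 + t) * \<bar>b\<bar>" using tri by (simp add: algebra_simps)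
      hence "\<bar>a\<bar> powr q \<le> ((1 + t) * \<bar>b\<bar>) powr q" using q by (intro powr_mono2) auto
      also have "\<dots> = (1 + e) * \<bar>b\<bar> powr q" using t by (simp add: powr_mult t1)
      finally show ?thesis by (simp add: add_increasing2)
    next
      case False
      hence "\<bar>b\<bar> \<le> \<bar>a - b\<bar> / t" using t by (simp add: field_simps)
      hence "\<bar>a\<bar> \<le> (1 + 1 / t) * \<bar>a - b\<bar>" using tri by (simp add: algebra_simps)
      hence "\<bar>a\<bar> powr q \<le> ((1 + 1 / t) * \<bar>a - b\<bar>) powr q" using q by (intro powr_mono2) auto
      also have "\<dots> = (1 + 1 / t) powr q * \<bar>a - b\<bar> powr q" using t by (simp add: powr_mult)
      finally show ?thesis using e by (simp add: add_increasing)
    qed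
  qed simp
qed

context kernel_pair begin

text \<open>At each point the kernels of the surrounding cube add up to 1, so the error is a
  weighted mean of differences within the cube; Jensen's inequality applies and the weights are then
  bounded by 1.\<close>

lemma smooth_ext_close:
  fixes u :: "int ^ 'd::finite \<Rightarrow> real"
  assumes F: "finite {x. u x \<noteq> 0}" and q: "q \<ge> 1"
  shows "\<bar>u (vfloor y) - smooth_ext u y\<bar> powr q \<le> oscillation q u (vfloor y)"
proof -
  let ?m = "vfloor y" and ?k = "\<lambda>x. ker (\<lambda>_. R) 1 x y"
  have cube: "x \<in> cube ?m" if "?k x \<noteq> 0" for x
    using ker_nonzeroD(3)[OF R_all that] by simp
  have "smooth_ext u y = (\<Sum>x\<in>{x. u x \<noteq> 0} \<union> cube ?m. ?k x * u x)"
    unfolding smooth_ext_def interpolant_def by (rule sum.mono_neutral_left) (use F in auto)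
  also have "\<dots> = (\<Sum>x\<in>cube ?m. ?k x * u x)"
    by (rule sum.mono_neutral_right) (use F cube in auto)
  finally have "u ?m - smooth_ext u y = (\<Sum>x\<in>cube ?m. ?k x) * u ?m - (\<Sum>x\<in>cube ?m. ?k x * u x)"
    using sum_ker_cube[OF R_all, of 1 y] by simp
  also have "\<dots> = (\<Sum>x\<in>cube ?m. ?k x * (u ?m - u x))"
    by (simp add: sum_distrib_right sum_subtractf right_diff_distrib)
  finally have "\<bar>u ?m - smooth_ext u y\<bar> powr q \<le> (\<Sum>x\<in>cube ?m. ?k x * \<bar>u ?m - u x\<bar> powr q)"
    by (simp only:) (rule sum_weight_powr_le[OF q finite_cube ker_nonneg[OF R_all] sum_ker_le_1[OF R_all finite_cube]])
  also have "\<dots> \<le> (\<Sum>x\<in>cube ?m. \<bar>u ?m - u x\<bar> powr q)"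
    using sum_ker_le_1[OF R_all, of "{_}" 1 y] ker_nonneg[OF R_all]
    by (intro sum_mono mult_left_le_one_le) auto
  also have "\<dots> = oscillation q u ?m"
    unfolding oscillation_def cube_translate[of ?m] by (subst sum.reindex) (auto simp: abs_minus_commute)
  finally show ?thesis .
qed

text \<open>The power sum is the integral of the step function on unit cells, which is compared
  pointwise with the interpolant. The factor 1 + e is needed because it multiplies the main term,
  while the large constant falls on the energy.\<close>

lemma power_sum_le_smooth_ext:
  assumes q: "q \<ge> 2" and e: "e > 0"
  obtains C where "C \<ge> 0" "\<And>u :: int ^ 'd::finite \<Rightarrow> real. finite {x. u x \<noteq> 0} \<Longrightarrow>
    power_sum q u \<le> (1 + e) * (LBINT y. \<bar>smooth_ext u y\<bar> powr q) + C * energy u powr (q / 2)"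
proof -
  obtain C1 where C1: "C1 \<ge> 0" "\<And>u :: int ^ 'd \<Rightarrow> real. ell2 u \<Longrightarrow> oscillation q u summable_on UNIV"
    "\<And>u :: int ^ 'd \<Rightarrow> real. ell2 u \<Longrightarrow> infsum (oscillation q u) UNIV \<le> C1 * energy u powr (q / 2)"
    using oscillation_bound[OF q, where 'd = 'd] by blast
  obtain C2 where C2: "C2 \<ge> 0" "\<And>a b :: real. \<bar>a\<bar> powr q \<le> (1 + e) * \<bar>b\<bar> powr q + C2 * \<bar>a - b\<bar> powr q"
    using powr_add_le[of q e] q e by auto
  show ?thesis
  proof (rule that[of "C2 * C1"])
    fix u :: "int ^ 'd \<Rightarrow> real" assume F: "finite {x. u x \<noteq> 0}"
    have l: "ell2 u" by (rule finite_support_ell2[OF F])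
    have onn: "oscillation q u m \<ge> 0" for m by (auto simp: oscillation_def intro: sum_nonneg)
    have q1: "q \<ge> 1" using q by simp
    note S = smooth_ext_norms[OF F q1]
    note [measurable] = S(1)
    have [measurable]: "(\<lambda>y. f (vfloor y)) \<in> borel_measurable lborel" for f :: "int ^ 'd \<Rightarrow> real"
      by (rule measurable_compose[of vfloor lborel "count_space UNIV"]) auto
    let ?S = "\<integral>y. \<bar>smooth_ext u y\<bar> powr q \<partial>lborel"
    have "ennreal (power_sum q u) = (\<integral>\<^sup>+y. ennreal (\<bar>u (vfloor y)\<bar> powr q) \<partial>lborel)"
      using integral_vfloor[OF zero_less_one ell2_power_summable(1)[OF l q]] by (simp add: power_sum_def)
    also have "\<dots> \<le> (\<integral>\<^sup>+y. ennreal (1 + e) * ennreal (\<bar>smooth_ext u y\<bar> powr q) +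
        ennreal C2 * ennreal (oscillation q u (vfloor y)) \<partial>lborel)"
    proof (rule nn_integral_mono)
      fix y
      have "\<bar>u (vfloor y)\<bar> powr q \<le> (1 + e) * \<bar>smooth_ext u y\<bar> powr q + C2 * oscillation q u (vfloor y)"
        using C2(2)[of "u (vfloor y)" "smooth_ext u y"] mult_left_mono[OF smooth_ext_close[OF F q1, of y] C2(1)] by linarith
      thus "ennreal (\<bar>u (vfloor y)\<bar> powr q) \<le> ennreal (1 + e) * ennreal (\<bar>smooth_ext u y\<bar> powr q) +
          ennreal C2 * ennreal (oscillation q u (vfloor y))"
        using e C2(1) onn by (simp add: ennreal_mult[symmetric] ennreal_plus[symmetric] ennreal_leI del: ennreal_plus)
    qed
    also have "\<dots> = ennreal (1 + e) * (\<integral>\<^sup>+y. ennreal (\<bar>smooth_ext u y\<bar> powr q) \<partial>lborel) +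
        ennreal C2 * (\<integral>\<^sup>+y. ennreal (oscillation q u (vfloor y)) \<partial>lborel)"
      by (subst nn_integral_add) (auto simp: nn_integral_cmult)
    also have "(\<integral>\<^sup>+y. ennreal (\<bar>smooth_ext u y\<bar> powr q) \<partial>lborel) = ennreal ?S"
      by (rule nn_integral_eq_integral[OF S(2)]) simp
    also have "(\<integral>\<^sup>+y. ennreal (oscillation q u (vfloor y)) \<partial>lborel) = ennreal (infsum (oscillation q u) UNIV)"
      using integral_vfloor[OF zero_less_one C1(2)[OF l] onn] by simp
    also have "ennreal (1 + e) * ennreal ?S + ennreal C2 * ennreal (infsum (oscillation q u) UNIV) =
        ennreal ((1 + e) * ?S + C2 * infsum (oscillation q u) UNIV)"
      using e C2(1) onn by (simp add: ennreal_mult[symmetric] ennreal_plus[symmetric] infsum_nonneg del: ennreal_plus)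
    finally have "power_sum q u \<le> (1 + e) * ?S + C2 * infsum (oscillation q u) UNIV"
      using e C2(1) onn by (subst (asm) ennreal_le_iff) (auto intro!: add_nonneg_nonneg mult_nonneg_nonneg infsum_nonneg)
    also have "\<dots> \<le> (1 + e) * ?S + C2 * (C1 * energy u powr (q / 2))"
      by (intro add_left_mono mult_left_mono C1(3) l C2(1))
    finally show "power_sum q u \<le> (1 + e) * ?S + C2 * C1 * energy u powr (q / 2)" by simp
  qed (use C1(1) C2(1) in simp)
qed

text \<open>Averages at every mesh have zero energy and vanish at infinity, so they are 0. This
  excludes a zero denominator in the Euclidean quotient.\<close>

lemma zero_weak_gradient_imp_zero:
  fixes v :: "real ^ 'd::finite \<Rightarrow> real"
  assumes v: "v \<in> borel_measurable lborel" "integrable lborel (\<lambda>y. \<bar>v y\<bar> powr 2)"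
    and g: "has_weak_gradient v g" "in_Lp 2 g" "(LBINT y. norm (g y) powr 2) = 0"
  shows "AE y in lborel. v y = 0"
proof -
  have z: "avg (\<lambda>_. r) h v x = 0" if h: "h > 0" for h x
  proof -
    have s: "(\<lambda>x. \<bar>avg (\<lambda>_. r) h v x\<bar> powr 2) summable_on UNIV"
      by (intro power_sum_avg_le r_all h v) simp
    have "energy (avg (\<lambda>_. r) h v) = 0"
      using energy_avg_le(2)[OF g(1,2) h] unfolding g(3) by (intro antisym) simp_all
    hence "avg (\<lambda>_. r) h v = (\<lambda>_. 0)"
      by (intro energy_zero_imp_zero energy_avg_le(1)[OF g(1,2) h] power_summable_imp_vanishing[OF _ s]) simp
    thus ?thesis by simp
  qed
  have "locally_integrable v" using g(1) by (simp add: has_weak_gradient_def)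
  thus ?thesis using z by (rule avg_zero_imp_AE_zero)
qed

text \<open>A finite bound on \<open>K_euclid\<close> is an inequality for the interpolant. It
  passes to the lattice norms because these dominate those of the interpolant and both exponents are
  positive.\<close>

lemma smooth_ext_Gagliardo_Nirenberg:
  fixes u :: "int ^ 'd::finite \<Rightarrow> real"
  assumes q: "2 < q" "ereal q < two_star CARD('d)" and K: "K_euclid TYPE('d) q \<le> ereal k" and k: "k \<ge> 0"
    and F: "finite {x. u x \<noteq> 0}"
  defines "d \<equiv> real CARD('d)"
  shows "(LBINT y. \<bar>smooth_ext u y\<bar> powr q) \<le>
    k * (sq_sum u powr ((d + (2 - d) * (q / 2)) / 2) * energy u powr ((q / 2 - 1) * d / 2))"
proof -
  let ?v = "smooth_ext u" and ?g = "smooth_ext_grad u"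
  let ?a = "(d + (2 - d) * (q / 2)) / 2" and ?b = "(q / 2 - 1) * d / 2"
  have a: "?a > 0" using subcritical_exponent_pos[OF q] by (simp add: d_def)
  have b: "?b > 0" using q by (simp add: d_def)
  note [measurable] = smooth_ext_norms(1)[OF F, of 2, simplified]
  note g = smooth_ext_weak_gradient[OF F]
  note gL = smooth_ext_norms(4)[OF F, of 2, simplified]
  have I2: "integrable lborel (\<lambda>y. \<bar>?v y\<bar> powr 2)" by (rule smooth_ext_norms(2)[OF F]) simp
  have vL: "in_Lp 2 ?v" using I2 by (simp add: in_Lp_def)
  define A where "A = (LBINT y. \<bar>?v y\<bar> powr 2)"
  define G where "G = (LBINT y. norm (?g y) powr 2)"
  have A: "0 \<le> A" "A \<le> sq_sum u"
    using smooth_ext_norms(3)[OF F, of 2] by (auto simp: A_def power_sum_2)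
  have G: "0 \<le> G" "G \<le> energy u"
    using smooth_ext_norms(5)[OF F, of 2] by (auto simp: G_def)
  show ?thesis
  proof (cases "AE y in lborel. ?v y = 0")
    case True
    hence "AE y in lborel. \<bar>?v y\<bar> powr q = 0" by eventually_elim simp
    hence "(LBINT y. \<bar>?v y\<bar> powr q) = 0" by (rule integral_eq_zero_AE)
    thus ?thesis using k by simp
  next
    case False
    \<comment> \<open>With a vanishing denominator the quotient would be 0 by convention and its
      upper bound would carry no information, so both norms must be shown to be nonzero.\<close>
    have "A \<noteq> 0"
    proof
      assume "A = 0"
      hence "AE y in lborel. \<bar>?v y\<bar> powr 2 = 0"
        unfolding A_def using integral_nonneg_eq_0_iff_AE[OF I2] by simp
      hence "AE y in lborel. ?v y = 0" by eventually_elim simp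
      thus False using False by simp
    qed
    moreover have "G \<noteq> 0"
      using zero_weak_gradient_imp_zero[OF _ I2 g gL] False by (auto simp: G_def)
    ultimately have pos: "A > 0" "G > 0" using A G by auto
    note w = weak_gradient_in_L2[OF g gL]
    have "?v \<in> H1_euclid" unfolding H1_euclid_def using vL g w(1) by blast
    hence "ereal (Q_euclid q ?v) \<le> K_euclid TYPE('d) q"
      unfolding K_euclid_def using q(2) False by (intro SUP_upper) simp
    hence "Q_euclid q ?v \<le> k" using K by (metis ereal_less_eq(3) order_trans)
    moreover have "(LBINT y. norm (weak_gradient ?v y) powr 2) = G"
      using w(2) Lp_norm_powr[of 2 "weak_gradient ?v" 2] Lp_norm_powr[of 2 ?g 2] by (simp add: G_def)
    ultimately have "(LBINT y. \<bar>?v y\<bar> powr q) / (A powr ?a * G powr ?b) \<le> k"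
      unfolding Q_euclid_subcritical[OF q] A_def d_def by simp
    hence "(LBINT y. \<bar>?v y\<bar> powr q) \<le> k * (A powr ?a * G powr ?b)"
      using pos by (simp add: pos_divide_le_eq)
    also have "\<dots> \<le> k * (sq_sum u powr ?a * energy u powr ?b)"
      using A G a b by (intro mult_left_mono[OF _ k] mult_mono powr_mono2) auto
    finally show ?thesis .
  qed
qed

text \<open>For finitely supported functions this combines the two preceding estimates; truncations
  carry it to all of l2, since mass, energy and power sum converge and the bound is continuous in
  them.\<close>

lemma small_gradient_bound:
  assumes q: "2 < q" "ereal q < two_star CARD('d::finite)" and K: "K_euclid TYPE('d) q \<le> ereal k" and k: "k \<ge> 0"
    and e: "e > 0"
  defines "d \<equiv> real CARD('d)"
  obtains C where "C \<ge> 0" "\<And>u :: int ^ 'd \<Rightarrow> real. ell2 u \<Longrightarrow> power_sum q u \<le>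
    (1 + e) * (k * (sq_sum u powr ((d + (2 - d) * (q / 2)) / 2) * energy u powr ((q / 2 - 1) * d / 2)))
     + C * energy u powr (q / 2)"
proof -
  let ?a = "(d + (2 - d) * (q / 2)) / 2" and ?b = "(q / 2 - 1) * d / 2"
  have a: "?a > 0" using subcritical_exponent_pos[OF q] by (simp add: d_def)
  have b: "?b > 0" using q by (simp add: d_def)
  have q2: "q \<ge> 2" using q by simp
  obtain C where C: "C \<ge> 0" "\<And>u :: int ^ 'd::finite \<Rightarrow> real. finite {x. u x \<noteq> 0} \<Longrightarrow>
    power_sum q u \<le> (1 + e) * (LBINT y. \<bar>smooth_ext u y\<bar> powr q) + C * energy u powr (q / 2)"
    using power_sum_le_smooth_ext[OF q2 e, where 'd = 'd] by blast
  let ?B = "\<lambda>s en. (1 + e) * (k * (s powr ?a * en powr ?b)) + C * en powr (q / 2)"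
  show ?thesis
  proof (rule that[OF C(1)])
    fix u :: "int ^ 'd \<Rightarrow> real" assume u: "ell2 u"
    have F: "finite {x. cut u n x \<noteq> 0}" for n by (rule finite_support_cut[OF ell2_imp_vanishing[OF u]])
    have le: "power_sum q (cut u n) \<le> ?B (sq_sum (cut u n)) (energy (cut u n))" for n
    proof -
      have "(1 + e) * (LBINT y. \<bar>smooth_ext (cut u n) y\<bar> powr q) \<le>
          (1 + e) * (k * (sq_sum (cut u n) powr ?a * energy (cut u n) powr ?b))"
        by (intro mult_left_mono smooth_ext_Gagliardo_Nirenberg[OF q K k F, folded d_def]) (use e in simp)
      thus ?thesis using C(2)[OF F[of n]] by linarith
    qed
    have E: "(\<lambda>n. energy (cut u n)) \<longlonglongrightarrow> energy u"
      by (rule energy_cut_tendsto[OF ell2_imp_finite_energy[OF u]])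
    have "(\<lambda>n. power_sum 2 (cut u n)) \<longlonglongrightarrow> power_sum 2 u"
      by (rule power_sum_cut_tendsto) (use u in \<open>auto simp: ell2_iff\<close>)
    hence A: "(\<lambda>n. sq_sum (cut u n)) \<longlonglongrightarrow> sq_sum u" by (simp add: power_sum_2)
    have P: "(\<lambda>n. power_sum q (cut u n)) \<longlonglongrightarrow> power_sum q u"
      by (rule power_sum_cut_tendsto[OF ell2_power_summable(1)[OF u q2]]) (use q in simp)
    have "(\<lambda>n. ?B (sq_sum (cut u n)) (energy (cut u n))) \<longlonglongrightarrow> ?B (sq_sum u) (energy u)"
      using a b q by (intro tendsto_intros tendsto_powr2 A E) (auto intro: always_eventually)
    from LIMSEQ_le[OF P this] show "power_sum q u \<le> ?B (sq_sum u) (energy u)" using le by auto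
  qed
qed

end

section \<open>Compactness of maximizing sequences\<close>

lemma power_sum_pointwise_limit:
  fixes f :: "nat \<Rightarrow> 'a \<Rightarrow> real"
  assumes p: "p > 0" and lim: "\<And>x. (\<lambda>n. f n x) \<longlonglongrightarrow> g x"
    and s: "\<And>n. (\<lambda>x. \<bar>f n x\<bar> powr p) summable_on UNIV" and M: "\<And>n. power_sum p (f n) \<le> M"
  shows "(\<lambda>x. \<bar>g x\<bar> powr p) summable_on UNIV" "power_sum p g \<le> M"
proof -
  have "(\<Sum>x\<in>F. \<bar>g x\<bar> powr p) \<le> M" if F: "finite F" for F
  proof (rule LIMSEQ_le_const2)
    show "(\<lambda>n. \<Sum>x\<in>F. \<bar>f n x\<bar> powr p) \<longlonglongrightarrow> (\<Sum>x\<in>F. \<bar>g x\<bar> powr p)"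
      using p by (intro tendsto_sum tendsto_powr2 tendsto_rabs lim tendsto_const) auto
    have "(\<Sum>x\<in>F. \<bar>f n x\<bar> powr p) \<le> M" for n
      using M[of n] finite_sum_le_infsum[OF s F, of n] by (simp add: power_sum_def)
    thus "\<exists>N. \<forall>n\<ge>N. (\<Sum>x\<in>F. \<bar>f n x\<bar> powr p) \<le> M" by blast
  qed
  note bd = this
  show "(\<lambda>x. \<bar>g x\<bar> powr p) summable_on UNIV" by (rule summable_on_bounded_sums(1)[OF _ bd]) auto
  show "power_sum p g \<le> M" unfolding power_sum_def by (rule summable_on_bounded_sums(2)[OF _ bd]) auto
qed

lemma infsum_diff_real:
  fixes f g :: "'a \<Rightarrow> real"
  assumes "f summable_on A" "g summable_on A"
  shows "(\<lambda>x. f x - g x) summable_on A" "(\<Sum>\<^sub>\<infinity>x\<in>A. f x - g x) = infsum f A - infsum g A"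
  using summable_on_add[OF assms(1) summable_on_uminus[THEN iffD2, OF assms(2)]]
    infsum_add[OF assms(1) summable_on_uminus[THEN iffD2, OF assms(2)]] by (simp_all add: infsum_uminus)

text \<open>The defect \<open>D n\<close> is split into a part with factor t, whose sum is small
  uniformly in n, and an excess \<open>rem n\<close>, which is dominated by a multiple of the
  q-independent limit term and tends to 0 pointwise. Allowing both the remainder and the sequence in
  the first part lets \<open>powr_add_le\<close> serve in both directions, for every p > 0.\<close>

lemma Brezis_Lieb:
  fixes f :: "nat \<Rightarrow> 'a \<Rightarrow> real"
  assumes p: "p > 0" and lim: "\<And>x. (\<lambda>n. f n x) \<longlonglongrightarrow> g x"
    and s: "\<And>n. (\<lambda>x. \<bar>f n x\<bar> powr p) summable_on UNIV" and M: "\<And>n. power_sum p (f n) \<le> M"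
  shows "(\<lambda>n. power_sum p (f n) - power_sum p (\<lambda>x. f n x - g x)) \<longlonglongrightarrow> power_sum p g"
proof -
  note sg = power_sum_pointwise_limit[OF p lim s M]
  let ?w = "\<lambda>n x. f n x - g x"
  \<comment> \<open>Used with e = 1 only to bound the power sums of the remainders
    uniformly.\<close>
  obtain C1 where C1: "C1 \<ge> 0" "\<And>a b :: real. \<bar>a\<bar> powr p \<le> (1 + 1) * \<bar>b\<bar> powr p + C1 * \<bar>a - b\<bar> powr p"
    using powr_add_le[OF p zero_less_one] by blast
  have wle: "\<bar>?w n x\<bar> powr p \<le> 2 * \<bar>f n x\<bar> powr p + C1 * \<bar>g x\<bar> powr p" for n x
    using C1(2)[of "?w n x" "f n x"] by simp
  have s2: "(\<lambda>x. 2 * \<bar>f n x\<bar> powr p + C1 * \<bar>g x\<bar> powr p) summable_on UNIV" for n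
    by (intro summable_on_add summable_on_cmult_right s sg)
  have sw: "(\<lambda>x. \<bar>?w n x\<bar> powr p) summable_on UNIV" for n
    by (rule summable_on_comparison_real[OF s2[of n]]) (use wle in auto)
  define M' where "M' = 2 * M + C1 * M"
  have M': "power_sum p (?w n) \<le> M'" for n
  proof -
    have "power_sum p (?w n) \<le> (\<Sum>\<^sub>\<infinity>x. 2 * \<bar>f n x\<bar> powr p + C1 * \<bar>g x\<bar> powr p)"
      unfolding power_sum_def by (intro infsum_mono sw s2 wle)
    also have "\<dots> = 2 * power_sum p (f n) + C1 * power_sum p g"
      by (subst infsum_add) (auto simp: power_sum_def infsum_cmult_right' intro!: summable_on_cmult_right s sg)
    also have "\<dots> \<le> M'" unfolding M'_def
      by (intro add_mono mult_left_mono M sg C1) auto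
    finally show ?thesis .
  qed
  have M0: "M \<ge> 0" "M' \<ge> 0" using order_trans[OF power_sum_nonneg M] order_trans[OF power_sum_nonneg M'] by auto
  show ?thesis
  proof (rule LIMSEQ_I)
    fix e :: real assume e: "e > 0"
    \<comment> \<open>Chosen so that the uniformly controlled part stays below e / 2; the summand 1
      covers the case that both bounds are 0.\<close>
    define t where "t = e / (2 * (M + M' + 1))"
    have t: "t > 0" using e M0 by (simp add: t_def)
    have tM: "t * (M + M') < e / 2" using e M0 by (simp add: t_def field_simps)
    obtain C where C: "C \<ge> 0" "\<And>a b :: real. \<bar>a\<bar> powr p \<le> (1 + t) * \<bar>b\<bar> powr p + C * \<bar>a - b\<bar> powr p"
      using powr_add_le[OF p t] by blast
    define D where "D n x = \<bar>f n x\<bar> powr p - \<bar>?w n x\<bar> powr p - \<bar>g x\<bar> powr p" for n x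
    define rem where "rem n x = max 0 (\<bar>D n x\<bar> - t * (\<bar>?w n x\<bar> powr p + \<bar>f n x\<bar> powr p))" for n x
    have Dle: "\<bar>D n x\<bar> \<le> t * (\<bar>?w n x\<bar> powr p + \<bar>f n x\<bar> powr p) + (C + 1) * \<bar>g x\<bar> powr p" for n x
    proof -
      have 1: "\<bar>f n x\<bar> powr p \<le> (1 + t) * \<bar>?w n x\<bar> powr p + C * \<bar>g x\<bar> powr p"
        using C(2)[of "f n x" "?w n x"] by simp
      have 2: "\<bar>?w n x\<bar> powr p \<le> (1 + t) * \<bar>f n x\<bar> powr p + C * \<bar>g x\<bar> powr p"
        using C(2)[of "?w n x" "f n x"] by simp
      have "0 \<le> t * \<bar>?w n x\<bar> powr p" "0 \<le> t * \<bar>f n x\<bar> powr p" "0 \<le> C * \<bar>g x\<bar> powr p" "0 \<le> \<bar>g x\<bar> powr p"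
        using t C by auto
      thus ?thesis using 1 2 unfolding D_def abs_le_iff distrib_left distrib_right mult_1_left by linarith
    qed
    have rem_bd: "\<bar>rem n x\<bar> \<le> (C + 1) * \<bar>g x\<bar> powr p" for n x
      using Dle[of n x] C by (simp add: rem_def)
    have pw: "(\<lambda>n. rem n x) \<longlonglongrightarrow> 0" for x
    proof -
      have wl: "(\<lambda>n. \<bar>?w n x\<bar> powr p) \<longlonglongrightarrow> \<bar>g x - g x\<bar> powr p"
        using p by (intro tendsto_powr2 tendsto_rabs tendsto_diff lim tendsto_const) auto
      have fl: "(\<lambda>n. \<bar>f n x\<bar> powr p) \<longlonglongrightarrow> \<bar>g x\<bar> powr p"
        using p by (intro tendsto_powr2 tendsto_rabs lim tendsto_const) auto
      have "(\<lambda>n. rem n x) \<longlonglongrightarrow> max 0 (\<bar>\<bar>g x\<bar> powr p - \<bar>g x - g x\<bar> powr p - \<bar>g x\<bar> powr p\<bar> -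
          t * (\<bar>g x - g x\<bar> powr p + \<bar>g x\<bar> powr p))"
        unfolding rem_def D_def
        by (intro tendsto_max tendsto_diff tendsto_rabs tendsto_mult tendsto_add tendsto_const wl fl)
      thus ?thesis using t by (simp add: max_absorb1)
    qed
    have sC: "(\<lambda>x. (C + 1) * \<bar>g x\<bar> powr p) summable_on UNIV" by (intro summable_on_cmult_right sg)
    note dc = infsum_dominated_convergence[OF pw sC rem_bd]
    have "eventually (\<lambda>n. infsum (rem n) UNIV < e / 2) sequentially"
      using dc(3) e by (intro order_tendstoD) auto
    then obtain N where N: "\<And>n. n \<ge> N \<Longrightarrow> infsum (rem n) UNIV < e / 2" by (auto simp: eventually_sequentially)
    show "\<exists>N. \<forall>n\<ge>N. norm (power_sum p (f n) - power_sum p (?w n) - power_sum p g) < e"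
    proof (intro exI[of _ N] allI impI)
      fix n assume n: "n \<ge> N"
      let ?B = "\<lambda>x. rem n x + t * (\<bar>?w n x\<bar> powr p + \<bar>f n x\<bar> powr p)"
      have sB: "?B summable_on UNIV" by (intro summable_on_add summable_on_cmult_right dc(1) sw s)
      have DB: "\<bar>D n x\<bar> \<le> ?B x" for x by (simp add: rem_def)
      have sD: "D n summable_on UNIV" by (rule summable_on_comparison_real[OF sB DB])
      have "power_sum p (f n) - power_sum p (?w n) - power_sum p g = infsum (D n) UNIV"
        unfolding D_def power_sum_def by (simp add: infsum_diff_real s sw sg)
      also have "\<bar>\<dots>\<bar> \<le> infsum ?B UNIV"
      proof -
        have "infsum (D n) UNIV \<le> infsum ?B UNIV"
          using DB by (intro infsum_mono sD sB) (simp add: abs_le_iff)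
        moreover have "- infsum (D n) UNIV = infsum (\<lambda>x. - D n x) UNIV" by (simp add: infsum_uminus)
        moreover have "\<dots> \<le> infsum ?B UNIV"
          using DB by (intro infsum_mono sB summable_on_uminus[THEN iffD2] sD) (simp add: abs_le_iff)
        ultimately show ?thesis by simp
      qed
      also have "\<dots> = infsum (rem n) UNIV + t * (power_sum p (?w n) + power_sum p (f n))"
        unfolding power_sum_def
        by (simp add: infsum_add dc(1) sw s summable_on_add summable_on_cmult_right infsum_cmult_right')
      also have "\<dots> \<le> infsum (rem n) UNIV + t * (M' + M)"
        using t by (intro add_left_mono mult_left_mono add_mono M M') auto
      also have "\<dots> < e" using N[OF n] tM by (simp add: add.commute)
      finally show "norm (power_sum p (f n) - power_sum p (?w n) - power_sum p g) < e" by simp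
    qed
  qed
qed

text \<open>The left side is the power a + b of a weighted geometric mean in [0, 1]. An exponent of
  at least 1 can only decrease it, and Young's inequality bounds the mean.\<close>

lemma powr_product_le_convex:
  fixes s t a b :: real
  assumes "0 \<le> s" "s \<le> 1" "0 \<le> t" "t \<le> 1" and ab: "a > 0" "b > 0" "a + b \<ge> 1"
  shows "s powr a * t powr b \<le> a / (a + b) * s + b / (a + b) * t"
proof (cases "s = 0 \<or> t = 0")
  case True
  thus ?thesis using assms by auto
next
  case False
  let ?x = "s powr (a / (a + b)) * t powr (b / (a + b))"
  have st: "s > 0" "t > 0" using False assms by auto
  have x1: "?x \<le> 1" using assms st by (intro mult_le_one powr_le1) auto
  have x0: "?x > 0" using st by simp
  have "s powr a * t powr b = ?x powr (a + b)"
    using ab by (simp add: powr_mult powr_powr)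
  also have "\<dots> \<le> ?x powr 1" using x0 x1 ab by (intro powr_mono') auto
  also have "\<dots> = ?x" using x0 by simp
  also have "\<dots> \<le> a / (a + b) * s + b / (a + b) * t"
    using ab st by (intro Youngs_inequality_0) (auto simp: add_divide_distrib[symmetric])
  finally show ?thesis .
qed

text \<open>After division by the totals, the two shares of each variable add up to 1, and so do the
  two convex bounds.\<close>

lemma powr_product_superadditive:
  fixes x y x' y' a b :: real
  assumes nn: "0 \<le> x" "0 \<le> y" "0 \<le> x'" "0 \<le> y'" and ab: "a > 0" "b > 0" "a + b \<ge> 1"
  shows "x powr a * y powr b + x' powr a * y' powr b \<le> (x + x') powr a * (y + y') powr b"
proof (cases "x + x' = 0 \<or> y + y' = 0")
  case True
  hence "x = 0 \<and> x' = 0 \<or> y = 0 \<and> y' = 0" using nn by (auto simp: add_nonneg_eq_0_iff)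
  thus ?thesis by auto
next
  case False
  hence pos: "x + x' > 0" "y + y' > 0" using nn by auto
  let ?X = "x + x'" and ?Y = "y + y'"
  have e: "z powr a * w powr b = (z / ?X) powr a * (w / ?Y) powr b * (?X powr a * ?Y powr b)"
    if "z \<ge> 0" "w \<ge> 0" for z w
    using pos that by (simp add: powr_divide)
  have "(x / ?X) powr a * (y / ?Y) powr b + (x' / ?X) powr a * (y' / ?Y) powr b \<le>
      (a / (a + b) * (x / ?X) + b / (a + b) * (y / ?Y)) + (a / (a + b) * (x' / ?X) + b / (a + b) * (y' / ?Y))"
    using pos nn ab by (intro add_mono powr_product_le_convex) auto
  also have "\<dots> = a / (a + b) * ((x + x') / ?X) + b / (a + b) * ((y + y') / ?Y)"
    by (simp only: add_divide_distrib distrib_left)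
  also have "\<dots> = 1" using pos ab by (simp add: add_divide_distrib[symmetric])
  finally have "((x / ?X) powr a * (y / ?Y) powr b + (x' / ?X) powr a * (y' / ?Y) powr b) * (?X powr a * ?Y powr b)
      \<le> 1 * (?X powr a * ?Y powr b)" by (intro mult_right_mono) auto
  thus ?thesis using e[OF nn(1,2)] e[OF nn(3,4)] by (simp add: distrib_right)
qed

lemma energy_le_sq_sum:
  fixes u :: "int ^ 'd::finite \<Rightarrow> real"
  assumes u: "ell2 u" shows "energy u \<le> 4 * real CARD('d) * sq_sum u"
proof -
  have "infsum (sq_diff u i) UNIV \<le> 4 * sq_sum u" for i
  proof -
    have "infsum (sq_diff u i) UNIV = sq_sum (\<lambda>x. u (x + unit_vec i) - u x)"
      by (simp add: sq_sum_def sq_diff_def[abs_def])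
    also have "\<dots> \<le> 2 * sq_sum (\<lambda>x. u (x + unit_vec i)) + 2 * sq_sum u"
      by (intro sq_sum_diff_le ell2_shift u)
    finally show ?thesis by (simp add: sq_sum_shift)
  qed
  hence "energy u \<le> (\<Sum>i\<in>(UNIV :: 'd set). 4 * sq_sum u)" unfolding energy_def by (intro sum_mono)
  thus ?thesis by simp
qed

lemma scaled_translate:
  fixes u :: "int ^ 'd::finite \<Rightarrow> real"
  shows "ell2 u \<Longrightarrow> ell2 (\<lambda>x. c * u (x + z))"
    "sq_sum (\<lambda>x. c * u (x + z)) = c\<^sup>2 * sq_sum u"
    "energy (\<lambda>x. c * u (x + z)) = c\<^sup>2 * energy u"
    "power_sum p (\<lambda>x. c * u (x + z)) = \<bar>c\<bar> powr p * power_sum p u"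
proof -
  show "ell2 (\<lambda>x. c * u (x + z))" if "ell2 u"
    using ell2_shift[OF that, of z] by (simp add: ell2_def power_mult_distrib summable_on_cmult_right)
  show "sq_sum (\<lambda>x. c * u (x + z)) = c\<^sup>2 * sq_sum u"
    using sq_sum_shift[of u z] by (simp add: sq_sum_def power_mult_distrib infsum_cmult_right')
  have "sq_diff (\<lambda>x. c * u (x + z)) i = (\<lambda>x. c\<^sup>2 * sq_diff u i (x + z))" for i
    by (simp add: sq_diff_def fun_eq_iff power_mult_distrib[symmetric] right_diff_distrib add_ac)
  thus "energy (\<lambda>x. c * u (x + z)) = c\<^sup>2 * energy u"
    by (simp add: energy_def infsum_cmult_right' infsum_shift sum_distrib_left)
  show "power_sum p (\<lambda>x. c * u (x + z)) = \<bar>c\<bar> powr p * power_sum p u"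
    using infsum_shift[of "\<lambda>x. \<bar>u x\<bar> powr p" z]
    by (simp add: power_sum_def abs_mult powr_mult infsum_cmult_right')
qed

text \<open>The energy is a sum over directions of squared l2 norms of differences, and taking
  differences commutes with the splitting.\<close>

lemma energy_Brezis_Lieb:
  fixes f :: "nat \<Rightarrow> int ^ 'd::finite \<Rightarrow> real"
  assumes lim: "\<And>x. (\<lambda>n. f n x) \<longlonglongrightarrow> g x" and l: "\<And>n. ell2 (f n)" and M: "\<And>n. energy (f n) \<le> M"
  shows "(\<lambda>n. energy (f n) - energy (\<lambda>x. f n x - g x)) \<longlonglongrightarrow> energy g"
proof -
  let ?D = "\<lambda>u i x. u (x + unit_vec i) - u x :: real"
  have e: "infsum (sq_diff u i) UNIV = power_sum 2 (?D u i)" for u and i :: 'd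
    by (simp add: power_sum_2 sq_sum_def sq_diff_def[abs_def])
  have "(\<lambda>n. power_sum 2 (?D (f n) i) - power_sum 2 (\<lambda>x. ?D (f n) i x - ?D g i x)) \<longlonglongrightarrow> power_sum 2 (?D g i)" for i
  proof (rule Brezis_Lieb)
    show "(\<lambda>n. ?D (f n) i x) \<longlonglongrightarrow> ?D g i x" for x by (intro tendsto_diff lim)
    show "(\<lambda>x. \<bar>?D (f n) i x\<bar> powr 2) summable_on UNIV" for n
      using ell2_shift_diff[OF l[of n], of "unit_vec i"] unfolding ell2_iff .
    have "infsum (sq_diff (f n) i) UNIV \<le> energy (f n)" for n
      unfolding energy_def by (rule member_le_sum) (auto intro: infsum_nonneg)
    thus "power_sum 2 (?D (f n) i) \<le> M" for n unfolding e using M[of n] by (metis order_trans)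
  qed simp
  hence "(\<lambda>n. \<Sum>i\<in>UNIV. power_sum 2 (?D (f n) i) - power_sum 2 (?D (\<lambda>x. f n x - g x) i)) \<longlonglongrightarrow> (\<Sum>i\<in>UNIV. power_sum 2 (?D g i))"
    by (intro tendsto_sum) (simp add: algebra_simps)
  thus ?thesis by (simp add: energy_def e sum_subtractf)
qed

text \<open>The remainder obeys the inequality with constant \<open>K\<close> while the whole
  sequence nearly attains it, so superadditivity leaves the limit no room to fall short. For g = 0
  the conclusion is empty; nontriviality of the limit is supplied separately.\<close>

lemma concentration:
  fixes f :: "nat \<Rightarrow> int ^ 'd::finite \<Rightarrow> real"
  assumes q: "q \<ge> 2" and a: "a > 0" and b: "b > 0" and ab: "a + b = q / 2" and K: "K \<ge> 0"
    and GN: "\<And>u :: int ^ 'd \<Rightarrow> real. ell2 u \<Longrightarrow> power_sum q u \<le> K * (sq_sum u powr a * energy u powr b)"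
    and l: "\<And>n. ell2 (f n)" and N: "\<And>n. sq_sum (f n) = 1"
    and lim: "\<And>x. (\<lambda>n. f n x) \<longlonglongrightarrow> g x" and E: "(\<lambda>n. energy (f n)) \<longlonglongrightarrow> \<beta>"
    and \<kappa>: "\<kappa> \<longlonglongrightarrow> K" "\<And>n. \<kappa> n * energy (f n) powr b \<le> power_sum q (f n)"
  shows "ell2 g" "K * (sq_sum g powr a * energy g powr b) \<le> power_sum q g"
proof -
  let ?w = "\<lambda>n x. f n x - g x"
  have s2: "(\<lambda>x. \<bar>f n x\<bar> powr 2) summable_on UNIV" for n using l[of n] by (simp add: ell2_iff)
  have N2: "power_sum 2 (f n) \<le> 1" for n by (simp add: power_sum_2 N)
  have g: "ell2 g" unfolding ell2_iff by (rule power_sum_pointwise_limit(1)[OF _ lim s2 N2]) simp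
  thus "ell2 g" .
  have w: "ell2 (?w n)" for n by (intro sq_sum_diff_le(1) l g)
  have "(\<lambda>n. 1 - sq_sum (?w n)) \<longlonglongrightarrow> sq_sum g"
    using Brezis_Lieb[OF _ lim s2 N2] by (simp add: power_sum_2 N)
  from tendsto_diff[OF tendsto_const[of 1] this] have A: "(\<lambda>n. sq_sum (?w n)) \<longlonglongrightarrow> 1 - sq_sum g" by simp
  have Eb: "energy (f n) \<le> 4 * real CARD('d)" for n using energy_le_sq_sum[OF l[of n]] by (simp add: N)
  from tendsto_diff[OF E energy_Brezis_Lieb[OF lim l Eb]]
  have B: "(\<lambda>n. energy (?w n)) \<longlonglongrightarrow> \<beta> - energy g" by simp
  have A0: "1 - sq_sum g \<ge> 0" by (rule LIMSEQ_le_const[OF A]) auto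
  have B0: "\<beta> - energy g \<ge> 0" by (rule LIMSEQ_le_const[OF B]) auto
  have S: "(\<lambda>n. power_sum q (f n) - power_sum q (?w n)) \<longlonglongrightarrow> power_sum q g"
  proof (rule Brezis_Lieb[OF _ lim])
    show "(\<lambda>x. \<bar>f n x\<bar> powr q) summable_on UNIV" for n by (rule ell2_power_summable(1)[OF l q])
    show "power_sum q (f n) \<le> 1" for n using ell2_power_summable(2)[OF l q, of n] by (simp add: N)
  qed (use q in simp)
  \<comment> \<open>The near-optimal lower bound for the sequence minus the upper bound for the
    remainder; in the limit the remainder is left with mass 1 - \<open>sq_sum g\<close> and energy
    \<open>\<beta> - energy g\<close>.\<close>
  have "(\<lambda>n. \<kappa> n * energy (f n) powr b - K * (sq_sum (?w n) powr a * energy (?w n) powr b)) \<longlonglongrightarrow>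
      K * \<beta> powr b - K * ((1 - sq_sum g) powr a * (\<beta> - energy g) powr b)"
    using a b by (intro tendsto_intros tendsto_powr2 \<kappa>(1) A B E) (auto intro: always_eventually)
  moreover have "\<kappa> n * energy (f n) powr b - K * (sq_sum (?w n) powr a * energy (?w n) powr b) \<le>
      power_sum q (f n) - power_sum q (?w n)" for n
    using \<kappa>(2)[of n] GN[OF w[of n]] by linarith
  ultimately have "K * \<beta> powr b - K * ((1 - sq_sum g) powr a * (\<beta> - energy g) powr b) \<le> power_sum q g"
    using LIMSEQ_le[OF _ S] by blast
  \<comment> \<open>The total mass is 1, so only the power of the total energy survives on the
    right.\<close>
  moreover have "sq_sum g powr a * energy g powr b + (1 - sq_sum g) powr a * (\<beta> - energy g) powr b \<le> \<beta> powr b"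
    using powr_product_superadditive[OF sq_sum_nonneg[of g] energy_nonneg[of g] A0 B0 a b] ab q by simp
  from mult_left_mono[OF this K]
  have "K * (sq_sum g powr a * energy g powr b) + K * ((1 - sq_sum g) powr a * (\<beta> - energy g) powr b) \<le> K * \<beta> powr b"
    by (simp add: distrib_left)
  ultimately show "K * (sq_sum g powr a * energy g powr b) \<le> power_sum q g" by linarith
qed

text \<open>If every value were small, the power sum would be at most \<open>\<eta>\<close> times
  the squared l2 norm, by splitting off the exponent q - 2 > 0. This excludes vanishing
  sequences.\<close>

lemma exists_large_value:
  fixes u :: "'a \<Rightarrow> real"
  assumes q: "q > 2" and u: "ell2 u" "sq_sum u = 1" and \<eta>: "\<eta> > 0" "power_sum q u > \<eta>"
  obtains x where "\<bar>u x\<bar> \<ge> \<eta> powr (1 / (q - 2))"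
proof -
  have "\<exists>x. \<bar>u x\<bar> powr (q - 2) \<ge> \<eta>"
  proof (rule ccontr)
    assume "\<not> ?thesis"
    hence lt: "\<bar>u x\<bar> powr (q - 2) \<le> \<eta>" for x by (meson less_imp_le not_le)
    have "\<bar>u x\<bar> powr q \<le> \<eta> * (u x)\<^sup>2" for x
    proof -
      have "\<bar>u x\<bar> powr q = \<bar>u x\<bar> powr (q - 2) * \<bar>u x\<bar> powr 2" by (simp add: powr_add[symmetric] del: powr_numeral)
      also have "\<dots> \<le> \<eta> * \<bar>u x\<bar> powr 2" by (intro mult_right_mono lt) auto
      finally show ?thesis by (simp add: abs_powr_2)
    qed
    hence "power_sum q u \<le> (\<Sum>\<^sub>\<infinity>x. \<eta> * (u x)\<^sup>2)"
      unfolding power_sum_def using u q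
      by (intro infsum_mono ell2_power_summable summable_on_cmult_right) (auto simp: ell2_def)
    thus False using u \<eta> by (simp add: infsum_cmult_right' sq_sum_def)
  qed
  then obtain x where x: "\<bar>u x\<bar> powr (q - 2) \<ge> \<eta>" by blast
  have "\<eta> powr (1 / (q - 2)) \<le> (\<bar>u x\<bar> powr (q - 2)) powr (1 / (q - 2))"
    using x \<eta> q by (intro powr_mono2) auto
  also have "\<dots> = \<bar>u x\<bar>" using q by (simp add: powr_powr)
  finally show ?thesis by (rule that)
qed

context kernel_pair begin

text \<open>This is where the comparison with \<open>K_euclid\<close> enters: a sequence whose energy tends to \<open>0\<close>
  spreads out, and its quotient is asymptotically that of a function on Euclidean space.\<close>

lemma energy_lower_bound:
  assumes q: "2 < q" "ereal q < two_star CARD('d::finite)" and K: "K_euclid TYPE('d) q \<le> ereal k0" and k0: "k0 \<ge> 0"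
    and k1: "k1 > k0"
  obtains \<delta> where "\<delta> > 0" "\<And>u :: int ^ 'd \<Rightarrow> real. ell2 u \<Longrightarrow> u \<noteq> (\<lambda>_. 0) \<Longrightarrow> Q_lattice q u > k1 \<Longrightarrow> \<delta> * sq_sum u \<le> energy u"
proof -
  define d where "d = real CARD('d)"
  define a where "a = (d + (2 - d) * (q / 2)) / 2"
  define b where "b = (q / 2 - 1) * d / 2"
  have a: "a > 0" using subcritical_exponent_pos[OF q] by (simp add: a_def d_def)
  have ab: "a + b = q / 2" by (simp add: a_def b_def field_simps)
  \<comment> \<open>Makes (1 + e) * k0 at most the midpoint of \<open>k0\<close> and
    \<open>k1\<close>; the summand 1 allows k0 = 0.\<close>
  define e where "e = (k1 - k0) / (2 * (k0 + 1))"
  have e: "e > 0" using k0 k1 by (simp add: e_def)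
  have "e * k0 \<le> e * (k0 + 1)" using e by (intro mult_left_mono) auto
  also have "\<dots> = (k1 - k0) / 2" using k0 by (simp add: e_def divide_simps)
  finally have ek: "(1 + e) * k0 \<le> (k0 + k1) / 2" by (simp add: algebra_simps)
  obtain C where C: "C \<ge> 0" "\<And>u :: int ^ 'd \<Rightarrow> real. ell2 u \<Longrightarrow> power_sum q u \<le>
    (1 + e) * (k0 * (sq_sum u powr a * energy u powr b)) + C * energy u powr (q / 2)"
    using small_gradient_bound[OF q K k0 e] unfolding a_def b_def d_def by blast
  \<comment> \<open>The ratio that remains once half of the gap k1 - k0 is compared with the error
    constant; the summand 1 allows C = 0.\<close>
  define \<tau> where "\<tau> = (k1 - k0) / (2 * (C + 1))"
  have \<tau>: "\<tau> > 0" using k1 C(1) by (simp add: \<tau>_def)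
  show ?thesis
  proof (rule that[of "\<tau> powr (1 / a)"])
    show "\<tau> powr (1 / a) > 0" using \<tau> by simp
    fix u :: "int ^ 'd \<Rightarrow> real" assume u: "ell2 u" "u \<noteq> (\<lambda>_. 0)" and Q: "Q_lattice q u > k1"
    note pos = ell2_nonzero_pos[OF u]
    let ?N = "sq_sum u" and ?E = "energy u"
    have D: "?N powr a * ?E powr b > 0" using pos by simp
    have "k1 * (?N powr a * ?E powr b) < power_sum q u"
      using Q D unfolding Q_lattice_subcritical[OF q u(1)] d_def[symmetric] a_def[symmetric] b_def[symmetric]
      by (simp add: pos_less_divide_eq)
    also have "\<dots> \<le> ((1 + e) * k0) * (?N powr a * ?E powr b) + C * ?E powr (q / 2)"
      using C(2)[OF u(1)] by (simp add: mult.assoc)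
    also have "\<dots> \<le> (k0 + k1) / 2 * (?N powr a * ?E powr b) + (C + 1) * ?E powr (q / 2)"
      using ek D by (intro add_mono mult_right_mono) auto
    finally have "(k1 - k0) / 2 * (?N powr a * ?E powr b) \<le> (C + 1) * ?E powr (q / 2)"
      by (simp add: field_simps)
    \<comment> \<open>The error contains the same factor E powr b as the denominator. Cancelling it
      leaves N powr a against E powr a, and a > 0 permits taking the root.\<close>
    also have "?E powr (q / 2) = ?E powr a * ?E powr b" unfolding ab[symmetric] by (rule powr_add)
    finally have "((k1 - k0) / 2 * ?N powr a) * ?E powr b \<le> ((C + 1) * ?E powr a) * ?E powr b"
      by (simp add: mult_ac)
    hence "(k1 - k0) / 2 * ?N powr a \<le> (C + 1) * ?E powr a"
      using pos by (subst (asm) mult_le_cancel_right) auto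
    hence "\<tau> * ?N powr a \<le> ?E powr a" using C(1) by (simp add: \<tau>_def field_simps)
    hence "(\<tau> * ?N powr a) powr (1 / a) \<le> (?E powr a) powr (1 / a)"
      using a \<tau> by (intro powr_mono2) auto
    thus "\<tau> powr (1 / a) * ?N \<le> ?E" using a \<tau> pos by (simp add: powr_mult powr_powr)
  qed
qed

lemma K_lattice_attained:
  fixes u0 :: "int ^ 'd::finite \<Rightarrow> real"
  assumes q: "2 < q" "ereal q < two_star CARD('d)"
    and u0: "u0 \<in> H1_lattice - {\<lambda>_. 0}" "K_euclid TYPE('d) q \<le> ereal (Q_lattice q u0)"
  shows "\<exists>u \<in> H1_lattice - {\<lambda>_ :: int ^ 'd. 0}. ereal (Q_lattice q u) = K_lattice TYPE('d) q"
proof (cases "ereal (Q_lattice q u0) = K_lattice TYPE('d) q")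
  case True
  thus ?thesis using u0 by blast
next
  case False
  have upper: "ereal (Q_lattice q u) \<le> K_lattice TYPE('d) q" if "ell2 u" "u \<noteq> (\<lambda>_. 0)" for u :: "int ^ 'd \<Rightarrow> real"
    using K_lattice_upper[OF that(2), of q] that q by simp
  have K_eq: "K_lattice TYPE('d) q = (SUP u \<in> {u. ell2 u} - {\<lambda>_ :: int ^ 'd. 0}. ereal (Q_lattice q u))"
    unfolding K_lattice_def using q by (simp add: H1_lattice_eq)
  \<comment> \<open>The quotient of the given function serves as the real upper bound for
    \<open>K_euclid\<close>.\<close>
  define k0 where "k0 = Q_lattice q u0"
  have k0: "k0 \<ge> 0" unfolding k0_def by (rule Q_lattice_nonneg)
  have "ereal k0 < K_lattice TYPE('d) q"
    using upper[of u0] u0 False by (simp add: k0_def H1_lattice_eq order_less_le)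
  \<comment> \<open>The strict gap above \<open>k0\<close> is what \<open>energy_lower_bound\<close>
    requires: functions with quotient above \<open>k1\<close> have energy comparable to their
    mass.\<close>
  then obtain k1 where k1: "k0 < k1" "ereal k1 < K_lattice TYPE('d) q"
    by (metis ereal_dense2 ereal_less(2) less_ereal.simps(1))
  obtain \<delta> where \<delta>: "\<delta> > 0" "\<And>u :: int ^ 'd \<Rightarrow> real. ell2 u \<Longrightarrow> u \<noteq> (\<lambda>_. 0) \<Longrightarrow> Q_lattice q u > k1 \<Longrightarrow> \<delta> * sq_sum u \<le> energy u"
    using energy_lower_bound[OF q u0(2)[folded k0_def] k0 k1(1)] by blast
  define d where "d = real CARD('d)"
  define a where "a = (d + (2 - d) * (q / 2)) / 2"
  define b where "b = (q / 2 - 1) * d / 2"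
  have a: "a > 0" using subcritical_exponent_pos[OF q] by (simp add: a_def d_def)
  have b: "b > 0" using q by (simp add: b_def d_def)
  have ab: "a + b = q / 2" by (simp add: a_def b_def field_simps)
  have q2: "q \<ge> 2" using q by simp
  have Q: "Q_lattice q u = power_sum q u / (sq_sum u powr a * energy u powr b)" if "ell2 u" for u :: "int ^ 'd \<Rightarrow> real"
    unfolding Q_lattice_subcritical[OF q that] a_def b_def d_def ..
  \<comment> \<open>Above \<open>k1\<close>, the embedding of l2 bounds the quotient by the power -b
    of E / N, hence by that power of \<open>\<delta>\<close>. This makes \<open>K_lattice\<close>
    finite.\<close>
  define bound where "bound = max k1 (\<delta> powr (- b))"
  have "Q_lattice q u \<le> bound" if u: "ell2 u" "u \<noteq> (\<lambda>_. 0)" for u :: "int ^ 'd \<Rightarrow> real"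
  proof (cases "Q_lattice q u > k1")
    case True
    note pos = ell2_nonzero_pos[OF u]
    have "power_sum q u \<le> sq_sum u powr a * sq_sum u powr b"
      using ell2_power_summable(2)[OF u(1) q2] unfolding ab[symmetric] powr_add .
    hence "Q_lattice q u \<le> (sq_sum u powr a * sq_sum u powr b) / (sq_sum u powr a * energy u powr b)"
      unfolding Q[OF u(1)] by (intro divide_right_mono) auto
    also have "\<dots> = (energy u / sq_sum u) powr (- b)"
      using pos by (simp add: powr_divide powr_minus divide_simps)
    also have "\<dots> \<le> \<delta> powr (- b)"
      using \<delta>(2)[OF u True] \<delta>(1) b pos by (intro powr_mono2') (auto simp: field_simps)
    finally show ?thesis by (simp add: bound_def)
  qed (simp add: bound_def)
  hence "K_lattice TYPE('d) q \<le> ereal bound"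
    unfolding K_eq by (intro SUP_least) simp
  then obtain K where K: "K_lattice TYPE('d) q = ereal K"
    using k1 by (cases "K_lattice TYPE('d) q") auto
  have K1: "K > k1" using k1 K by simp
  have GN: "power_sum q u \<le> K * (sq_sum u powr a * energy u powr b)" if u: "ell2 u" for u :: "int ^ 'd \<Rightarrow> real"
  proof (cases "u = (\<lambda>_. 0)")
    case True
    thus ?thesis using q by (simp add: power_sum_def sq_sum_def)
  next
    case False
    have "Q_lattice q u \<le> K" using upper[OF u False] K by simp
    thus ?thesis using ell2_nonzero_pos[OF u False] unfolding Q[OF u] by (simp add: pos_divide_le_eq)
  qed
  \<comment> \<open>The lower bound for the power sum of a normalized function with quotient above
    \<open>k1\<close>, whose energy is at least \<open>\<delta>\<close>.\<close>
  define \<eta> where "\<eta> = k1 * \<delta> powr b"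
  have \<eta>: "\<eta> > 0" using k0 k1 \<delta> by (simp add: \<eta>_def)
  \<comment> \<open>The maximum with \<open>k1\<close> keeps every member of the maximizing sequence
    in the range of the energy bound without changing the limit \<open>K\<close>.\<close>
  define \<kappa> where "\<kappa> n = max k1 (K - level n)" for n
  have "\<exists>f :: int ^ 'd \<Rightarrow> real. ell2 f \<and> sq_sum f = 1 \<and> \<kappa> n * energy f powr b \<le> power_sum q f \<and>
      \<eta> powr (1 / (q - 2)) \<le> \<bar>f 0\<bar>" for n
  proof -
    have "ereal (\<kappa> n) < (SUP u \<in> {u. ell2 u} - {\<lambda>_ :: int ^ 'd. 0}. ereal (Q_lattice q u))"
      using K1 level_props(1)[of n] unfolding K_eq[symmetric] K by (simp add: \<kappa>_def del: ereal_max)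
    then obtain v :: "int ^ 'd \<Rightarrow> real" where v: "ell2 v" "v \<noteq> (\<lambda>_. 0)" "\<kappa> n < Q_lattice q v"
      by (auto simp: less_SUP_iff)
    note pos = ell2_nonzero_pos[OF v(1,2)]
    define c where "c = 1 / sqrt (sq_sum v)"
    have c: "c > 0" "c\<^sup>2 = 1 / sq_sum v" using pos by (auto simp: c_def power_divide)
    \<comment> \<open>All translates have the same mass, energy and power sum; the shift is chosen
      afterwards so that the large value sits at the origin.\<close>
    define h where "h z x = c * v (x + z)" for z x
    have h: "ell2 (h z)" "sq_sum (h z) = 1" "energy (h z) = c\<^sup>2 * energy v" "power_sum q (h z) = c powr q * power_sum q v" for z
      unfolding h_def using scaled_translate(1)[OF v(1)] scaled_translate(2-4)[where c = c and u = v and z = z] c pos by auto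
    have "\<kappa> n * (sq_sum v powr a * energy v powr b) < power_sum q v"
      using v(3) pos unfolding Q[OF v(1)] by (simp add: pos_less_divide_eq)
    hence "c powr q * (\<kappa> n * (sq_sum v powr a * energy v powr b)) < c powr q * power_sum q v"
      using c by (intro mult_strict_left_mono) auto
    moreover have "c powr q * (sq_sum v powr a * energy v powr b) = (c\<^sup>2 * sq_sum v) powr a * (c\<^sup>2 * energy v) powr b"
    proof -
      have "q = 2 * a + 2 * b" using ab by simp
      hence "c powr q = c powr (2 * a) * c powr (2 * b)" by (simp only: powr_add)
      moreover have "c powr (2 * a) = c\<^sup>2 powr a" "c powr (2 * b) = c\<^sup>2 powr b"
        using powr_powr[of c 2] c(1) by simp_all
      ultimately show ?thesis using c(1) pos by (simp add: powr_mult mult_ac)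
    qed
    ultimately have S: "\<kappa> n * energy (h z) powr b < power_sum q (h z)" for z
      using c pos by (simp add: h mult.left_commute)
    have "\<delta> \<le> energy v / sq_sum v" using \<delta>(2)[OF v(1,2)] v(3) pos by (simp add: \<kappa>_def pos_le_divide_eq)
    hence "\<delta> \<le> energy (h 0)" by (simp add: h c(2))
    hence "\<delta> powr b \<le> energy (h 0) powr b" using \<delta> b by (intro powr_mono2) auto
    hence "\<eta> \<le> \<kappa> n * energy (h 0) powr b"
      unfolding \<eta>_def \<kappa>_def using k0 k1 by (intro mult_mono) auto
    hence "\<eta> < power_sum q (h 0)" using S[of 0] by linarith
    then obtain x where "\<bar>h 0 x\<bar> \<ge> \<eta> powr (1 / (q - 2))"
      using exists_large_value[OF q(1) h(1,2) \<eta>] by blast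
    hence "\<eta> powr (1 / (q - 2)) \<le> \<bar>h x 0\<bar>" by (simp add: h_def)
    thus ?thesis using h(1,2)[of x] S[of x] by (intro exI[of _ "h x"]) auto
  qed
  then obtain f :: "nat \<Rightarrow> int ^ 'd \<Rightarrow> real" where f: "\<And>n. ell2 (f n)" "\<And>n. sq_sum (f n) = 1"
    "\<And>n. \<kappa> n * energy (f n) powr b \<le> power_sum q (f n)" "\<And>n. \<eta> powr (1 / (q - 2)) \<le> \<bar>f n 0\<bar>"
    by metis
  \<comment> \<open>The energies are adjoined as one extra coordinate, so a single diagonal
    extraction over a countable index set makes both the energies and all point values
    converge.\<close>
  define F where "F n w = (case w of None \<Rightarrow> energy (f n) | Some x \<Rightarrow> f n x)" for n w
  have "norm (F n w) \<le> 4 * d" for n w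
  proof (cases w)
    case None
    thus ?thesis using energy_le_sq_sum[OF f(1)[of n]] by (simp add: F_def f(2) d_def)
  next
    case (Some x)
    have "(f n x)\<^sup>2 \<le> 1"
      using infsum_member_le[where f = "\<lambda>x. (f n x)\<^sup>2"] f(1)[of n] f(2)[of n] by (simp add: ell2_def sq_sum_def)
    hence "\<bar>f n x\<bar> \<le> 1" by (simp add: abs_square_le_1)
    moreover have "d \<ge> 1" by (simp add: d_def Suc_leI)
    ultimately show ?thesis using Some by (simp add: F_def)
  qed
  hence F: "\<And>n w. w \<in> UNIV \<Longrightarrow> norm (F n w) \<le> 4 * d" by blast
  obtain s where s: "strict_mono (s :: nat \<Rightarrow> nat)" "\<And>w. \<exists>l. (\<lambda>n. F (s n) w) \<longlonglongrightarrow> l"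
    by (rule function_convergent_subsequence[where f = F and S = UNIV and M = "4 * d", OF countableI_type F]) simp_all
  then obtain l where l: "\<And>w. (\<lambda>n. F (s n) w) \<longlonglongrightarrow> l w" by metis
  define g where "g x = l (Some x)" for x
  have lim: "(\<lambda>n. f (s n) x) \<longlonglongrightarrow> g x" for x using l[of "Some x"] by (simp add: F_def g_def)
  have E: "(\<lambda>n. energy (f (s n))) \<longlonglongrightarrow> l None" using l[of None] by (simp add: F_def)
  have "\<kappa> \<longlonglongrightarrow> max k1 (K - 0)" unfolding \<kappa>_def by (intro tendsto_intros level_props(2))
  hence \<kappa>: "(\<lambda>n. \<kappa> (s n)) \<longlonglongrightarrow> K" using LIMSEQ_subseq_LIMSEQ[OF _ s(1)] K1 by (auto simp: o_def)
  \<comment> \<open>At this point the constant is known to be finite and nonnegative, so its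
    inequality can be applied to the remainders of the maximizing sequence.\<close>
  have K0: "K \<ge> 0" using k0 k1 K1 by simp
  note conc = concentration[OF q2 a b ab K0 GN f(1) f(2) lim E \<kappa> f(3)]
  have "\<eta> powr (1 / (q - 2)) \<le> \<bar>g 0\<bar>"
    by (rule LIMSEQ_le_const[OF tendsto_rabs[OF lim]]) (use f(4) in auto)
  hence "g 0 \<noteq> 0" using \<eta> by auto
  hence nz: "g \<noteq> (\<lambda>_. 0)" by auto
  have lg: "ell2 g" by (rule conc(1))
  have "K \<le> power_sum q g / (sq_sum g powr a * energy g powr b)"
    using conc(2) ell2_nonzero_pos[OF lg nz] by (simp add: pos_le_divide_eq)
  hence "K \<le> Q_lattice q g" using Q[OF lg] by simp
  hence "ereal (Q_lattice q g) = K_lattice TYPE('d) q" using upper[OF lg nz] K by simp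
  thus ?thesis using lg nz by (intro bexI[of _ g]) (auto simp: H1_lattice_eq)
qed

end

theorem theorem1p7:
  fixes q :: real
  shows "((2 < q \<and> ereal q < two_star CARD('d::finite)) \<or>
            (CARD('d) \<ge> 3 \<and> ereal q = two_star CARD('d)) \<longrightarrow>
          K_lattice TYPE('d) q \<ge> K_euclid TYPE('d) q) \<and>
         (2 < q \<and> ereal q < two_star CARD('d) \<longrightarrow>
          (\<exists>u \<in> H1_lattice - {\<lambda>_ :: int ^ 'd. 0}. ereal (Q_lattice q u) \<ge> K_euclid TYPE('d) q) \<longrightarrow>
          (\<exists>u \<in> H1_lattice - {\<lambda>_ :: int ^ 'd. 0}. ereal (Q_lattice q u) = K_lattice TYPE('d) q))"
proof -
  obtain r R where rR: "unit_kernel r" "unit_kernel R"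
    "\<And>t. (R has_real_derivative r t - r (t - 1)) (at t)"
    by (rule unit_kernel_pair_exists) blast
  interpret kernel_pair r R by unfold_locales (use rR in auto)
  show ?thesis
    using K_euclid_le_K_lattice[where 'd = 'd, of q] K_lattice_attained[where 'd = 'd, of q] by blast
qed

end
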